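(* Let $D$ be a weighted oriented graph with vertex set $\{x_1,\dots,x_n\}$ such that its edge ideal $I=I(D)\subseteq R=\mathbb{K}[x_1,\dots,x_n]$ is vertex splittable, with a vertex splitting $I=x_1I_1+I_2$, where $x_1$ is a splitting variable and $I_2\subseteq I_1$. Then $HS_1(I)$ has linear quotients if and only if none of $D_6$, $D_7$, $D_8$ is an induced subgraph of $D$.
   Context: $\mathbb{K}$ is a field. A weighted oriented graph $D$ is a finite simple graph $G$ (the underlying graph) in which each edge is given exactly one orientation, with a weight function $w:V(D)\to\{1,2,\dots\}$, $w_i=w(x_i)$; $(x_i,x_j)\in E(D)$ means the edge is oriented $x_i\to x_j$. Sources (vertices with no incoming edge) of $D$ are assumed to have weight $1$. The edge ideal is $I(D)=(x_ix_j^{w_j} : (x_i,x_j)\in E(D))$. For a monomial ideal $J$, $\mathcal{G}(J)$ is its minimal monomial generating set. $J$ has linear quotients if there is an order $u_1<\dots<u_m$ of $\mathcal{G}(J)$ such that $(u_1,\dots,u_{i-1}):u_i$ is generated by a subset of the variables for $i=2,\dots,m$ (the zero ideal has linear quotients). The $k$th homological shift ideal is $HS_k(J)=(\mathbf{x}^{\mathbf{a}} : \beta_{k,\mathbf{a}}(J)\ne 0)$, where $\beta_{k,\mathbf{a}}(J)$ are the multigraded Betti numbers of the minimal $\mathbb{N}^n$-graded free resolution of $J$. A monomial ideal $J\subseteq\mathbb{K}[X]$ is vertex splittable if it is obtained recursively as follows: (1) $(v)$ for a monomial $v$, $(0)$ and $\mathbb{K}[X]$ are vertex splittable; (2) if there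 are a variable $x\in X$ and vertex splittable ideals $J_1,J_2$ of $\mathbb{K}[X\setminus\{x\}]$ with $J=xJ_1+J_2$, $J_2\subseteq J_1$ and $\mathcal{G}(J)=\mathcal{G}(xJ_1)\sqcup\mathcal{G}(J_2)$, then $J$ is vertex splittable; such an expression is a vertex splitting of $J$ and $x$ is a splitting variable. The patterns are: $D_6$: vertices $x_1,x_2,x_3,x_4$, edges $x_1\to x_2\to x_3\to x_4$, with $w(x_2)>1$, $w(x_3)=1$, $w(x_4)>1$. $D_7$: vertices $x_1,x_2,x_3$, edges $x_1\to x_2\to x_3\to x_1$, with $w(x_1)=1$, $w(x_2)>2$, $w(x_3)>2$. $D_8$: vertices $x_1,x_2,x_3,x_4$, edges $x_2\to x_1$, $x_3\to x_4$ and an edge between $x_2$ and $x_3$ of either orientation, with $w(x_1)>1$, $w(x_2)=w(x_3)=1$, $w(x_4)>1$. $D_i$ is an induced subgraph of $D$ if for some $A\subseteq V(D)$ the induced weighted oriented subgraph $D[A]$ (with inherited orientations and weights) is, up to renaming vertices, of the form $D_i$ for some weights satisfying the listed conditions (no condition on unlisted weights).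
   Formalization: In an induced subgraph D[A], vertices that become sources are given weight 1 rather than their inherited weight, so in D_8 the source end of the edge between x_2 and x_3 may have any weight in D; with strictly inherited weights the equivalence fails. *)

theory Defs
  imports Main "HOL-Library.Poly_Mapping"
begin

text \<open>
  The polynomial ring \<open>R = K[x\<^sub>1,\<dots>,x\<^sub>n]\<close> is the type \<open>('v, 'k) mpoly\<close> below with \<open>'v\<close> a finite type
  (the set of variables) and \<open>'k\<close> a field. An element of \<open>'v \<Rightarrow>\<^sub>0 nat\<close> is an exponent vector in
  \<open>\<nat>\<^sup>n\<close>, and multiplication of polynomials is the convolution product.
\<close>

type_synonym 'v expo = "'v \<Rightarrow>\<^sub>0 nat"
type_synonym ('v, 'k) mpoly = "'v expo \<Rightarrow>\<^sub>0 'k"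

definition monom :: "'v expo \<Rightarrow> ('v, 'k::field) mpoly" where
  "monom a = Poly_Mapping.single a 1"

definition var :: "'v \<Rightarrow> ('v, 'k::field) mpoly" where
  "var x = monom (Poly_Mapping.single x 1)"

text \<open>For a set \<open>Y\<close> of variables, \<open>poly_ring Y\<close> is the subring \<open>K[Y]\<close> of \<open>R\<close>.\<close>

definition poly_ring :: "'v set \<Rightarrow> ('v, 'k::field) mpoly set" where
  "poly_ring Y = {p. \<forall>a\<in>Poly_Mapping.keys p. Poly_Mapping.keys a \<subseteq> Y}"

definition monomials :: "'v set \<Rightarrow> ('v, 'k::field) mpoly set" where
  "monomials Y = {monom a | a. Poly_Mapping.keys a \<subseteq> Y}"

text \<open>\<open>ideal_gen Y B\<close> is the ideal of \<open>K[Y]\<close> generated by a set \<open>B \<subseteq> K[Y]\<close>.\<close>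

definition ideal_gen :: "'v set \<Rightarrow> ('v, 'k::field) mpoly set \<Rightarrow> ('v, 'k) mpoly set" where
  "ideal_gen Y B = {(\<Sum>b\<in>F. q b * b) | F q. finite F \<and> F \<subseteq> B \<and> q ` F \<subseteq> poly_ring Y}"

definition colon :: "('v, 'k::field) mpoly set \<Rightarrow> ('v, 'k) mpoly \<Rightarrow> ('v, 'k) mpoly set" where
  "colon J u = {p. p * u \<in> J}"

text \<open>
  \<open>min_gens Y J\<close> is \<open>\<G>(J)\<close> for a monomial ideal \<open>J\<close> of \<open>K[Y]\<close>. It is meaningful only for monomial
  ideals, for which the minimal set of monomial generators exists and is unique.
\<close>

definition min_gens :: "'v set \<Rightarrow> ('v, 'k::field) mpoly set \<Rightarrow> ('v, 'k) mpoly set" where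
  "min_gens Y J = (THE G. G \<subseteq> monomials Y \<and> ideal_gen Y G = J \<and>
                          (\<forall>G'. G' \<subset> G \<longrightarrow> ideal_gen Y G' \<noteq> J))"

definition linear_quotients :: "('v, 'k::field) mpoly set \<Rightarrow> bool" where
  "linear_quotients J \<longleftrightarrow>
     (\<exists>us. distinct us \<and> set us = min_gens UNIV J \<and>
           (\<forall>i. 1 \<le> i \<and> i < length us \<longrightarrow>
                (\<exists>S. colon (ideal_gen UNIV (set (take i us))) (us ! i) = ideal_gen UNIV (var ` S))))"


section \<open>Minimal multigraded free resolutions and homological shift ideals\<close>

text \<open>
  A sequence of finitely generated \<open>\<nat>\<^sup>n\<close>-graded free \<open>R\<close>-modules
  \<open>\<dots> \<rightarrow> F\<^sub>2 \<rightarrow> F\<^sub>1 \<rightarrow> F\<^sub>0 \<rightarrow> R\<close> is given by its matrices: the basis of \<open>F\<^sub>k\<close> is indexed by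
  \<open>{i. i < frank F k}\<close>, its \<open>i\<close>th element has multidegree \<open>fdeg F k i\<close>; \<open>faug F j \<in> R\<close> is the
  image of the \<open>j\<close>th basis element of \<open>F\<^sub>0\<close>, and \<open>fdiff F k i j\<close> is the coefficient of the \<open>i\<close>th
  basis element of \<open>F\<^sub>k\<close> in the image of the \<open>j\<close>th basis element of \<open>F\<^bsub>k+1\<^esub>\<close>. Values at
  indices outside these ranges are irrelevant.
\<close>

record (overloaded) ('v, 'k) graded_free_seq =
  frank :: "nat \<Rightarrow> nat"
  fdeg  :: "nat \<Rightarrow> nat \<Rightarrow> 'v expo"
  faug  :: "nat \<Rightarrow> ('v, 'k) mpoly"
  fdiff :: "nat \<Rightarrow> nat \<Rightarrow> nat \<Rightarrow> ('v, 'k) mpoly"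

definition free_mod :: "('v, 'k::field) graded_free_seq \<Rightarrow> nat \<Rightarrow> (nat \<Rightarrow> ('v, 'k) mpoly) set" where
  "free_mod F k = {v. \<forall>i\<ge>frank F k. v i = 0}"

definition aug_map :: "('v, 'k::field) graded_free_seq \<Rightarrow> (nat \<Rightarrow> ('v, 'k) mpoly) \<Rightarrow> ('v, 'k) mpoly" where
  "aug_map F v = (\<Sum>j<frank F 0. v j * faug F j)"

text \<open>\<open>diff_map F k\<close> is the differential \<open>F\<^bsub>k+1\<^esub> \<rightarrow> F\<^sub>k\<close>.\<close>

definition diff_map ::
  "('v, 'k::field) graded_free_seq \<Rightarrow> nat \<Rightarrow> (nat \<Rightarrow> ('v, 'k) mpoly) \<Rightarrow> nat \<Rightarrow> ('v, 'k) mpoly" where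
  "diff_map F k v = (\<lambda>i. if i < frank F k then (\<Sum>j<frank F (Suc k). v j * fdiff F k i j) else 0)"

text \<open>The maps are homogeneous of multidegree \<open>0\<close>; here \<open>J \<subseteq> R\<close> carries the grading of \<open>R\<close>.\<close>

definition multigraded :: "('v, 'k::field) graded_free_seq \<Rightarrow> bool" where
  "multigraded F \<longleftrightarrow>
     (\<forall>j<frank F 0. \<forall>m\<in>Poly_Mapping.keys (faug F j). m = fdeg F 0 j) \<and>
     (\<forall>k. \<forall>i<frank F k. \<forall>j<frank F (Suc k).
        \<forall>m\<in>Poly_Mapping.keys (fdiff F k i j). m + fdeg F k i = fdeg F (Suc k) j)"

definition resolves :: "('v, 'k::field) graded_free_seq \<Rightarrow> ('v, 'k) mpoly set \<Rightarrow> bool" where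
  "resolves F J \<longleftrightarrow>
     aug_map F ` free_mod F 0 = J \<and>
     diff_map F 0 ` free_mod F 1 = {v \<in> free_mod F 0. aug_map F v = 0} \<and>
     (\<forall>k. diff_map F (Suc k) ` free_mod F (Suc (Suc k)) =
            {v \<in> free_mod F (Suc k). diff_map F k v = (\<lambda>_. 0)})"

text \<open>Minimality: the image of \<open>F\<^bsub>k+1\<^esub>\<close> lies in \<open>\<mm> F\<^sub>k\<close>, where \<open>\<mm>\<close> is generated by the variables.\<close>

definition minimal_resolution :: "('v, 'k::field) graded_free_seq \<Rightarrow> ('v, 'k) mpoly set \<Rightarrow> bool" where
  "minimal_resolution F J \<longleftrightarrow>
     multigraded F \<and> resolves F J \<and>
     (\<forall>k. \<forall>i<frank F k. \<forall>j<frank F (Suc k). fdiff F k i j \<in> ideal_gen UNIV (range var))"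

text \<open>
  Every monomial ideal has a minimal multigraded free resolution, unique up to isomorphism, so the
  choice made here does not affect the Betti numbers.
\<close>

definition betti :: "nat \<Rightarrow> 'v expo \<Rightarrow> ('v, 'k::field) mpoly set \<Rightarrow> nat" where
  "betti k a J =
     (let F = (SOME F. minimal_resolution F J) in card {i. i < frank F k \<and> fdeg F k i = a})"

definition HS :: "nat \<Rightarrow> ('v, 'k::field) mpoly set \<Rightarrow> ('v, 'k) mpoly set" where
  "HS k J = ideal_gen UNIV {monom a | a. betti k a J \<noteq> 0}"


section \<open>Vertex splittable ideals\<close>

text \<open>
  \<open>splits Y x J1 J2 J\<close>: \<open>J = x J\<^sub>1 + J\<^sub>2\<close> in \<open>K[Y]\<close>, \<open>J\<^sub>2 \<subseteq> J\<^sub>1\<close> and \<open>\<G>(J) = \<G>(x J\<^sub>1) \<squnion> \<G>(J\<^sub>2)\<close>,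
  where \<open>J\<^sub>1, J\<^sub>2\<close> are ideals of \<open>K[Y \ {x}]\<close>; in the expression \<open>x J\<^sub>1 + J\<^sub>2\<close> they are extended to \<open>K[Y]\<close>.
\<close>

definition splits ::
  "'v set \<Rightarrow> 'v \<Rightarrow> ('v, 'k::field) mpoly set \<Rightarrow> ('v, 'k) mpoly set \<Rightarrow> ('v, 'k) mpoly set \<Rightarrow> bool" where
  "splits Y x J1 J2 J \<longleftrightarrow>
     (let xJ1 = ideal_gen Y ((\<lambda>p. var x * p) ` J1) in
        J = {a + b | a b. a \<in> xJ1 \<and> b \<in> ideal_gen Y J2} \<and>
        J2 \<subseteq> J1 \<and>
        min_gens Y J = min_gens Y xJ1 \<union> min_gens (Y - {x}) J2 \<and>
        min_gens Y xJ1 \<inter> min_gens (Y - {x}) J2 = {})"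

inductive vertex_splittable :: "'v set \<Rightarrow> ('v, 'k::field) mpoly set \<Rightarrow> bool" where
  principal: "v \<in> monomials Y \<Longrightarrow> vertex_splittable Y (ideal_gen Y {v})"
| zero: "vertex_splittable Y {0}"
| whole: "vertex_splittable Y (poly_ring Y)"
| split: "x \<in> Y \<Longrightarrow> vertex_splittable (Y - {x}) J1 \<Longrightarrow> vertex_splittable (Y - {x}) J2 \<Longrightarrow>
          splits Y x J1 J2 J \<Longrightarrow> vertex_splittable Y J"

definition vertex_splitting ::
  "'v set \<Rightarrow> 'v \<Rightarrow> ('v, 'k::field) mpoly set \<Rightarrow> ('v, 'k) mpoly set \<Rightarrow> ('v, 'k) mpoly set \<Rightarrow> bool" where
  "vertex_splitting Y x J1 J2 J \<longleftrightarrow>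
     x \<in> Y \<and> vertex_splittable (Y - {x}) J1 \<and> vertex_splittable (Y - {x}) J2 \<and> splits Y x J1 J2 J"


section \<open>Weighted oriented graphs\<close>

record 'v wograph =
  verts  :: "'v set"
  edges  :: "('v \<times> 'v) set"
  weight :: "'v \<Rightarrow> nat"

definition weighted_oriented_graph :: "'v wograph \<Rightarrow> bool" where
  "weighted_oriented_graph D \<longleftrightarrow>
     finite (verts D) \<and> edges D \<subseteq> verts D \<times> verts D \<and>
     irrefl (edges D) \<and> (\<forall>u v. (u, v) \<in> edges D \<longrightarrow> (v, u) \<notin> edges D) \<and>
     (\<forall>v\<in>verts D. weight D v \<ge> 1) \<and>
     (\<forall>v\<in>verts D. (\<nexists>u. (u, v) \<in> edges D) \<longrightarrow> weight D v = 1)"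

definition edge_ideal :: "'v wograph \<Rightarrow> ('v, 'k::field) mpoly set" where
  "edge_ideal D = ideal_gen (verts D) {var u * var v ^ weight D v | u v. (u, v) \<in> edges D}"

text \<open>
  An induced subgraph \<open>D[A]\<close> is again a weighted oriented graph, so the convention that sources have
  weight \<open>1\<close> applies to it as well: a vertex with no incoming edge in \<open>D[A]\<close> gets weight \<open>1\<close>
  (its weight in \<open>D\<close> does not enter \<open>I(D[A])\<close>), and all other vertices inherit their weight.
\<close>

definition induced :: "'v wograph \<Rightarrow> 'v set \<Rightarrow> 'v wograph" where
  "induced D A =
     (let E = edges D \<inter> (A \<times> A) in
        \<lparr>verts = A, edges = E, weight = (\<lambda>v. if \<exists>u. (u, v) \<in> E then weight D v else 1)\<rparr>)"

lemma weighted_oriented_graph_induced: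
  assumes "weighted_oriented_graph D" and "A \<subseteq> verts D"
  shows "weighted_oriented_graph (induced D A)"
  using assms
  by (auto simp: weighted_oriented_graph_def induced_def Let_def irrefl_def intro: finite_subset)

definition is_D6 :: "'v wograph \<Rightarrow> bool" where
  "is_D6 H \<longleftrightarrow> (\<exists>x1 x2 x3 x4. distinct [x1, x2, x3, x4] \<and> verts H = {x1, x2, x3, x4} \<and>
     edges H = {(x1, x2), (x2, x3), (x3, x4)} \<and>
     weight H x2 > 1 \<and> weight H x3 = 1 \<and> weight H x4 > 1)"

definition is_D7 :: "'v wograph \<Rightarrow> bool" where
  "is_D7 H \<longleftrightarrow> (\<exists>x1 x2 x3. distinct [x1, x2, x3] \<and> verts H = {x1, x2, x3} \<and>
     edges H = {(x1, x2), (x2, x3), (x3, x1)} \<and>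
     weight H x1 = 1 \<and> weight H x2 > 2 \<and> weight H x3 > 2)"

definition is_D8 :: "'v wograph \<Rightarrow> bool" where
  "is_D8 H \<longleftrightarrow> (\<exists>x1 x2 x3 x4. distinct [x1, x2, x3, x4] \<and> verts H = {x1, x2, x3, x4} \<and>
     (edges H = {(x2, x1), (x3, x4), (x2, x3)} \<or> edges H = {(x2, x1), (x3, x4), (x3, x2)}) \<and>
     weight H x1 > 1 \<and> weight H x2 = 1 \<and> weight H x3 = 1 \<and> weight H x4 > 1)"

definition has_induced :: "'v wograph \<Rightarrow> ('v wograph \<Rightarrow> bool) \<Rightarrow> bool" where
  "has_induced D P \<longleftrightarrow> (\<exists>A \<subseteq> verts D. P (induced D A))"

end

theory Submission
  imports Defs
begin

text \<open>
  A first syzygy of a monomial ideal relates at least two generators, so \<open>HS\<^sub>1(I)\<close> is generated by the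
  least common multiples of pairs of distinct generators of \<open>I\<close>. This needs no knowledge of the
  resolution beyond its existence and minimality.

  If a pattern \<open>D\<^sub>6\<close>, \<open>D\<^sub>7\<close> or \<open>D\<^sub>8\<close> is induced, with generators \<open>g\<^sub>1, g\<^sub>2, g\<^sub>3\<close>, then
  \<open>lcm(g\<^sub>1, g\<^sub>2)\<close> and \<open>lcm(g\<^sub>2, g\<^sub>3)\<close> are the only generators of \<open>HS\<^sub>1(I)\<close> dividing their least common
  multiple, and neither of the two colon ideals is generated by a variable.

  Conversely, a vertex splitting \<open>I = x I\<^sub>1 + I\<^sub>2\<close> gives \<open>HS\<^sub>1(I) = x A + HS\<^sub>1(I\<^sub>2)\<close> with
  \<open>A = HS\<^sub>1(I\<^sub>1) + I\<^sub>2\<close> and \<open>HS\<^sub>1(I\<^sub>2) \<subseteq> A\<close>, so by induction it suffices to order the generators of \<open>A\<close>.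
  Here \<open>I\<^sub>1\<close> is generated by the neighbours of \<open>x\<close>, at most one of them, \<open>y\<^sub>0\<close>, to a power greater than
  one, and every edge of \<open>D \ x\<close> meets a neighbour of \<open>x\<close>. The products of two neighbours other than
  \<open>y\<^sub>0\<close> come first; they leave only generators sharing the same neighbour \<open>u\<close> to be compared, and
  for these the absence of the patterns and the splittability of \<open>I\<^sub>2\<close> suffice.
\<close>

text \<open>All ideals are moved to sets of exponents: a monomial ideal is the upward closure
  \<open>up\<close> of an antichain, and HS_1 becomes the set \<open>U2\<close> of monomials with
  two distinct generators as divisors. Since \<open>betti\<close> chooses a resolution, a minimal
  one has to be constructed before anything can be said about the chosen one. The obstacle is that
  I_1 and A are not edge ideals. The induction therefore runs only through I_2, the edge ideal of
  the graph without x, and A is ordered by an explicit rank. Splittability of I_2 enters in a local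
  form: if two generators divide m, each of them is linear, in one direction or the other, with a
  further generator dividing m. Taking m supported on three vertices turns this into a statement
  about induced subgraphs. The weight bounds in the patterns are the ones at which the two colon
  ideals have generators of degree at least two; for D_7 these generators are b^(w b - 1) and c^(w c
  - 1), hence the bound 2 there.\<close>

abbreviation lookup :: "('a \<Rightarrow>\<^sub>0 'b::zero) \<Rightarrow> 'a \<Rightarrow> 'b" where "lookup \<equiv> Poly_Mapping.lookup"
abbreviation single :: "'a \<Rightarrow> 'b \<Rightarrow> 'a \<Rightarrow>\<^sub>0 'b::zero" where "single \<equiv> Poly_Mapping.single"
abbreviation keys :: "('a \<Rightarrow>\<^sub>0 'b::zero) \<Rightarrow> 'a set" where "keys \<equiv> Poly_Mapping.keys"

section \<open>Divisibility of monomials\<close>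

definition dv :: "'v expo \<Rightarrow> 'v expo \<Rightarrow> bool" (infix "\<preceq>" 50) where
  "a \<preceq> b \<longleftrightarrow> (\<forall>x. lookup a x \<le> lookup b x)"

definition ev :: "'v \<Rightarrow> 'v expo" where "ev z = single z 1"

lemma dvD: "a \<preceq> b \<Longrightarrow> lookup a x \<le> lookup b x"
  by (simp add: dv_def)

lemma dv_refl [simp]: "a \<preceq> a"
  by (simp add: dv_def)

lemma dv_trans [trans]: "a \<preceq> b \<Longrightarrow> b \<preceq> c \<Longrightarrow> a \<preceq> c"
  unfolding dv_def using order_trans by blast

lemma dv_antisym: "a \<preceq> b \<Longrightarrow> b \<preceq> a \<Longrightarrow> a = b"
  by (simp add: dv_def poly_mapping_eqI antisym)

lemma dv_add [simp]: "a \<preceq> a + b" "a \<preceq> b + a"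
  by (simp_all add: dv_def lookup_add)

lemma dv_add_mono: "a \<preceq> b \<Longrightarrow> a + c \<preceq> b + c"
  by (simp add: dv_def lookup_add)

lemma dv_add_cancel [simp]: "c + a \<preceq> c + b \<longleftrightarrow> a \<preceq> b"
  by (simp add: dv_def lookup_add)

lemma dv_minus_add: "a \<preceq> b \<Longrightarrow> (b - a) + a = b"
  by (rule poly_mapping_eqI) (simp add: dv_def lookup_add lookup_minus)

lemma dv_iff_add: "a \<preceq> b \<longleftrightarrow> (\<exists>c. b = c + a)"
  using dv_minus_add by (metis dv_add(2))

lemma lookup_ev: "lookup (ev z) x = (if x = z then 1 else 0)"
  by (simp add: ev_def lookup_single when_def)

lemma ev_dv_iff: "ev z \<preceq> a \<longleftrightarrow> 0 < lookup a z"
  by (auto simp: dv_def lookup_ev Suc_le_eq)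

definition deg :: "'v::finite expo \<Rightarrow> nat" where
  "deg a = (\<Sum>x\<in>UNIV. lookup a x)"

lemma deg_add: "deg (a + b) = deg a + deg b"
  by (simp add: deg_def lookup_add sum.distrib)

lemma deg_single: "deg (single z n) = n"
  by (simp add: deg_def lookup_single when_def)

lemma dv_deg_eq: "a \<preceq> b \<Longrightarrow> deg b \<le> deg a \<Longrightarrow> a = b"
proof -
  assume ab: "a \<preceq> b" and d: "deg b \<le> deg a"
  then obtain c where c: "b = c + a" by (auto simp: dv_iff_add)
  then have "deg c = 0" using d by (simp add: deg_add)
  then have "c = 0" by (intro poly_mapping_eqI) (simp add: deg_def)
  with c show ?thesis by simp
qed

section \<open>Antichains of monomials and the ideals they generate\<close>

definition antichain :: "'v expo set \<Rightarrow> bool" where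
  "antichain S \<longleftrightarrow> (\<forall>s\<in>S. \<forall>t\<in>S. s \<preceq> t \<longrightarrow> s = t)"

text \<open>The exponents of the minimal monomial generators of the ideal generated by
  \<open>S\<close>.\<close>

definition Mins :: "'v expo set \<Rightarrow> 'v expo set" where
  "Mins S = {s\<in>S. \<forall>t\<in>S. t \<preceq> s \<longrightarrow> t = s}"

text \<open>The exponents of the monomials in the ideal generated by \<open>S\<close>; monomial
  ideals are compared through these sets.\<close>

definition up :: "'v expo set \<Rightarrow> 'v expo set" where
  "up S = {a. \<exists>s\<in>S. s \<preceq> a}"

lemma antichainD: "antichain S \<Longrightarrow> s \<in> S \<Longrightarrow> t \<in> S \<Longrightarrow> s \<preceq> t \<Longrightarrow> s = t"
  by (simp add: antichain_def)

lemma in_up: "s \<in> S \<Longrightarrow> s \<in> up S"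
  unfolding up_def using dv_refl by blast

lemma up_closed: "a \<in> up S \<Longrightarrow> a \<preceq> b \<Longrightarrow> b \<in> up S"
  by (auto simp: up_def intro: dv_trans)

lemma Mins_subset: "Mins S \<subseteq> S"
  by (auto simp: Mins_def)

lemma antichain_Mins: "antichain (Mins S)"
  by (auto simp: antichain_def Mins_def)

lemma antichain_subset: "antichain S \<Longrightarrow> T \<subseteq> S \<Longrightarrow> antichain T"
  by (auto simp: antichain_def)

lemma Mins_below:
  fixes S :: "'v::finite expo set"
  assumes "s \<in> S" shows "\<exists>t\<in>Mins S. t \<preceq> s"
  using assms
proof (induction "deg s" arbitrary: s rule: less_induct)
  case less
  show ?case
  proof (cases "s \<in> Mins S")
    case True
    then show ?thesis by (intro bexI[of _ s]) auto
  next
    case False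
    then obtain t where t: "t \<in> S" "t \<preceq> s" "t \<noteq> s" using less.prems by (auto simp: Mins_def)
    then have "deg t < deg s" using dv_deg_eq by (metis not_le)
    then obtain r where "r \<in> Mins S" "r \<preceq> t" using less.hyps t by blast
    then show ?thesis using t dv_trans by blast
  qed
qed

lemma up_Mins:
  fixes S :: "'v::finite expo set"
  shows "up (Mins S) = up S"
proof
  show "up (Mins S) \<subseteq> up S" using Mins_subset by (fastforce simp: up_def)
  show "up S \<subseteq> up (Mins S)"
  proof
    fix a assume "a \<in> up S"
    then obtain s where "s \<in> S" "s \<preceq> a" by (auto simp: up_def)
    then show "a \<in> up (Mins S)" using Mins_below[of s S] dv_trans by (fastforce simp: up_def)
  qed
qed

text \<open>Going down from s in \<open>S\<close> to some t in \<open>T\<close> and on to some r in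
  \<open>S\<close> ends at s again, because \<open>S\<close> is an antichain, so t = s. This is the
  uniqueness of minimal monomial generators.\<close>

lemma antichain_up_unique:
  assumes "antichain S" "antichain T" "up S = up T"
  shows "S = T"
proof -
  have *: "S \<subseteq> T" if S: "antichain S" and e: "up S = up T" for S T :: "'a expo set"
  proof
    fix s assume s: "s \<in> S"
    then have "s \<in> up T" using e in_up by blast
    then obtain t where t: "t \<in> T" "t \<preceq> s" by (auto simp: up_def)
    then have "t \<in> up S" using e in_up by blast
    then obtain r where r: "r \<in> S" "r \<preceq> t" by (auto simp: up_def)
    then have "r = s" using S s t dv_trans by (metis antichainD)
    then show "s \<in> T" using r t dv_antisym by blast
  qed
  show ?thesis using *[of S T] *[of T S] assms by auto
qed

lemma Mins_antichain: "antichain S \<Longrightarrow> Mins S = S"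
  by (auto simp: antichain_def Mins_def)

text \<open>Dickson's lemma, by induction on the coordinates that are compared.\<close>

lemma dickson_coordinates:
  fixes A :: "'v expo set"
  assumes "finite X"
  shows "\<exists>B\<subseteq>A. finite B \<and> (\<forall>a\<in>A. \<exists>b\<in>B. \<forall>x\<in>X. lookup b x \<le> lookup a x)"
  using assms
proof (induction X arbitrary: A)
  case empty
  show ?case
  proof (cases "A = {}")
    case False
    then obtain a where "a \<in> A" by auto
    then show ?thesis by (intro exI[of _ "{a}"]) auto
  qed auto
next
  case (insert y X)
  obtain B where B: "B \<subseteq> A" "finite B" "\<forall>a\<in>A. \<exists>b\<in>B. \<forall>x\<in>X. lookup b x \<le> lookup a x"
    using insert.IH[of A] by blast
  \<comment> \<open>An element with y-coordinate at least N lies above an element of B in the new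
    coordinate as well. Below N there are finitely many levels, and on a level the new coordinate is
    constant, so the induction hypothesis covers each of them.\<close>
  obtain N where N: "\<forall>b\<in>B. lookup b y < N"
    using finite_imageI[OF B(2), of "\<lambda>b. lookup b y"] unfolding finite_nat_set_iff_bounded by blast
  define A' where "A' n = {a\<in>A. lookup a y = n}" for n
  have "\<forall>n. \<exists>C. C \<subseteq> A' n \<and> finite C \<and> (\<forall>a\<in>A' n. \<exists>b\<in>C. \<forall>x\<in>X. lookup b x \<le> lookup a x)"
    by (intro allI insert.IH)
  then obtain C where "\<forall>n. C n \<subseteq> A' n \<and> finite (C n) \<and>
      (\<forall>a\<in>A' n. \<exists>b\<in>C n. \<forall>x\<in>X. lookup b x \<le> lookup a x)"
    by (drule_tac choice) blast
  then have C: "C n \<subseteq> A' n" "finite (C n)" "\<forall>a\<in>A' n. \<exists>b\<in>C n. \<forall>x\<in>X. lookup b x \<le> lookup a x" for n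
    by blast+
  show ?case
  proof (intro exI[of _ "B \<union> (\<Union>n<N. C n)"] conjI ballI)
    show "B \<union> (\<Union>n<N. C n) \<subseteq> A" using B C(1) unfolding A'_def by blast
    show "finite (B \<union> (\<Union>n<N. C n))" using B C(2) by auto
    fix a assume a: "a \<in> A"
    show "\<exists>b\<in>B \<union> (\<Union>n<N. C n). \<forall>x\<in>insert y X. lookup b x \<le> lookup a x"
    proof (cases "lookup a y < N")
      case True
      obtain b where "b \<in> C (lookup a y)" "\<forall>x\<in>X. lookup b x \<le> lookup a x"
        using C(3)[of "lookup a y"] a unfolding A'_def by blast
      moreover from this have "lookup b y = lookup a y" using C(1) unfolding A'_def by blast
      ultimately show ?thesis using True by (intro bexI[of _ b]) auto
    next
      case False
      obtain b where "b \<in> B" "\<forall>x\<in>X. lookup b x \<le> lookup a x" using B(3) a by blast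
      moreover from this have "lookup b y \<le> lookup a y" using N False by fastforce
      ultimately show ?thesis by (intro bexI[of _ b]) auto
    qed
  qed
qed

lemma dickson:
  fixes A :: "'v::finite expo set"
  obtains B where "B \<subseteq> A" "finite B" "\<And>a. a \<in> A \<Longrightarrow> \<exists>b\<in>B. b \<preceq> a"
  using dickson_coordinates[of UNIV A] by (auto simp: dv_def)

lemma finite_antichain:
  fixes S :: "'v::finite expo set"
  assumes "antichain S" shows "finite S"
proof -
  obtain B where B: "B \<subseteq> S" "finite B" "\<And>a. a \<in> S \<Longrightarrow> \<exists>b\<in>B. b \<preceq> a" by (rule dickson[of S]) blast
  then have "S \<subseteq> B" using assms by (metis antichainD subset_iff)
  with B show ?thesis using finite_subset by blast
qed

section \<open>Monomial ideals\<close>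

lemma keys_monom [simp]: "keys (monom a :: ('v, 'k::field) mpoly) = {a}"
  by (simp add: monom_def)

lemma monom_inj [simp]: "monom a = (monom b :: ('v, 'k::field) mpoly) \<longleftrightarrow> a = b"
  by (metis keys_monom singleton_inject)

lemma inj_monom: "inj (monom :: 'v expo \<Rightarrow> ('v, 'k::field) mpoly)"
  by (simp add: inj_def)

lemma monom_mult: "monom a * monom b = (monom (a + b) :: ('v, 'k::field) mpoly)"
  by (simp add: monom_def mult_single)

lemma monom_0: "monom 0 = (1 :: ('v, 'k::field) mpoly)"
  by (simp add: monom_def)

text \<open>Distinct exponents stay distinct after adding \<open>a\<close>, so nothing cancels. This
  makes the colon of a monomial ideal by a monomial a matter of exponents alone.\<close>

lemma keys_mult_monom:
  fixes p :: "('v, 'k::field) mpoly"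
  shows "keys (p * monom a) = (\<lambda>m. m + a) ` keys p"
proof -
  have "(\<Sum>m\<in>keys p. single (m + a) (lookup p m)) = p * monom a"
  proof -
    have "p = (\<Sum>m\<in>keys p. single m (lookup p m))"
      by (rule poly_mapping_eqI)
        (simp add: lookup_sum lookup_single when_def in_keys_iff)
    then have "p * monom a = (\<Sum>m\<in>keys p. single m (lookup p m)) * monom a" by simp
    also have "\<dots> = (\<Sum>m\<in>keys p. single (m + a) (lookup p m))"
      by (simp add: sum_distrib_right monom_def mult_single)
    finally show ?thesis by simp
  qed
  moreover have "lookup (\<Sum>m\<in>keys p. single (m + a) (lookup p m)) b =
      (if \<exists>m\<in>keys p. b = m + a then lookup p (b - a) else 0)" for b
  proof (cases "\<exists>m\<in>keys p. b = m + a")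
    case True
    then obtain m where m: "m \<in> keys p" "b = m + a" by auto
    have "lookup (\<Sum>m\<in>keys p. single (m + a) (lookup p m)) b =
        (\<Sum>m'\<in>keys p. if m' = m then lookup p m' else 0)"
      by (auto simp: lookup_sum lookup_single when_def m intro!: sum.cong)
    then show ?thesis using m True by simp
  next
    case False
    then show ?thesis
      by (auto simp: lookup_sum lookup_single when_def intro!: sum.neutral)
  qed
  ultimately show ?thesis
    by (auto simp: in_keys_iff split: if_splits) 
qed

lemma poly_ring_UNIV [simp]: "poly_ring UNIV = UNIV"
  by (simp add: poly_ring_def)

lemma poly_ring_0 [simp]: "0 \<in> poly_ring Y"
  by (simp add: poly_ring_def)

lemma poly_ring_add: "p \<in> poly_ring Y \<Longrightarrow> q \<in> poly_ring Y \<Longrightarrow> p + q \<in> poly_ring Y"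
  using keys_add[of p q] by (auto simp: poly_ring_def)

lemma keys_add_expo: "keys (a + b :: 'v expo) = keys a \<union> keys b"
  by (auto simp: in_keys_iff lookup_add)

lemma poly_ring_mult:
  assumes "p \<in> poly_ring Y" "q \<in> poly_ring Y" shows "p * q \<in> poly_ring Y"
  unfolding poly_ring_def
proof (intro CollectI ballI)
  fix m assume "m \<in> keys (p * q)"
  then obtain a b where "m = a + b" "a \<in> keys p" "b \<in> keys q" using keys_mult[of p q] by blast
  then show "keys m \<subseteq> Y" using assms by (simp add: keys_add_expo poly_ring_def)
qed

lemma ideal_gen_0: "0 \<in> ideal_gen Y B"
  unfolding ideal_gen_def by (rule CollectI, rule exI[of _ "{}"]) auto

lemma ideal_gen_add:
  assumes "p \<in> ideal_gen Y B" "p' \<in> ideal_gen Y B"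
  shows "p + p' \<in> ideal_gen Y B"
proof -
  obtain F q where F: "finite F" "F \<subseteq> B" "q ` F \<subseteq> poly_ring Y" "p = (\<Sum>b\<in>F. q b * b)"
    using assms(1) by (auto simp: ideal_gen_def)
  obtain F' q' where F': "finite F'" "F' \<subseteq> B" "q' ` F' \<subseteq> poly_ring Y" "p' = (\<Sum>b\<in>F'. q' b * b)"
    using assms(2) by (auto simp: ideal_gen_def)
  \<comment> \<open>The two combinations use different finite sets of generators; each coefficient
    function is extended by 0 to their union.\<close>
  define r where "r b = (if b \<in> F then q b else 0) + (if b \<in> F' then q' b else 0)" for b
  have "(\<Sum>b\<in>F \<union> F'. r b * b) = (\<Sum>b\<in>F \<union> F'. (if b \<in> F then q b * b else 0)) +
      (\<Sum>b\<in>F \<union> F'. (if b \<in> F' then q' b * b else 0))"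
    by (auto simp: r_def algebra_simps sum.distrib[symmetric] intro!: sum.cong)
  also have "(\<Sum>b\<in>F \<union> F'. (if b \<in> F then q b * b else 0)) = p"
    using F F' by (auto simp: sum.If_cases Int_absorb1 intro!: sum.cong)
  also have "(\<Sum>b\<in>F \<union> F'. (if b \<in> F' then q' b * b else 0)) = p'"
    using F F' by (auto simp: sum.If_cases Int_absorb1 intro!: sum.cong)
  finally have "p + p' = (\<Sum>b\<in>F \<union> F'. r b * b)" by simp
  moreover have "r ` (F \<union> F') \<subseteq> poly_ring Y"
    using F(3) F'(3) unfolding r_def image_subset_iff by (intro ballI poly_ring_add) auto
  ultimately show ?thesis unfolding ideal_gen_def mem_Collect_eq using F F'
    by (intro exI[of _ "F \<union> F'"] exI[of _ r]) auto
qed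

lemma ideal_gen_sum: "(\<And>i. i \<in> A \<Longrightarrow> p i \<in> ideal_gen Y B) \<Longrightarrow> (\<Sum>i\<in>A. p i) \<in> ideal_gen Y B"
  by (induction A rule: infinite_finite_induct) (auto intro: ideal_gen_0 ideal_gen_add)

lemma ideal_gen_base: "b \<in> B \<Longrightarrow> q \<in> poly_ring Y \<Longrightarrow> q * b \<in> ideal_gen Y B"
  unfolding ideal_gen_def mem_Collect_eq by (intro exI[of _ "{b}"] exI[of _ "\<lambda>_. q"]) auto

lemma poly_mapping_sum_single: "p = (\<Sum>m\<in>keys p. single m (lookup p m))"
  by (rule poly_mapping_eqI) (simp add: lookup_sum lookup_single when_def in_keys_iff)

text \<open>Given by supports and not by generators, so that membership is decided term by term;
  \<open>ideal_gen_monom\<close> identifies it with the generated ideal.\<close>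

definition mon_ideal :: "'v set \<Rightarrow> 'v expo set \<Rightarrow> ('v, 'k::field) mpoly set" where
  "mon_ideal Y S = {p \<in> poly_ring Y. keys p \<subseteq> up S}"

lemma mon_ideal_add: "p \<in> mon_ideal Y S \<Longrightarrow> q \<in> mon_ideal Y S \<Longrightarrow> p + q \<in> mon_ideal Y S"
  using keys_add[of p q] by (auto simp: mon_ideal_def intro!: poly_ring_add)

lemma mon_ideal_0: "0 \<in> mon_ideal Y S"
  by (simp add: mon_ideal_def)

lemma mon_ideal_sum: "(\<And>i. i \<in> A \<Longrightarrow> p i \<in> mon_ideal Y S) \<Longrightarrow> (\<Sum>i\<in>A. p i) \<in> mon_ideal Y S"
  by (induction A rule: infinite_finite_induct) (auto intro: mon_ideal_add mon_ideal_0)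

lemma mon_ideal_mult:
  assumes "p \<in> mon_ideal Y S" "q \<in> poly_ring Y" shows "q * p \<in> mon_ideal Y S"
  unfolding mon_ideal_def
proof (intro CollectI conjI subsetI)
  show "q * p \<in> poly_ring Y" using assms by (auto simp: mon_ideal_def intro: poly_ring_mult)
  fix m assume "m \<in> keys (q * p)"
  then obtain a b where "m = a + b" "b \<in> keys p" using keys_mult[of q p] by blast
  then show "m \<in> up S" using assms up_closed[of b S m] by (auto simp: mon_ideal_def)
qed

lemma ideal_gen_subset_mon_ideal: "B \<subseteq> mon_ideal Y S \<Longrightarrow> ideal_gen Y B \<subseteq> mon_ideal Y S"
  unfolding ideal_gen_def by (auto intro!: mon_ideal_sum mon_ideal_mult)

lemma monom_in_mon_ideal: "monom a \<in> mon_ideal Y S \<longleftrightarrow> keys a \<subseteq> Y \<and> a \<in> up S"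
  by (auto simp: mon_ideal_def poly_ring_def)

text \<open>Every term of a polynomial in the ideal is a multiple of one generator. \<open>B\<close>
  may contain more than the monomial generators because \<open>splits\<close> generates its ideals
  from whole ideals.\<close>

lemma mon_ideal_subset_ideal_gen:
  fixes B :: "('v, 'k::field) mpoly set"
  assumes "monom ` S \<subseteq> B"
  shows "mon_ideal Y S \<subseteq> ideal_gen Y B"
proof
  fix p :: "('v, 'k) mpoly" assume p: "p \<in> mon_ideal Y S"
  have "single m (lookup p m) \<in> ideal_gen Y B" if "m \<in> keys p" for m
  proof -
    from that p obtain s where s: "s \<in> S" "s \<preceq> m" by (auto simp: mon_ideal_def up_def)
    have "keys m \<subseteq> Y" using p that by (auto simp: mon_ideal_def poly_ring_def)
    moreover have "keys (m - s) \<subseteq> keys m" by (auto simp: in_keys_iff lookup_minus)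
    ultimately have "single (m - s) (lookup p m) \<in> poly_ring Y"
      by (auto simp: poly_ring_def)
    then have "single (m - s) (lookup p m) * monom s \<in> ideal_gen Y B"
      using assms s by (intro ideal_gen_base) auto
    then show ?thesis using s by (simp add: monom_def mult_single dv_minus_add)
  qed
  then have "(\<Sum>m\<in>keys p. single m (lookup p m)) \<in> ideal_gen Y B" by (rule ideal_gen_sum)
  then show "p \<in> ideal_gen Y B" using poly_mapping_sum_single[of p] by simp
qed

lemma ideal_gen_monom:
  assumes "\<And>s. s \<in> S \<Longrightarrow> keys s \<subseteq> Y"
  shows "ideal_gen Y (monom ` S) = mon_ideal Y S"
proof
  show "ideal_gen Y (monom ` S) \<subseteq> mon_ideal Y S"
    using assms by (intro ideal_gen_subset_mon_ideal) (auto simp: monom_in_mon_ideal in_up)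
qed (intro mon_ideal_subset_ideal_gen, simp)

lemma mon_ideal_cong_up: "up S = up T \<Longrightarrow> mon_ideal Y S = mon_ideal Y T"
  by (simp add: mon_ideal_def)

lemma mon_ideal_eqD:
  assumes "mon_ideal Y S = (mon_ideal Y T :: ('v, 'k::field) mpoly set)"
    and S: "\<And>s. s \<in> S \<Longrightarrow> keys s \<subseteq> Y" and T: "\<And>s. s \<in> T \<Longrightarrow> keys s \<subseteq> Y"
  shows "up S = up T"
proof -
  have *: "up S \<subseteq> up T" if e: "mon_ideal Y S = (mon_ideal Y T :: ('v, 'k) mpoly set)"
    and S: "\<And>s. s \<in> S \<Longrightarrow> keys s \<subseteq> Y" for S T
  proof
    fix a assume "a \<in> up S"
    then obtain s where s: "s \<in> S" "s \<preceq> a" by (auto simp: up_def)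
    then have "(monom s :: ('v, 'k) mpoly) \<in> mon_ideal Y T"
      unfolding e[symmetric] using S by (auto simp: monom_in_mon_ideal in_up)
    then show "a \<in> up T" using s by (auto simp: monom_in_mon_ideal intro: up_closed)
  qed
  show ?thesis using *[of S T] *[of T S] assms by auto
qed

lemma min_gens_mon_ideal:
  fixes S :: "'v::finite expo set"
  assumes SY: "\<And>s. s \<in> S \<Longrightarrow> keys s \<subseteq> Y"
  shows "min_gens Y (mon_ideal Y S) = (monom ` Mins S :: ('v, 'k::field) mpoly set)"
  unfolding min_gens_def
proof (rule the_equality)
  let ?P = "\<lambda>G::('v, 'k) mpoly set. G \<subseteq> monomials Y \<and> ideal_gen Y G = mon_ideal Y S \<and>
             (\<forall>G'. G' \<subset> G \<longrightarrow> ideal_gen Y G' \<noteq> mon_ideal Y S)"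
  have MY: "keys s \<subseteq> Y" if "s \<in> Mins S" for s using that SY Mins_subset by blast
  show "?P (monom ` Mins S)"
  proof (intro conjI allI impI)
    show "monom ` Mins S \<subseteq> monomials Y" using MY by (auto simp: monomials_def)
    show "ideal_gen Y (monom ` Mins S) = mon_ideal Y S"
      by (metis ideal_gen_monom MY mon_ideal_cong_up up_Mins)
    fix G' :: "('v, 'k) mpoly set" assume G': "G' \<subset> monom ` Mins S"
    then obtain T where T: "T \<subseteq> Mins S" "G' = monom ` T" by (metis psubset_imp_subset subset_imageE)
    have TY: "keys s \<subseteq> Y" if "s \<in> T" for s using that T MY by blast
    show "ideal_gen Y G' \<noteq> mon_ideal Y S"
    proof
      assume "ideal_gen Y G' = mon_ideal Y S"
      then have "mon_ideal Y T = (mon_ideal Y S :: ('v, 'k) mpoly set)"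
        using T ideal_gen_monom[OF TY] by auto
      then have "up T = up S" using mon_ideal_eqD SY TY by blast
      then have "up T = up (Mins S)" by (simp add: up_Mins)
      then have "T = Mins S" using antichain_up_unique antichain_subset[OF antichain_Mins T(1)] antichain_Mins by blast
      then show False using G' T by simp
    qed
  qed
  fix G :: "('v, 'k) mpoly set" assume G: "?P G"
  define T where "T = {a. keys a \<subseteq> Y \<and> monom a \<in> G}"
  have T: "\<And>s. s \<in> T \<Longrightarrow> keys s \<subseteq> Y" "G = monom ` T"
    using G by (auto simp: T_def monomials_def)
  have "ideal_gen Y (monom ` T) = (mon_ideal Y T :: ('v, 'k) mpoly set)"
    using T(1) by (rule ideal_gen_monom)
  then have e: "mon_ideal Y T = (mon_ideal Y S :: ('v, 'k) mpoly set)"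
    using G unfolding T(2) by simp
  then have upT: "up T = up S" using mon_ideal_eqD[OF e T(1) SY] by blast
  have "antichain T"
  proof (rule ccontr)
    assume "\<not> antichain T"
    then obtain s t where st: "s \<in> T" "t \<in> T" "s \<preceq> t" "s \<noteq> t" by (auto simp: antichain_def)
    have "up (T - {t}) = up T"
      using st unfolding up_def by (auto intro: dv_trans)
    then have "mon_ideal Y (T - {t}) = (mon_ideal Y S :: ('v, 'k) mpoly set)"
      using e mon_ideal_cong_up by metis
    moreover have "ideal_gen Y (monom ` (T - {t})) = (mon_ideal Y (T - {t}) :: ('v, 'k) mpoly set)"
      using T by (intro ideal_gen_monom) auto
    moreover have "monom t \<notin> (monom ` (T - {t}) :: ('v, 'k) mpoly set)" by auto
    then have "monom ` (T - {t}) \<subset> G" unfolding T(2) using st(2) by blast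
    ultimately show False using G by metis
  qed
  then have "T = Mins S" using antichain_up_unique[OF _ antichain_Mins] upT up_Mins by metis
  then show "G = monom ` Mins S" using T by simp
qed

section \<open>Vertex splittings of monomial ideals\<close>

definition shift :: "'v \<Rightarrow> 'v expo set \<Rightarrow> 'v expo set" where
  "shift x S = (\<lambda>s. ev x + s) ` S"

text \<open>Vertex splittability on minimal generators. Of the rings only the absence of x from
  \<open>S1\<close> and \<open>S2\<close> survives; the whole ring is \<open>vsplit_single\<close>
  with exponent 0, and the antichain condition stands for the decomposition of the minimal
  generators.\<close>

inductive vsplit :: "'v expo set \<Rightarrow> bool" where
  vsplit_empty: "vsplit {}"
| vsplit_single: "vsplit {s}"
| vsplit_step: "vsplit S1 \<Longrightarrow> vsplit S2 \<Longrightarrow> (\<And>s. s \<in> S1 \<union> S2 \<Longrightarrow> lookup s x = 0) \<Longrightarrow>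
    S2 \<subseteq> up S1 \<Longrightarrow> antichain (shift x S1 \<union> S2) \<Longrightarrow> vsplit (shift x S1 \<union> S2)"

lemma var_eq: "var x = monom (ev x)"
  by (simp add: var_def ev_def)

lemma mon_ideal_Un:
  fixes Y :: "'v set"
  shows "(mon_ideal Y (A \<union> B) :: ('v, 'k::field) mpoly set) =
    {a + b | a b. a \<in> mon_ideal Y A \<and> b \<in> mon_ideal Y B}"
proof (intro set_eqI iffI)
  fix p :: "('v, 'k) mpoly"
  assume p: "p \<in> mon_ideal Y (A \<union> B)"
  let ?f = "\<lambda>m. single m (lookup p m) :: ('v, 'k) mpoly"
  have pY: "keys m \<subseteq> Y" if "m \<in> keys p" for m
    using p that by (auto simp: mon_ideal_def poly_ring_def)
  have "p = (\<Sum>m\<in>keys p. ?f m)" by (rule poly_mapping_sum_single)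
  also have "\<dots> = (\<Sum>m\<in>keys p \<inter> up A. ?f m) + (\<Sum>m\<in>keys p - up A. ?f m)"
    by (rule sum.Int_Diff) simp
  finally have "p = (\<Sum>m\<in>keys p \<inter> up A. ?f m) + (\<Sum>m\<in>keys p - up A. ?f m)" .
  moreover have "(\<Sum>m\<in>keys p \<inter> up A. ?f m) \<in> mon_ideal Y A"
    by (rule mon_ideal_sum) (use pY in \<open>auto simp: mon_ideal_def poly_ring_def\<close>)
  moreover have "(\<Sum>m\<in>keys p - up A. ?f m) \<in> mon_ideal Y B"
  proof (rule mon_ideal_sum)
    fix m assume m: "m \<in> keys p - up A"
    then have "m \<in> up (A \<union> B)" using p by (auto simp: mon_ideal_def)
    then have "m \<in> up B" using m by (auto simp: up_def)
    then show "?f m \<in> mon_ideal Y B" using pY m by (auto simp: mon_ideal_def poly_ring_def)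
  qed
  ultimately show "p \<in> {a + b | a b. a \<in> mon_ideal Y A \<and> b \<in> mon_ideal Y B}" by blast
next
  fix p :: "('v, 'k) mpoly"
  assume "p \<in> {a + b | a b. a \<in> mon_ideal Y A \<and> b \<in> mon_ideal Y B}"
  then obtain a b where "p = a + b" "a \<in> mon_ideal Y A" "b \<in> mon_ideal Y B" by blast
  then show "p \<in> mon_ideal Y (A \<union> B)"
    by (intro mon_ideal_add[of a _ _ b, folded \<open>p = a + b\<close>]) (auto simp: mon_ideal_def up_def)
qed

lemma ideal_gen_shift:
  fixes S :: "'v expo set"
  assumes "x \<in> Y" "\<And>s. s \<in> S \<Longrightarrow> keys s \<subseteq> Y - {x}"
  shows "ideal_gen Y ((\<lambda>p. var x * p) ` mon_ideal (Y - {x}) S) =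
    (mon_ideal Y (shift x S) :: ('v, 'k::field) mpoly set)"
proof
  show "ideal_gen Y ((\<lambda>p. var x * p) ` mon_ideal (Y - {x}) S) \<subseteq>
    (mon_ideal Y (shift x S) :: ('v, 'k) mpoly set)"
  proof (intro ideal_gen_subset_mon_ideal image_subsetI)
    fix p :: "('v, 'k) mpoly" assume p: "p \<in> mon_ideal (Y - {x}) S"
    have k: "keys (var x * p) = (\<lambda>m. m + ev x) ` keys p"
      using keys_mult_monom[of p "ev x"] by (simp add: var_eq mult.commute)
    have "m + ev x \<in> up (shift x S) \<and> keys (m + ev x) \<subseteq> Y" if m: "m \<in> keys p" for m
    proof -
      obtain s where "s \<in> S" "s \<preceq> m" using p m by (auto simp: mon_ideal_def up_def)
      then have "m + ev x \<in> up (shift x S)"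
        unfolding up_def shift_def by (auto simp: add.commute[of _ "ev x"])
      moreover have "keys m \<subseteq> Y" "keys (ev x) \<subseteq> Y"
        using p m assms(1) by (auto simp: mon_ideal_def poly_ring_def ev_def)
      ultimately show ?thesis by (simp add: keys_add_expo)
    qed
    then show "var x * p \<in> mon_ideal Y (shift x S)"
      by (auto simp: mon_ideal_def poly_ring_def k)
  qed
  show "(mon_ideal Y (shift x S) :: ('v, 'k) mpoly set) \<subseteq>
    ideal_gen Y ((\<lambda>p. var x * p) ` mon_ideal (Y - {x}) S)"
  proof (intro mon_ideal_subset_ideal_gen subsetI)
    fix q :: "('v, 'k) mpoly" assume "q \<in> monom ` shift x S"
    then obtain s where s: "s \<in> S" "q = var x * monom s"
      by (auto simp: shift_def var_eq monom_mult)
    then have "monom s \<in> (mon_ideal (Y - {x}) S :: ('v, 'k) mpoly set)"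
      using assms by (auto simp: monom_in_mon_ideal in_up)
    then show "q \<in> (\<lambda>p. var x * p) ` mon_ideal (Y - {x}) S" using s by blast
  qed
qed

lemma ideal_gen_extend:
  fixes S :: "'v expo set"
  assumes "Z \<subseteq> Y" "\<And>s. s \<in> S \<Longrightarrow> keys s \<subseteq> Z"
  shows "ideal_gen Y (mon_ideal Z S) = (mon_ideal Y S :: ('v, 'k::field) mpoly set)"
proof
  have "mon_ideal Z S \<subseteq> (mon_ideal Y S :: ('v, 'k) mpoly set)"
    using assms by (auto simp: mon_ideal_def poly_ring_def)
  then show "ideal_gen Y (mon_ideal Z S) \<subseteq> (mon_ideal Y S :: ('v, 'k) mpoly set)"
    by (rule ideal_gen_subset_mon_ideal)
  show "(mon_ideal Y S :: ('v, 'k) mpoly set) \<subseteq> ideal_gen Y (mon_ideal Z S)"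
    using assms by (intro mon_ideal_subset_ideal_gen) (auto simp: monom_in_mon_ideal in_up)
qed

lemma antichain_shift: "antichain S \<Longrightarrow> antichain (shift x S)"
  unfolding antichain_def shift_def by auto

lemma splits_mon_ideal:
  fixes S1 S2 :: "'v::finite expo set"
  assumes x: "x \<in> Y"
    and k1: "\<And>s. s \<in> S1 \<Longrightarrow> keys s \<subseteq> Y - {x}" and k2: "\<And>s. s \<in> S2 \<Longrightarrow> keys s \<subseteq> Y - {x}"
    and a1: "antichain S1" and a2: "antichain S2"
    and sp: "splits Y x (mon_ideal (Y - {x}) S1) (mon_ideal (Y - {x}) S2) (J :: ('v, 'k::field) mpoly set)"
  shows "J = mon_ideal Y (shift x S1 \<union> S2)" "antichain (shift x S1 \<union> S2)" "S2 \<subseteq> up S1"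
proof -
  let ?xJ = "mon_ideal Y (shift x S1) :: ('v, 'k) mpoly set"
  have e1: "ideal_gen Y ((\<lambda>p. var x * p) ` mon_ideal (Y - {x}) S1) = ?xJ"
    using x k1 by (rule ideal_gen_shift)
  have e2: "ideal_gen Y (mon_ideal (Y - {x}) S2) = (mon_ideal Y S2 :: ('v, 'k) mpoly set)"
    using k2 by (intro ideal_gen_extend) auto
  have ks: "keys s \<subseteq> Y" if "s \<in> shift x S1" for s
    using that k1 x by (force simp: shift_def keys_add_expo ev_def)
  have k2': "keys s \<subseteq> Y" if "s \<in> S2" for s
    using that k2 by auto
  show J: "J = mon_ideal Y (shift x S1 \<union> S2)"
    using sp unfolding splits_def Let_def e1 e2 mon_ideal_Un by (rule conjunct1)
  \<comment> \<open>All three sets of minimal generators are known, so this equation says that the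
    union of the two generating sets is its own set of minimal elements.\<close>
  have "min_gens Y J = min_gens Y ?xJ \<union> min_gens (Y - {x}) (mon_ideal (Y - {x}) S2)"
    using sp unfolding splits_def Let_def e1 by (elim conjE)
  moreover have "min_gens Y J = monom ` Mins (shift x S1 \<union> S2)"
    unfolding J using ks k2' by (intro min_gens_mon_ideal) auto
  moreover have "min_gens Y ?xJ = monom ` shift x S1"
    using min_gens_mon_ideal[of "shift x S1" Y] ks Mins_antichain[OF antichain_shift[OF a1]] by simp
  moreover have "min_gens (Y - {x}) (mon_ideal (Y - {x}) S2) = (monom ` S2 :: ('v, 'k) mpoly set)"
    using min_gens_mon_ideal[of S2 "Y - {x}"] k2 Mins_antichain[OF a2] by simp
  ultimately have "monom ` Mins (shift x S1 \<union> S2) = (monom ` (shift x S1 \<union> S2) :: ('v, 'k) mpoly set)"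
    by (simp add: image_Un)
  then have "Mins (shift x S1 \<union> S2) = shift x S1 \<union> S2"
    by (simp only: inj_image_eq_iff[OF inj_monom])
  then show "antichain (shift x S1 \<union> S2)" using antichain_Mins by metis
  show "S2 \<subseteq> up S1"
  proof
    fix s assume "s \<in> S2"
    then have "monom s \<in> (mon_ideal (Y - {x}) S2 :: ('v, 'k) mpoly set)"
      using k2 by (auto simp: monom_in_mon_ideal in_up)
    then have "monom s \<in> (mon_ideal (Y - {x}) S1 :: ('v, 'k) mpoly set)"
      using sp by (auto simp: splits_def Let_def)
    then show "s \<in> up S1" by (simp add: monom_in_mon_ideal)
  qed
qed

lemma vertex_splittable_vsplit:
  fixes J :: "('v::finite, 'k::field) mpoly set"
  assumes "vertex_splittable Y J"
  shows "\<exists>S. J = mon_ideal Y S \<and> antichain S \<and> (\<forall>s\<in>S. keys s \<subseteq> Y) \<and> vsplit S"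
  using assms
proof induction
  case (principal v Y)
  then obtain a where a: "v = monom a" "keys a \<subseteq> Y" by (auto simp: monomials_def)
  then have "ideal_gen Y {v} = mon_ideal Y {a}" using ideal_gen_monom[of "{a}" Y] by simp
  then show ?case using a by (intro exI[of _ "{a}"]) (auto simp: antichain_def intro: vsplit_single)
next
  case (zero Y)
  have "{0} = mon_ideal Y {}" by (auto simp: mon_ideal_def up_def)
  then show ?case by (intro exI[of _ "{}"]) (auto simp: antichain_def intro: vsplit_empty)
next
  case (whole Y)
  have "poly_ring Y = mon_ideal Y {0}" by (auto simp: mon_ideal_def up_def dv_def)
  then show ?case by (intro exI[of _ "{0}"]) (auto simp: antichain_def intro: vsplit_single)
next
  case (split x Y J1 J2 J)
  then obtain S1 S2 where S1: "J1 = mon_ideal (Y - {x}) S1" "antichain S1" "\<forall>s\<in>S1. keys s \<subseteq> Y - {x}" "vsplit S1"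
    and S2: "J2 = mon_ideal (Y - {x}) S2" "antichain S2" "\<forall>s\<in>S2. keys s \<subseteq> Y - {x}" "vsplit S2"
    by blast
  have *: "J = mon_ideal Y (shift x S1 \<union> S2)" "antichain (shift x S1 \<union> S2)" "S2 \<subseteq> up S1"
    using splits_mon_ideal[of x Y S1 S2 J] split S1 S2 by auto
  moreover have "vsplit (shift x S1 \<union> S2)"
  proof (rule vsplit_step)
    show "lookup s x = 0" if "s \<in> S1 \<union> S2" for s
      using that S1(3) S2(3) by (force simp: in_keys_iff)
  qed (use * S1 S2 in auto)
  moreover have "keys s \<subseteq> Y" if "s \<in> shift x S1 \<union> S2" for s
    using that S1(3) S2(3) split(1) by (force simp: shift_def keys_add_expo ev_def)
  ultimately show ?case by blast
qed

text \<open>The colon ideal (r) : s contains a variable, that is, r / gcd(r, s) is 1 or a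
  variable.\<close>

definition lin :: "'v expo \<Rightarrow> 'v expo \<Rightarrow> bool" where
  "lin r s \<longleftrightarrow> (\<exists>z. r \<preceq> s + ev z)"

lemma shift_dv_iff:
  assumes "lookup s x = 0"
  shows "ev x + s \<preceq> m \<longleftrightarrow> 0 < lookup m x \<and> s \<preceq> m"
proof (intro iffI conjI)
  assume h: "ev x + s \<preceq> m"
  show "0 < lookup m x" using dvD[OF h, of x] by (simp add: lookup_add lookup_ev)
  show "s \<preceq> m" by (rule dv_trans[OF _ h]) simp
next
  assume h: "0 < lookup m x \<and> s \<preceq> m"
  show "ev x + s \<preceq> m" unfolding dv_def
  proof
    fix y show "lookup (ev x + s) y \<le> lookup m y"
      using h dvD[of s m y] assms by (simp add: lookup_add lookup_ev Suc_le_eq)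
  qed
qed

text \<open>A weak connectedness property of ideals with linear quotients, restricted to the divisors
  of \<open>m\<close>; it is the only consequence of vertex splittability needed for subgraphs.\<close>

lemma vsplit_not_isolated:
  assumes "vsplit S" "s \<in> S" "t \<in> S" "s \<noteq> t" "s \<preceq> m" "t \<preceq> m"
  shows "\<exists>r\<in>S. r \<noteq> s \<and> r \<preceq> m \<and> (lin r s \<or> lin s r)"
  using assms
proof (induction arbitrary: s t m)
  case (vsplit_step S1 S2 x)
  have z1: "lookup s x = 0" if "s \<in> S1" for s using that vsplit_step.hyps by blast
  have z2: "lookup s x = 0" if "s \<in> S2" for s using that vsplit_step.hyps by blast
  have sh: "ev x + r \<in> shift x S1" if "r \<in> S1" for r using that by (simp add: shift_def)
  have lin_shift: "lin (ev x + r) (ev x + s) \<longleftrightarrow> lin r s" for r s :: "'a expo"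
    by (simp add: lin_def add.assoc)
  \<comment> \<open>The second element is taken in \<open>S1\<close> without the factor x. In this
    form the claim also serves for t in \<open>S2\<close>, through a divisor of t in
    \<open>S1\<close>.\<close>
  have step1: ?case if s: "s = ev x + s1" "s1 \<in> S1" and t: "t1 \<in> S1" "t1 \<noteq> s1" "t1 \<preceq> m" for s1 t1
  proof -
    have "0 < lookup m x" "s1 \<preceq> m"
      using vsplit_step.prems s shift_dv_iff[OF z1[OF s(2)]] by auto
    moreover obtain r where r: "r \<in> S1" "r \<noteq> s1" "r \<preceq> m" "lin r s1 \<or> lin s1 r"
      using vsplit_step.IH(1)[of s1 t1 m] s t \<open>s1 \<preceq> m\<close> by blast
    ultimately have "ev x + r \<preceq> m" using shift_dv_iff[OF z1[OF r(1)]] by simp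
    then show ?thesis using r s sh lin_shift by (intro bexI[of _ "ev x + r"]) auto
  qed
  show ?case
  proof (cases "s \<in> S2")
    case s2: True
    show ?thesis
    proof (cases "t \<in> S2")
      case True
      then show ?thesis using vsplit_step.IH(2)[of s t m] s2 vsplit_step.prems by blast
    next
      case False
      then obtain t1 where t1: "t = ev x + t1" "t1 \<in> S1" using vsplit_step.prems by (auto simp: shift_def)
      then have mx: "0 < lookup m x"
        using vsplit_step.prems shift_dv_iff[OF z1[OF t1(2)]] by auto
      \<comment> \<open>From t only the fact that x divides m is used. The neighbour of s is x r for
        a divisor r of s in \<open>S1\<close>: it divides x s and hence m.\<close>
      obtain r where r: "r \<in> S1" "r \<preceq> s" using vsplit_step.hyps s2 by (auto simp: up_def)
      have "ev x + r \<preceq> m"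
        using shift_dv_iff[OF z1[OF r(1)]] mx r dv_trans vsplit_step.prems(4) by blast
      moreover have "lin (ev x + r) s"
        using r by (auto simp: lin_def add.commute[of "ev x"] intro: dv_add_mono)
      moreover have "ev x + r \<noteq> s"
        using z2[OF s2] by (metis add_is_0 lookup_add lookup_ev zero_neq_one)
      ultimately show ?thesis using sh[OF r(1)] by blast
    qed
  next
    case False
    then obtain s1 where s1: "s = ev x + s1" "s1 \<in> S1" using vsplit_step.prems by (auto simp: shift_def)
    show ?thesis
    proof (cases "t \<in> S2")
      case True
      obtain t1 where t1: "t1 \<in> S1" "t1 \<preceq> t" using vsplit_step.hyps True by (auto simp: up_def)
      show ?thesis
      proof (cases "t1 = s1")
        \<comment> \<open>Now s1 divides t, so s = x s1 divides x t and t itself is the required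
          neighbour.\<close>
        case eq: True
        have "lin s t"
          using t1 s1 eq by (auto simp: lin_def add.commute[of "ev x"] intro: dv_add_mono)
        then show ?thesis using vsplit_step.prems by (intro bexI[of _ t]) auto
      next
        case False
        then show ?thesis using step1[OF s1 t1(1)] t1 vsplit_step.prems dv_trans by blast
      qed
    next
      case False
      then obtain t1 where t1: "t = ev x + t1" "t1 \<in> S1" using vsplit_step.prems by (auto simp: shift_def)
      have "t1 \<preceq> m" using t1 vsplit_step.prems shift_dv_iff[OF z1[OF t1(2)]] by auto
      then show ?thesis using step1[OF s1 t1(2)] t1 s1 vsplit_step.prems by auto
    qed
  qed
qed auto

section \<open>Linear quotients\<close>

text \<open>Linear quotients in combinatorial form, the order being that of insertion: for each
  earlier j some variable z dividing j / gcd(j, a) lies in the colon ideal of a, as witnessed by an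
  earlier k.\<close>

inductive lqs :: "'v expo set \<Rightarrow> bool" where
  lqs_empty: "lqs {}"
| lqs_insert: "lqs T \<Longrightarrow> a \<notin> T \<Longrightarrow>
    (\<And>j. j \<in> T \<Longrightarrow> \<exists>k\<in>T. \<exists>z. k \<preceq> a + ev z \<and> lookup a z < lookup j z) \<Longrightarrow> lqs (insert a T)"

lemma lqs_list:
  "lqs T \<Longrightarrow> \<exists>us. distinct us \<and> set us = T \<and> (\<forall>i<length us. \<forall>j\<in>set (take i us).
     \<exists>k\<in>set (take i us). \<exists>z. k \<preceq> us ! i + ev z \<and> lookup (us ! i) z < lookup j z)"
proof (induction rule: lqs.induct)
  case (lqs_insert T a)
  then obtain us where us: "distinct us" "set us = T" "\<forall>i<length us. \<forall>j\<in>set (take i us).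
     \<exists>k\<in>set (take i us). \<exists>z. k \<preceq> us ! i + ev z \<and> lookup (us ! i) z < lookup j z" by blast
  show ?case
  proof (intro exI[of _ "us @ [a]"] conjI allI impI)
    fix i assume "i < length (us @ [a])"
    then consider "i < length us" | "i = length us" by fastforce
    then show "\<forall>j\<in>set (take i (us @ [a])).
     \<exists>k\<in>set (take i (us @ [a])). \<exists>z. k \<preceq> (us @ [a]) ! i + ev z \<and> lookup ((us @ [a]) ! i) z < lookup j z"
    proof cases
      case 1 then show ?thesis using us(3) by (simp add: nth_append)
    next
      case 2 then show ?thesis using us(2) lqs_insert.hyps by (simp add: nth_append)
    qed
  qed (use us lqs_insert.hyps in auto)
qed simp

text \<open>The first condition puts the variables of \<open>Z\<close> into the colon ideal. By the
  second, every monomial of the colon ideal has to make up a deficit of \<open>a\<close> at some z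
  in \<open>Z\<close>, so z divides it.\<close>

lemma colon_mon_ideal:
  fixes B :: "'v expo set"
  assumes "\<And>z. z \<in> Z \<Longrightarrow> \<exists>k\<in>B. k \<preceq> a + ev z"
    and "\<And>j. j \<in> B \<Longrightarrow> \<exists>z\<in>Z. lookup a z < lookup j z"
  shows "colon (mon_ideal UNIV B) (monom a) = (mon_ideal UNIV (ev ` Z) :: ('v, 'k::field) mpoly set)"
proof -
  have "m + a \<in> up B \<longleftrightarrow> m \<in> up (ev ` Z)" for m
  proof
    assume "m + a \<in> up B"
    then obtain j where j: "j \<in> B" "j \<preceq> m + a" by (auto simp: up_def)
    then obtain z where z: "z \<in> Z" "lookup a z < lookup j z" using assms(2) by blast
    then have "0 < lookup m z" using dvD[OF j(2), of z] by (simp add: lookup_add)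
    then show "m \<in> up (ev ` Z)" using z by (auto simp: up_def ev_dv_iff)
  next
    assume "m \<in> up (ev ` Z)"
    then obtain z where z: "z \<in> Z" "ev z \<preceq> m" by (auto simp: up_def)
    then obtain k where "k \<in> B" "k \<preceq> a + ev z" using assms(1) by blast
    moreover have "a + ev z \<preceq> m + a" using z by (simp add: add.commute[of m])
    ultimately show "m + a \<in> up B" unfolding up_def using dv_trans by blast
  qed
  then show ?thesis by (auto simp: colon_def mon_ideal_def keys_mult_monom)
qed

lemma ideal_gen_var: "ideal_gen UNIV (var ` Z) = mon_ideal UNIV (ev ` Z)"
  using ideal_gen_monom[of "ev ` Z" UNIV] by (simp add: image_image var_eq)

lemma ideal_gen_monom_UNIV: "ideal_gen UNIV (monom ` S) = mon_ideal UNIV S"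
  by (rule ideal_gen_monom) simp

lemma lqs_linear_quotients:
  fixes T :: "'v::finite expo set"
  assumes "lqs T" "antichain T"
  shows "linear_quotients (mon_ideal UNIV T :: ('v, 'k::field) mpoly set)"
proof -
  obtain us where us: "distinct us" "set us = T" "\<forall>i<length us. \<forall>j\<in>set (take i us).
     \<exists>k\<in>set (take i us). \<exists>z. k \<preceq> us ! i + ev z \<and> lookup (us ! i) z < lookup j z"
    using lqs_list[OF assms(1)] by blast
  have mg: "min_gens UNIV (mon_ideal UNIV T) = (monom ` T :: ('v, 'k) mpoly set)"
    using min_gens_mon_ideal[of T UNIV] Mins_antichain[OF assms(2)] by simp
  show ?thesis unfolding linear_quotients_def
  proof (intro exI[of _ "map monom us"] conjI allI impI)
    show "distinct (map monom us :: ('v, 'k) mpoly list)"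
      using us(1) by (simp add: distinct_map inj_on_def)
    show "set (map monom us) = min_gens UNIV (mon_ideal UNIV T :: ('v, 'k) mpoly set)"
      using mg us(2) by simp
    fix i assume i: "1 \<le> i \<and> i < length (map monom us :: ('v, 'k) mpoly list)"
    \<comment> \<open>All variables in the colon ideal; the condition carried by \<open>lqs\<close>
      makes them generate it.\<close>
    define Z where "Z = {z. \<exists>k\<in>set (take i us). k \<preceq> us ! i + ev z}"
    have "colon (mon_ideal UNIV (set (take i us))) (monom (us ! i)) =
        (mon_ideal UNIV (ev ` Z) :: ('v, 'k) mpoly set)"
    proof (rule colon_mon_ideal)
      fix j assume "j \<in> set (take i us)"
      then obtain k z where "k \<in> set (take i us)" "k \<preceq> us ! i + ev z" "lookup (us ! i) z < lookup j z"
        using us(3) i by fastforce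
      then show "\<exists>z\<in>Z. lookup (us ! i) z < lookup j z" by (auto simp: Z_def)
    qed (simp add: Z_def)
    then show "\<exists>S. colon (ideal_gen UNIV (set (take i (map monom us)))) (map monom us ! i) =
        (ideal_gen UNIV (var ` S) :: ('v, 'k) mpoly set)"
      using i by (intro exI[of _ Z]) (simp add: ideal_gen_var take_map ideal_gen_monom_UNIV)
  qed
qed

text \<open>Let q be the later of the two in the order. The colon ideal of q contains p / gcd(p, q)
  and hence a variable z dividing it, so some earlier r divides z q. As z occurs in p more often
  than in q, this r divides lcm(p, q), and the hypothesis leaves only r = p.\<close>

lemma linear_quotients_pair:
  fixes T :: "'v::finite expo set"
  assumes lq: "linear_quotients (mon_ideal UNIV T :: ('v, 'k::field) mpoly set)" and T: "antichain T"
    and pq: "p \<in> T" "q \<in> T" "p \<noteq> q"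
    and only: "\<And>r. r \<in> T \<Longrightarrow> (\<And>x. lookup r x \<le> max (lookup p x) (lookup q x)) \<Longrightarrow> r = p \<or> r = q"
  shows "lin p q \<or> lin q p"
proof -
  obtain us :: "('v, 'k) mpoly list" where us: "distinct us" "set us = min_gens UNIV (mon_ideal UNIV T)"
    "\<forall>i. 1 \<le> i \<and> i < length us \<longrightarrow>
       (\<exists>S. colon (ideal_gen UNIV (set (take i us))) (us ! i) = ideal_gen UNIV (var ` S))"
    using lq unfolding linear_quotients_def by blast
  have "set us = monom ` T"
    using us(2) min_gens_mon_ideal[of T UNIV] Mins_antichain[OF T] by simp
  then have "set us \<subseteq> range monom" by auto
  then obtain vs where vs: "us = map monom vs" by (metis ex_map_conv subset_iff imageE)
  have vT: "set vs = T"
    using \<open>set us = monom ` T\<close> by (simp only: vs set_map inj_image_eq_iff[OF inj_monom])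
  have dist: "distinct vs" using us(1) vs by (simp add: distinct_map)
  have main: "lin p q" if ij: "i < j" "j < length vs" "vs ! i = p" "vs ! j = q"
    and only: "\<And>r. r \<in> T \<Longrightarrow> (\<And>x. lookup r x \<le> max (lookup p x) (lookup q x)) \<Longrightarrow> r = p \<or> r = q"
    for i j p q
  proof -
    obtain S where "colon (ideal_gen UNIV (set (take j us))) (us ! j) = (ideal_gen UNIV (var ` S) :: ('v, 'k) mpoly set)"
      using us(3) ij vs by (metis One_nat_def Suc_leI gr0I length_map not_less0)
    then have S: "colon (mon_ideal UNIV (set (take j vs))) (monom q) = (mon_ideal UNIV (ev ` S) :: ('v, 'k) mpoly set)"
      using vs ij by (simp add: take_map ideal_gen_monom_UNIV ideal_gen_var)
    have mem: "m \<in> up (ev ` S) \<longleftrightarrow> m + q \<in> up (set (take j vs))" for m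
    proof -
      have "monom m \<in> (mon_ideal UNIV (ev ` S) :: ('v, 'k) mpoly set) \<longleftrightarrow>
         monom m * monom q \<in> (mon_ideal UNIV (set (take j vs)) :: ('v, 'k) mpoly set)"
        unfolding S[symmetric] colon_def by simp
      then show ?thesis by (simp add: monom_mult monom_in_mon_ideal)
    qed
    have "p \<in> set (take j vs)" using ij by (auto simp: in_set_conv_nth intro!: exI[of _ i])
    \<comment> \<open>Subtraction is truncated, so \<open>p - q\<close> is the exponent of p /
      gcd(p, q).\<close>
    moreover have "p \<preceq> (p - q) + q" unfolding dv_def lookup_add lookup_minus by (intro allI) linarith
    ultimately have "(p - q) + q \<in> up (set (take j vs))" unfolding up_def by blast
    then obtain z where z: "z \<in> S" "0 < lookup (p - q) z"
      unfolding mem[symmetric] by (auto simp: up_def ev_dv_iff)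
    then have "ev z \<in> up (ev ` S)" by (intro in_up) simp
    then obtain r where r: "r \<in> set (take j vs)" "r \<preceq> ev z + q" unfolding mem by (auto simp: up_def)
    have "r \<in> T" using r vT set_take_subset by fastforce
    moreover have "lookup r x \<le> max (lookup p x) (lookup q x)" for x
      using dvD[OF r(2), of x] z by (auto simp: lookup_add lookup_ev lookup_minus split: if_splits)
    ultimately have "r = p \<or> r = q" by (rule only)
    moreover have "r \<noteq> q"
      using r(1) dist ij by (auto simp: in_set_conv_nth nth_eq_iff_index_eq)
    ultimately show ?thesis using r by (auto simp: lin_def add.commute[of q])
  qed
  obtain i j where ij: "i < length vs" "j < length vs" "vs ! i = p" "vs ! j = q"
    using pq vT by (auto simp: in_set_conv_nth)
  then consider "i < j" | "j < i" using pq(3) by fastforce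
  then show ?thesis
  proof cases
    case 1 then show ?thesis using main[of i j p q] ij only by blast
  next
    case 2
    have "lin q p" by (rule main[OF 2]) (use ij only in \<open>auto simp: max.commute\<close>)
    then show ?thesis ..
  qed
qed

text \<open>Within the batch any order will do: the witness for j against a is j itself or an
  element of \<open>T\<close>, and \<open>T\<close> precedes the whole batch.\<close>

lemma lqs_add_batch:
  assumes "finite B" "lqs T" "B \<inter> T = {}"
    and "\<And>a j. a \<in> B \<Longrightarrow> j \<in> T \<union> B \<Longrightarrow> j \<noteq> a \<Longrightarrow>
      \<exists>z. lookup a z < lookup j z \<and> (j \<preceq> a + ev z \<or> (\<exists>k\<in>T. k \<preceq> a + ev z))"
  shows "lqs (T \<union> B)"
  using assms
proof (induction B)
  case (insert b B)
  have "lqs (insert b (T \<union> B))"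
  proof (rule lqs_insert)
    show "lqs (T \<union> B)" using insert.prems by (intro insert.IH) auto
    show "b \<notin> T \<union> B" using insert by auto
    fix j assume j: "j \<in> T \<union> B"
    then have "j \<noteq> b" using insert by auto
    then have "\<exists>z. lookup b z < lookup j z \<and> (j \<preceq> b + ev z \<or> (\<exists>k\<in>T. k \<preceq> b + ev z))"
      using insert.prems(3)[of b j] j by auto
    then show "\<exists>k\<in>T \<union> B. \<exists>z. k \<preceq> b + ev z \<and> lookup b z < lookup j z" using j by blast
  qed
  then show ?case by simp
qed auto

text \<open>Replaces an order by a rank function. Ties may be broken arbitrarily because a witness
  is either j itself or of strictly smaller rank; rank 0 is left to an order known
  beforehand.\<close>

lemma lqs_rank:
  fixes \<rho> :: "'v expo \<Rightarrow> nat"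
  assumes "finite Z" "lqs {t\<in>Z. \<rho> t = 0}"
    and step: "\<And>a j. a \<in> Z \<Longrightarrow> j \<in> Z \<Longrightarrow> j \<noteq> a \<Longrightarrow> 0 < \<rho> a \<Longrightarrow> \<rho> j \<le> \<rho> a \<Longrightarrow>
      \<exists>z. lookup a z < lookup j z \<and> (j \<preceq> a + ev z \<or> (\<exists>k\<in>Z. \<rho> k < \<rho> a \<and> k \<preceq> a + ev z))"
  shows "lqs Z"
proof -
  have "lqs {t\<in>Z. \<rho> t \<le> n}" for n
  proof (induction n)
    case (Suc n)
    have "lqs ({t\<in>Z. \<rho> t \<le> n} \<union> {t\<in>Z. \<rho> t = Suc n})"
    proof (rule lqs_add_batch[OF _ Suc])
      fix a j assume aj: "a \<in> {t\<in>Z. \<rho> t = Suc n}" "j \<in> {t\<in>Z. \<rho> t \<le> n} \<union> {t\<in>Z. \<rho> t = Suc n}" "j \<noteq> a"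
      then have "\<exists>z. lookup a z < lookup j z \<and> (j \<preceq> a + ev z \<or> (\<exists>k\<in>Z. \<rho> k < \<rho> a \<and> k \<preceq> a + ev z))"
        by (intro step) auto
      then show "\<exists>z. lookup a z < lookup j z \<and> (j \<preceq> a + ev z \<or> (\<exists>k\<in>{t\<in>Z. \<rho> t \<le> n}. k \<preceq> a + ev z))"
        using aj(1) by auto
    qed (use assms(1) in auto)
    moreover have "{t\<in>Z. \<rho> t \<le> n} \<union> {t\<in>Z. \<rho> t = Suc n} = {t\<in>Z. \<rho> t \<le> Suc n}" by auto
    ultimately show ?case by simp
  qed (use assms(2) in simp)
  moreover obtain n where "\<forall>t\<in>Z. \<rho> t \<le> n"
    using finite_imageI[OF assms(1), of \<rho>] by (auto simp: finite_nat_set_iff_bounded_le)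
  then have "{t\<in>Z. \<rho> t \<le> n} = Z" by auto
  ultimately show ?thesis by metis
qed

text \<open>The edge ideal of a complete graph, one vertex u at a time. Against a new product u q,
  an old product has a factor r other than q, and q r divides u q r; a new product u q' divides u q
  q'.\<close>

lemma lqs_pairs:
  assumes "finite N"
  shows "lqs {ev p + ev q | p q. p \<in> N \<and> q \<in> N \<and> p \<noteq> q}"
  using assms
proof induction
  case (insert u N)
  let ?T = "{ev p + ev q | p q. p \<in> N \<and> q \<in> N \<and> p \<noteq> q}" and ?B = "(\<lambda>q. ev u + ev q) ` N"
  have "lqs (?T \<union> ?B)"
  proof (rule lqs_add_batch[OF _ insert.IH])
    show "finite ?B" using insert by auto
    show "?B \<inter> ?T = {}"
    proof -
      have "lookup t u = 0" if "t \<in> ?T" for t using that insert(2) by (auto simp: lookup_add lookup_ev)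
      moreover have "0 < lookup t u" if "t \<in> ?B" for t using that by (auto simp: lookup_add lookup_ev)
      ultimately show ?thesis by fastforce
    qed
    fix a j assume a: "a \<in> ?B" and j: "j \<in> ?T \<union> ?B" "j \<noteq> a"
    obtain q where q: "q \<in> N" "a = ev u + ev q" using a by auto
    have uq: "u \<noteq> q" using q insert by auto
    show "\<exists>z. lookup a z < lookup j z \<and> (j \<preceq> a + ev z \<or> (\<exists>k\<in>?T. k \<preceq> a + ev z))"
    proof (cases "j \<in> ?T")
      case True
      then obtain p1 p2 where p: "p1 \<in> N" "p2 \<in> N" "p1 \<noteq> p2" "j = ev p1 + ev p2" by auto
      obtain r where r: "r \<in> N" "r \<noteq> q" "0 < lookup j r"
      proof (cases "p1 = q")
        case True then show ?thesis using p that[of p2] by (auto simp: lookup_add lookup_ev)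
      next
        case False then show ?thesis using p that[of p1] by (auto simp: lookup_add lookup_ev)
      qed
      have "u \<noteq> r" using r insert by auto
      have "ev q + ev r \<in> ?T" using q r by blast
      moreover have "ev q + ev r \<preceq> a + ev r" by (simp add: q dv_def lookup_add)
      moreover have "lookup a r < lookup j r" using r \<open>u \<noteq> r\<close> by (simp add: q lookup_add lookup_ev)
      ultimately show ?thesis by blast
    next
      case False
      then obtain q' where q': "q' \<in> N" "j = ev u + ev q'" using j by auto
      then have "lookup a q' < lookup j q'" using j q insert by (auto simp: lookup_add lookup_ev)
      moreover have "j \<preceq> a + ev q'" by (simp add: q q' dv_def lookup_add)
      ultimately show ?thesis by blast
    qed
  qed
  moreover have "?T \<union> ?B = {ev p + ev q | p q. p \<in> insert u N \<and> q \<in> insert u N \<and> p \<noteq> q}"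
    using insert(2) by (auto simp: add.commute)
  ultimately show ?case by simp
qed (simp add: lqs_empty)

lemma lqs_shift:
  assumes "lqs A" shows "lqs (shift x A)"
  using assms
proof induction
  case (lqs_insert T a)
  have "lqs (insert (ev x + a) (shift x T))"
  proof (rule lqs.lqs_insert[OF lqs_insert.IH])
    show "ev x + a \<notin> shift x T" using lqs_insert.hyps by (auto simp: shift_def)
    fix j assume "j \<in> shift x T"
    then obtain i where i: "i \<in> T" "j = ev x + i" by (auto simp: shift_def)
    then obtain k z where "k \<in> T" "k \<preceq> a + ev z" "lookup a z < lookup i z" using lqs_insert.hyps by blast
    then have "ev x + k \<in> shift x T" "ev x + k \<preceq> ev x + a + ev z" "lookup (ev x + a) z < lookup j z"
      using i by (auto simp: shift_def add.assoc lookup_add)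
    then show "\<exists>k\<in>shift x T. \<exists>z. k \<preceq> ev x + a + ev z \<and> lookup (ev x + a) z < lookup j z" by blast
  qed
  then show ?case by (simp add: shift_def)
qed (simp add: shift_def lqs_empty)

text \<open>The elements of x A come first. Against any of them an element a of \<open>B\<close>
  uses the variable x: some k in \<open>A\<close> divides a, and then x k divides x a.\<close>

lemma lqs_shift_Un:
  assumes "lqs A" "lqs B" "\<And>b. b \<in> B \<Longrightarrow> lookup b x = 0" "B \<subseteq> up A"
  shows "lqs (shift x A \<union> B)"
  using assms(2-4)
proof induction
  case lqs_empty
  then show ?case using lqs_shift[OF assms(1)] by simp
next
  case (lqs_insert T a)
  have "lqs (insert a (shift x A \<union> T))"
  proof (rule lqs.lqs_insert)
    show "lqs (shift x A \<union> T)" using lqs_insert by auto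
    have ax: "lookup a x = 0" using lqs_insert.prems by auto
    then show "a \<notin> shift x A \<union> T" using lqs_insert.hyps by (auto simp: shift_def lookup_add lookup_ev)
    fix j assume j: "j \<in> shift x A \<union> T"
    show "\<exists>k\<in>shift x A \<union> T. \<exists>z. k \<preceq> a + ev z \<and> lookup a z < lookup j z"
    proof (cases "j \<in> T")
      case True
      then show ?thesis using lqs_insert.hyps by blast
    next
      case False
      obtain k where k: "k \<in> A" "k \<preceq> a" using lqs_insert.prems by (auto simp: up_def)
      have "ev x + k \<preceq> a + ev x" using k by (simp add: add.commute[of a])
      moreover have "lookup a x < lookup j x" using ax False j by (auto simp: shift_def lookup_add lookup_ev)
      moreover have "ev x + k \<in> shift x A" using k by (simp add: shift_def)
      ultimately show ?thesis by blast
    qed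
  qed
  then show ?case by simp
qed

section \<open>Homological shifts and vertex splittings on generators\<close>

definition U2 :: "'v expo set \<Rightarrow> 'v expo set" where
  "U2 S = {a. \<exists>s\<in>S. \<exists>t\<in>S. s \<noteq> t \<and> s \<preceq> a \<and> t \<preceq> a}"

text \<open>So \<open>U2 S\<close> already is the set of monomials of an ideal, the one generated by
  the least common multiples of pairs. Recording two divisors avoids an operation for least common
  multiples.\<close>

lemma up_U2: "up (U2 S) = U2 S"
  unfolding up_def U2_def using dv_refl dv_trans by blast

lemma up_shift_subset:
  assumes "up A \<subseteq> up B" shows "up (shift x A) \<subseteq> up (shift x B)"
proof
  fix a assume "a \<in> up (shift x A)"
  then obtain s where s: "s \<in> A" "ev x + s \<preceq> a" by (auto simp: up_def shift_def)
  then have "s \<in> up B" using assms in_up by blast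
  then obtain t where t: "t \<in> B" "t \<preceq> s" by (auto simp: up_def)
  then have "ev x + t \<preceq> a" using s(2) dv_trans[of "ev x + t" "ev x + s"] by simp
  then show "a \<in> up (shift x B)" using t by (auto simp: up_def shift_def)
qed

lemma up_shift_cong: "up A = up B \<Longrightarrow> up (shift x A) = up (shift x B)"
  by (intro antisym up_shift_subset) auto

lemma up_Un: "up (A \<union> B) = up A \<union> up B"
  by (auto simp: up_def)

text \<open>If x divided t, then t / x would keep both of its divisors in \<open>S\<close>, against
  the minimality of t.\<close>

lemma Mins_U2_free:
  assumes "\<And>s. s \<in> S \<Longrightarrow> lookup s x = 0" "t \<in> Mins (U2 S)"
  shows "lookup t x = 0"
proof (rule ccontr)
  assume "lookup t x \<noteq> 0"
  then have d: "t = (t - ev x) + ev x" by (intro dv_minus_add[symmetric]) (simp add: ev_dv_iff)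
  have "s \<preceq> t - ev x" if "s \<in> S" "s \<preceq> t" for s
    using assms(1)[OF that(1)] dvD[OF that(2)] by (auto simp: dv_def lookup_minus lookup_ev)
  then have "t - ev x \<in> U2 S" using assms(2) unfolding Mins_def U2_def by blast
  moreover have "t - ev x \<preceq> t" by (simp add: dv_def lookup_minus)
  ultimately have "t - ev x = t" using assms(2) by (auto simp: Mins_def)
  then have "lookup (ev x) x = 0" using d by (metis add_cancel_right_right lookup_zero)
  then show False by (simp add: lookup_ev)
qed

text \<open>Products of pairs, which are their least common multiples when the elements are powers
  of different variables.\<close>

definition sums :: "'v expo set \<Rightarrow> 'v expo set" where
  "sums S = {s + t | s t. s \<in> S \<and> t \<in> S \<and> s \<noteq> t}"

text \<open>A pair from x S1 has the least common multiple x s t. For a mixed pair x s, t the least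
  common multiple is a multiple of x t, and x t is attained because some s in \<open>S1\<close>
  divides t; so the mixed pairs contribute x S2. Pairs from \<open>S2\<close> contribute
  \<open>U2 S2\<close>.\<close>

lemma Mins_U2_split:
  fixes S1 S2 :: "'v::finite expo set"
  assumes z1: "\<And>s. s \<in> S1 \<Longrightarrow> lookup s x = 0" and z2: "\<And>s. s \<in> S2 \<Longrightarrow> lookup s x = 0"
    and above: "S2 \<subseteq> up S1" and anti: "antichain S2"
    and coprime: "\<And>s t a. s \<in> S1 \<Longrightarrow> t \<in> S1 \<Longrightarrow> s \<noteq> t \<Longrightarrow> s \<preceq> a \<Longrightarrow> t \<preceq> a \<Longrightarrow> s + t \<preceq> a"
  defines "Q \<equiv> sums S1 \<union> S2"
  shows "Mins (U2 (shift x S1 \<union> S2)) = shift x (Mins Q) \<union> Mins (U2 S2)"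
proof (rule antichain_up_unique)
  let ?S = "shift x S1 \<union> S2"
  show "antichain (Mins (U2 ?S))" by (rule antichain_Mins)
  have free: "lookup t x = 0" if "t \<in> Mins (U2 S2)" for t
    using that z2 by (rule Mins_U2_free[rotated])
  show "antichain (shift x (Mins Q) \<union> Mins (U2 S2))"
    unfolding antichain_def
  proof (intro ballI impI)
    fix s t assume st: "s \<in> shift x (Mins Q) \<union> Mins (U2 S2)" "t \<in> shift x (Mins Q) \<union> Mins (U2 S2)" "s \<preceq> t"
    consider "s \<in> shift x (Mins Q)" "t \<in> shift x (Mins Q)" | "s \<in> Mins (U2 S2)" "t \<in> Mins (U2 S2)"
      | "s \<in> shift x (Mins Q)" "t \<in> Mins (U2 S2)" | "s \<in> Mins (U2 S2)" "t \<in> shift x (Mins Q)"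
      using st by blast
    then show "s = t"
    proof cases
      case 1 show ?thesis by (rule antichainD[OF antichain_shift[OF antichain_Mins] 1 st(3)])
    next
      case 2 show ?thesis by (rule antichainD[OF antichain_Mins 2 st(3)])
    next
      case 3
      then have "0 < lookup s x" by (auto simp: shift_def lookup_add lookup_ev)
      then show ?thesis using free[OF 3(2)] dvD[OF st(3), of x] by simp
    next
      case 4
      obtain b where b: "b \<in> Mins Q" "t = ev x + b" using 4 by (auto simp: shift_def)
      have "s \<preceq> b" unfolding dv_def
      proof
        fix y show "lookup s y \<le> lookup b y"
          using free[OF 4(1)] dvD[OF st(3), of y] b by (cases "y = x") (auto simp: lookup_add lookup_ev)
      qed
      \<comment> \<open>s has two distinct divisors in \<open>S2\<close>, a part of
        \<open>Q\<close>. As s divides b, the minimality of b in \<open>Q\<close> would identify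
        both of them with b.\<close>
      obtain s1 s2 where s12: "s1 \<in> S2" "s2 \<in> S2" "s1 \<noteq> s2" "s1 \<preceq> s" "s2 \<preceq> s"
        using 4(1) Mins_subset unfolding U2_def by blast
      then have "s1 \<preceq> b" "s2 \<preceq> b" using \<open>s \<preceq> b\<close> dv_trans by blast+
      then have "s1 = b" "s2 = b" using b(1) s12 by (auto simp: Mins_def Q_def)
      then show ?thesis using s12 by simp
    qed
  qed
  have 1: "up (shift x Q) \<union> U2 S2 \<subseteq> U2 ?S"
  proof
    fix a assume "a \<in> up (shift x Q) \<union> U2 S2"
    then consider "a \<in> U2 S2" | q where "q \<in> sums S1" "ev x + q \<preceq> a" | q where "q \<in> S2" "ev x + q \<preceq> a"
      by (auto simp: up_def shift_def Q_def)
    then show "a \<in> U2 ?S"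
    proof cases
      case 1 then show ?thesis by (auto simp: U2_def)
    next
      case (2 q)
      then obtain s t where st: "s \<in> S1" "t \<in> S1" "s \<noteq> t" "q = s + t" by (auto simp: sums_def)
      have "ev x + s \<preceq> ev x + q" "ev x + t \<preceq> ev x + q" using st by simp_all
      then have "ev x + s \<preceq> a" "ev x + t \<preceq> a" using 2 dv_trans by blast+
      moreover have "ev x + s \<in> ?S" "ev x + t \<in> ?S" using st by (auto simp: shift_def)
      moreover have "ev x + s \<noteq> ev x + t" using st by simp
      ultimately show ?thesis unfolding U2_def by blast
    next
      case (3 q)
      obtain s where s: "s \<in> S1" "s \<preceq> q" using above 3 by (auto simp: up_def)
      have "ev x + s \<preceq> a" using s 3 dv_trans[of "ev x + s" "ev x + q"] by simp
      moreover have "q \<preceq> a" using 3 dv_trans[of q "ev x + q"] by simp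
      moreover have "ev x + s \<noteq> q" using z2[OF 3(1)] by (metis add_is_0 lookup_add lookup_ev zero_neq_one)
      moreover have "ev x + s \<in> ?S" "q \<in> ?S" using s 3 by (auto simp: shift_def)
      ultimately show ?thesis unfolding U2_def by blast
    qed
  qed
  have *: "a \<in> up (shift x Q)" if s: "s \<in> shift x S1" "s \<preceq> a" and t: "t \<in> ?S" "t \<preceq> a" "s \<noteq> t" for s t a
  proof -
    obtain s1 where s1: "s1 \<in> S1" "s = ev x + s1" using s by (auto simp: shift_def)
    have ax: "0 < lookup a x" "s1 \<preceq> a" using s(2) s1 shift_dv_iff[OF z1[OF s1(1)]] by auto
    show ?thesis
    proof (cases "t \<in> S2")
      case True
      then have "ev x + t \<preceq> a" using shift_dv_iff[OF z2[OF True]] ax t by simp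
      then show ?thesis using True by (auto simp: up_def shift_def Q_def)
    next
      case False
      then obtain t1 where t1: "t1 \<in> S1" "t = ev x + t1" using t by (auto simp: shift_def)
      have "t1 \<preceq> a" using t(2) t1 shift_dv_iff[OF z1[OF t1(1)]] by auto
      moreover have "s1 \<noteq> t1" using t s1 t1 by auto
      ultimately have "s1 + t1 \<preceq> a" "s1 + t1 \<in> Q" using coprime s1 t1 ax by (auto simp: Q_def sums_def)
      moreover have "lookup (s1 + t1) x = 0" using z1 s1 t1 by (simp add: lookup_add)
      ultimately have "ev x + (s1 + t1) \<preceq> a" using ax shift_dv_iff[of "s1 + t1" x a] by blast
      then show ?thesis using \<open>s1 + t1 \<in> Q\<close> by (auto simp: up_def shift_def)
    qed
  qed
  have 2: "U2 ?S \<subseteq> up (shift x Q) \<union> U2 S2"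
  proof
    fix a assume "a \<in> U2 ?S"
    then obtain s t where st: "s \<in> ?S" "t \<in> ?S" "s \<noteq> t" "s \<preceq> a" "t \<preceq> a" by (auto simp: U2_def)
    show "a \<in> up (shift x Q) \<union> U2 S2"
    proof (cases "s \<in> S2 \<and> t \<in> S2")
      case True then show ?thesis using st by (auto simp: U2_def)
    next
      case False then show ?thesis using *[of s a t] *[of t a s] st by blast
    qed
  qed
  show "up (Mins (U2 ?S)) = up (shift x (Mins Q) \<union> Mins (U2 S2))"
    unfolding up_Un up_Mins up_U2 up_shift_cong[OF up_Mins] using 1 2 by blast
qed

section \<open>Edge ideals of weighted oriented graphs\<close>

definition edge_expo :: "('v \<Rightarrow> nat) \<Rightarrow> 'v \<times> 'v \<Rightarrow> 'v expo" where
  "edge_expo w e = ev (fst e) + single (snd e) (w (snd e))"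

definition adj :: "('v \<times> 'v) set \<Rightarrow> 'v \<Rightarrow> 'v \<Rightarrow> bool" where
  "adj E u v \<longleftrightarrow> (u, v) \<in> E \<or> (v, u) \<in> E"

definition path6_free :: "('v \<times> 'v) set \<Rightarrow> ('v \<Rightarrow> nat) \<Rightarrow> bool" where
  "path6_free E w \<longleftrightarrow> (\<forall>a b c d. distinct [a, b, c, d] \<and> (a, b) \<in> E \<and> (b, c) \<in> E \<and> (c, d) \<in> E \<and>
     1 < w b \<and> w c = 1 \<and> 1 < w d \<longrightarrow> adj E a c \<or> adj E a d \<or> adj E b d)"

text \<open>A triangle has no chords to exclude, and in an asymmetric edge set its three vertices
  are automatically distinct.\<close>

definition cycle7_free :: "('v \<times> 'v) set \<Rightarrow> ('v \<Rightarrow> nat) \<Rightarrow> bool" where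
  "cycle7_free E w \<longleftrightarrow> (\<forall>a b c. (a, b) \<in> E \<and> (b, c) \<in> E \<and> (c, a) \<in> E \<and> w a = 1 \<longrightarrow> w b \<le> 2 \<or> w c \<le> 2)"

text \<open>Only the head of the middle edge gets a weight condition: its tail is a source of the
  induced path and has weight 1 there by convention.\<close>

definition path8_free :: "('v \<times> 'v) set \<Rightarrow> ('v \<Rightarrow> nat) \<Rightarrow> bool" where
  "path8_free E w \<longleftrightarrow> (\<forall>a b c d. distinct [a, b, c, d] \<and> (b, a) \<in> E \<and> (c, d) \<in> E \<and>
     ((b, c) \<in> E \<and> w c = 1 \<or> (c, b) \<in> E \<and> w b = 1) \<and> 1 < w a \<and> 1 < w d \<longrightarrow>
     adj E a c \<or> adj E a d \<or> adj E b d)"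

locale weighted_graph =
  fixes E :: "('v::finite \<times> 'v) set" and w :: "'v \<Rightarrow> nat"
  assumes asym: "(u, v) \<in> E \<Longrightarrow> (v, u) \<notin> E" and wpos: "0 < w v"
begin

lemma irrefl: "(u, u) \<notin> E"
  using asym by blast

lemma lookup_edge_expo: "(u, v) \<in> E \<Longrightarrow>
  lookup (edge_expo w (u, v)) z = (if z = u then 1 else if z = v then w v else 0)"
  using irrefl by (auto simp: edge_expo_def lookup_add lookup_ev lookup_single)

text \<open>As weights are positive, the support of a generator consists of the two ends of its
  edge, and an asymmetric set has at most one edge on two given vertices.\<close>

lemma edge_expo_inj:
  assumes "e \<in> E" "f \<in> E" "edge_expo w e \<preceq> edge_expo w f" shows "e = f"
proof -
  obtain a b c d where ef: "e = (a, b)" "f = (c, d)" by (cases e, cases f)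
  have "a \<noteq> b" "c \<noteq> d" using assms ef irrefl by auto
  have "lookup (edge_expo w e) a > 0" "lookup (edge_expo w e) b > 0"
    using assms(1) ef wpos by (auto simp: lookup_edge_expo)
  then have "lookup (edge_expo w f) a > 0" "lookup (edge_expo w f) b > 0"
    using dvD[OF assms(3)] by (meson less_le_trans)+
  then have "a \<in> {c, d}" "b \<in> {c, d}"
    using assms(2) ef by (auto simp: lookup_edge_expo split: if_splits)
  then show ?thesis using assms ef asym \<open>a \<noteq> b\<close> by auto
qed

lemma antichain_edge_expo: "F \<subseteq> E \<Longrightarrow> antichain (edge_expo w ` F)"
  using edge_expo_inj unfolding antichain_def by blast

text \<open>If c were adjacent to p or q, \<open>vsplit_not_isolated\<close> would give an edge from
  c to p, from p to c or from q to c whose generator is linear with p q^(w q) in one direction.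
  Neither direction is possible: these edges bring in c together with a second factor, since their
  heads are heavy, and they lack either two powers of q, or p and a power of q.\<close>

lemma heavy_edge_isolated:
  assumes vs: "vsplit (edge_expo w ` E)" and pq: "(p, q) \<in> E" "1 < w q" and c: "c \<noteq> p" "c \<noteq> q" "(c, q) \<notin> E"
    and heavy: "(c, p) \<in> E \<Longrightarrow> 1 < w p" "(p, c) \<in> E \<Longrightarrow> 1 < w c" "(q, c) \<in> E \<Longrightarrow> 1 < w c"
  shows "\<not> adj E c p \<and> \<not> adj E c q"
proof (rule ccontr)
  assume "\<not> (\<not> adj E c p \<and> \<not> adj E c q)"
  then obtain f where f: "f \<in> E" "f = (c, p) \<or> f = (p, c) \<or> f = (q, c)"
    using c by (auto simp: adj_def)
  have npq: "p \<noteq> q" using pq irrefl by auto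
  let ?s = "edge_expo w (p, q)" and ?t = "edge_expo w f"
  \<comment> \<open>The exponents suffice for every edge within {p, q, c}, so the generators
    dividing m are those of the induced subgraph on these three vertices.\<close>
  let ?m = "single p (Suc (w p)) + single q (Suc (w q)) + single c (Suc (w c))"
  have lm: "lookup ?m z = (if z = p then Suc (w p) else if z = q then Suc (w q) else if z = c then Suc (w c) else 0)" for z
    using c npq by (simp add: lookup_add lookup_single when_def)
  have "?s \<preceq> ?m" "?t \<preceq> ?m"
    using pq(1) f unfolding dv_def lm by (auto simp: lookup_edge_expo)
  moreover have "?s \<noteq> ?t" using edge_expo_inj[OF pq(1) f(1)] f(2) c by auto
  ultimately obtain r where r: "r \<in> edge_expo w ` E" "r \<noteq> ?s" "r \<preceq> ?m" "lin r ?s \<or> lin ?s r"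
    using vsplit_not_isolated[OF vs, of ?s ?t ?m] pq(1) f(1) by blast
  obtain a b where ab: "(a, b) \<in> E" "r = edge_expo w (a, b)" using r(1) by auto
  have "0 < lookup r a" "0 < lookup r b" using ab wpos by (auto simp: lookup_edge_expo)
  then have "0 < lookup ?m a" "0 < lookup ?m b" using dvD[OF r(3)] by (meson less_le_trans)+
  then have "a \<in> {p, q, c}" "b \<in> {p, q, c}" unfolding lm by (auto split: if_splits)
  moreover have "(a, b) \<noteq> (p, q)" using r(2) ab by auto
  ultimately consider "a = c" "b = p" | "a = p" "b = c" | "a = q" "b = c"
    using ab(1) asym[OF pq(1)] irrefl c by auto
  note cases3 = this
  obtain z where "r \<preceq> ?s + ev z \<or> ?s \<preceq> r + ev z" using r(4) by (auto simp: lin_def)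
  then have z: "(\<forall>y. lookup r y \<le> lookup ?s y + (if y = z then 1 else 0)) \<or>
     (\<forall>y. lookup ?s y \<le> lookup r y + (if y = z then 1 else 0))"
    by (simp add: dv_def lookup_add lookup_ev)
  show False using z
  proof
    assume h: "\<forall>y. lookup r y \<le> lookup ?s y + (if y = z then 1 else 0)"
    show False using cases3
    proof cases
      case 1
      then show False using spec[OF h, of c] spec[OF h, of p] heavy(1) c ab npq pq
        by (auto simp: lookup_edge_expo split: if_splits)
    next
      case 2
      then show False using spec[OF h, of c] heavy(2) c ab npq pq
        by (auto simp: lookup_edge_expo split: if_splits)
    next
      case 3
      then show False using spec[OF h, of c] heavy(3) c ab npq pq
        by (auto simp: lookup_edge_expo split: if_splits)
    qed
  next
    assume h: "\<forall>y. lookup ?s y \<le> lookup r y + (if y = z then 1 else 0)"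
    show False using cases3
    proof cases
      case 1
      then show False using spec[OF h, of q] c ab npq pq
        by (auto simp: lookup_edge_expo split: if_splits)
    next
      case 2
      then show False using spec[OF h, of q] c ab npq pq
        by (auto simp: lookup_edge_expo split: if_splits)
    next
      case 3
      then show False using spec[OF h, of q] spec[OF h, of p] c ab npq pq
        by (auto simp: lookup_edge_expo split: if_splits)
    qed
  qed
qed

end

text \<open>The situation at a splitting vertex \<open>x\<close>. The neighbours of \<open>x\<close> form \<open>N\<close>, and \<open>y0\<close> is the only
  out-neighbour of \<open>x\<close> of weight greater than one; if there is none, we put \<open>y0 = x\<close>, which is not
  in \<open>N\<close>.\<close>

locale splitting_vertex = weighted_graph E w for E :: "('v::finite \<times> 'v) set" and w :: "'v \<Rightarrow> nat" +
  fixes x y0 :: 'v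
  assumes in_x: "(y, x) \<in> E \<Longrightarrow> w x = 1"
    and light: "(x, y) \<in> E \<Longrightarrow> y \<noteq> y0 \<Longrightarrow> w y = 1"
    and y0: "y0 = x \<or> (x, y0) \<in> E \<and> 1 < w y0"
    and cover: "(u, v) \<in> E \<Longrightarrow> u \<noteq> x \<Longrightarrow> v \<noteq> x \<Longrightarrow> adj E x v \<or> adj E x u \<and> u \<noteq> y0"
    and vs2: "vsplit (edge_expo w ` {e\<in>E. fst e \<noteq> x \<and> snd e \<noteq> x})"
    and free: "path6_free E w" "cycle7_free E w" "path8_free E w"
begin

section \<open>The generators of A at a splitting vertex\<close>

definition N :: "'v set" where "N = {y. adj E x y}"
text \<open>The neighbours that occur in I_1 to the first power.\<close>

definition N' :: "'v set" where "N' = N - {y0}"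
definition ex :: "'v \<Rightarrow> nat" where "ex y = (if y = y0 then w y0 else 1)"
definition E2 :: "('v \<times> 'v) set" where "E2 = {e\<in>E. fst e \<noteq> x \<and> snd e \<noteq> x}"
text \<open>Generators of A, where \<open>ex y\<close> is the exponent of the neighbour y in I_1;
  they need not be minimal.\<close>

definition link :: "'v expo set" where
  "link = sums ((\<lambda>y. single y (ex y)) ` N) \<union> edge_expo w ` E2"
definition pairs :: "'v expo set" where
  "pairs = {ev p + ev q | p q. p \<in> N' \<and> q \<in> N' \<and> p \<noteq> q}"

lemma x_notin_N: "x \<notin> N"
  using irrefl by (auto simp: N_def adj_def)

lemma N'_N: "u \<in> N' \<Longrightarrow> u \<in> N" "u \<in> N' \<Longrightarrow> u \<noteq> y0" "u \<in> N' \<Longrightarrow> u \<noteq> x" "y0 \<notin> N'"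
  using x_notin_N by (auto simp: N'_def)

lemma y0_N: "y0 \<in> N \<longleftrightarrow> y0 \<noteq> x"
  using y0 x_notin_N by (auto simp: N_def adj_def)

lemma y0_heavy: "y0 \<in> N \<Longrightarrow> 1 < w y0" "y0 \<in> N \<Longrightarrow> (x, y0) \<in> E"
  using y0 y0_N by auto

lemma E2_iff: "(u, v) \<in> E2 \<longleftrightarrow> (u, v) \<in> E \<and> u \<noteq> x \<and> v \<noteq> x"
  by (simp add: E2_def)

lemma cover2: "(u, v) \<in> E2 \<Longrightarrow> v \<in> N \<or> u \<in> N'"
  using cover by (auto simp: E2_iff N_def N'_def)

lemma heavy_N': "u \<in> N' \<Longrightarrow> 1 < w u \<Longrightarrow> (u, x) \<in> E \<and> w x = 1"
  using light[of u] in_x[of u] by (auto simp: N'_def N_def adj_def)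

sublocale G2: weighted_graph E2 w
  by unfold_locales (auto simp: E2_def asym wpos)

lemma adj_E2: "u \<noteq> x \<Longrightarrow> v \<noteq> x \<Longrightarrow> adj E2 u v \<longleftrightarrow> adj E u v"
  by (auto simp: adj_def E2_iff)

lemma heavy_isolated2:
  assumes "(p, q) \<in> E2" "1 < w q" "c \<noteq> p" "c \<noteq> q" "c \<noteq> x" "(c, q) \<notin> E2"
    and "(c, p) \<in> E2 \<Longrightarrow> 1 < w p" "(p, c) \<in> E2 \<Longrightarrow> 1 < w c" "(q, c) \<in> E2 \<Longrightarrow> 1 < w c"
  shows "\<not> adj E c p \<and> \<not> adj E c q"
proof -
  have "p \<noteq> x" "q \<noteq> x" using assms(1) by (auto simp: E2_iff)
  then show ?thesis
    using G2.heavy_edge_isolated[OF vs2[folded E2_def] assms(1-4,6-9)] assms(5) adj_E2 by blast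
qed

text \<open>Edges at a vertex \<open>u \<in> N'\<close> whose generators are not linear over each other: an edge of weight
  greater than one would be isolated, or \<open>D\<^sub>6\<close>, \<open>D\<^sub>7\<close>, \<open>D\<^sub>8\<close> would occur.\<close>

lemma out_out:
  assumes "(u, v) \<in> E2" "v \<notin> N" "1 < w v" "(u, v') \<in> E2" "v' \<notin> N" "1 < w v'"
  shows "v = v'"
proof (rule ccontr)
  assume "v \<noteq> v'"
  have n: "(v, v') \<notin> E2" "(v', v) \<notin> E2" using cover2 assms N'_N(1) by blast+
  have "\<not> adj E v' u"
    using heavy_isolated2[of u v v'] assms \<open>v \<noteq> v'\<close> n G2.irrefl G2.asym[OF assms(4)]
    by (metis E2_iff)
  then show False using assms(4) by (auto simp: adj_def E2_iff)
qed

lemma out_in: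
  assumes "u \<in> N'" "(u, v) \<in> E2" "v \<notin> N" "1 < w v" "(v', u) \<in> E2" "v' \<notin> N" "1 < w u"
  shows False
proof -
  have "v \<noteq> v'" using G2.asym[OF assms(2)] assms(5) by auto
  have n: "(v, v') \<notin> E2" "(v', v) \<notin> E2" using cover2 assms N'_N(1) by blast+
  have "\<not> adj E v' u"
    using heavy_isolated2[of u v v'] assms \<open>v \<noteq> v'\<close> n G2.irrefl G2.asym[OF assms(5)]
    by (metis E2_iff)
  then show False using assms(5) by (auto simp: adj_def E2_iff)
qed

text \<open>By \<open>heavy_isolated2\<close> the vertex y0 is adjacent neither to u nor to v, and
  then y0, x, u, v induce D_8 with x and u in the middle. The last hypothesis excludes a light edge
  from y0 to u, whose generator y0 u is linear over that of u -> v.\<close>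

lemma out_y0:
  assumes "u \<in> N'" "(u, v) \<in> E2" "v \<notin> N" "1 < w v" "y0 \<in> N" "\<not> ((y0, u) \<in> E \<and> w u = 1)"
  shows False
proof -
  have ne: "y0 \<noteq> u" "y0 \<noteq> v" "y0 \<noteq> x" "u \<noteq> x" "v \<noteq> x" "u \<noteq> v"
    using assms N'_N x_notin_N by (auto simp: E2_iff)
  have "(y0, v) \<notin> E2" using cover2 assms N'_N by blast
  moreover have "1 < w u" if "(y0, u) \<in> E2" using that assms(6) wpos[of u] by (auto simp: E2_iff)
  ultimately have na: "\<not> adj E y0 u" "\<not> adj E y0 v"
    using heavy_isolated2[of u v y0] assms(2,4) ne y0_heavy(1)[OF assms(5)] by auto
  have "\<not> adj E x v" using assms(3) by (simp add: N_def)
  moreover have "(x, u) \<in> E \<and> w u = 1 \<or> (u, x) \<in> E \<and> w x = 1"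
    using assms(1) light[of u] in_x[of u] by (auto simp: N'_def N_def adj_def)
  ultimately show False
    using free(3)[unfolded path8_free_def, rule_format, of y0 x u v] y0_heavy[OF assms(5)] assms(2,4) ne na
    by (auto simp: E2_iff)
qed

text \<open>Otherwise y0 is adjacent neither to u nor to v, and v -> u -> x -> y0 is an induced
  D_6.\<close>

lemma in_y0:
  assumes "u \<in> N'" "(v, u) \<in> E2" "v \<notin> N" "1 < w u" "y0 \<in> N"
  shows "(y0, u) \<in> E"
proof (rule ccontr)
  assume n: "(y0, u) \<notin> E"
  have ne: "y0 \<noteq> u" "y0 \<noteq> v" "y0 \<noteq> x" "u \<noteq> x" "v \<noteq> x" "u \<noteq> v"
    using assms N'_N x_notin_N by (auto simp: E2_iff irrefl)
  have "(y0, v) \<notin> E2" using cover2 assms N'_N by blast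
  then have na: "\<not> adj E y0 u" "\<not> adj E y0 v"
    using heavy_isolated2[of v u y0] assms(2,4) ne n y0_heavy(1)[OF assms(5)] by (auto simp: E2_iff)
  have "\<not> adj E x v" using assms(3) by (simp add: N_def)
  then show False
    using free(1)[unfolded path6_free_def, rule_format, of v u x y0] y0_heavy[OF assms(5)] assms(2,4) ne na
      heavy_N'[OF assms(1,4)]
    by (auto simp: E2_iff adj_def)
qed

text \<open>x -> y0 -> u -> x is a triangle with w x = 1, and w y0 and w u are at least 2; without
  D_7 they cannot both exceed 2.\<close>

lemma y0_cycle:
  assumes "u \<in> N'" "y0 \<in> N" "(y0, u) \<in> E" "1 < w u"
  shows "w y0 = 2 \<or> w u = 2"
  using free(2)[unfolded cycle7_free_def, rule_format, of x y0 u] heavy_N'[OF assms(1,4)]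
    y0_heavy[OF assms(2)] assms(3,4) by auto

lemma link_deg: "t \<in> link \<Longrightarrow> 2 \<le> deg t"
proof -
  assume "t \<in> link"
  moreover have "1 \<le> ex y" for y using wpos by (auto simp: ex_def Suc_le_eq)
  then have "2 \<le> ex y + ex z" for y z by (metis add_mono one_add_one)
  moreover have "2 \<le> 1 + w z" for z using wpos[of z] by simp
  ultimately show ?thesis
    by (auto simp: link_def sums_def edge_expo_def deg_add deg_single ev_def)
qed

lemma pair_in_link: "u \<in> N \<Longrightarrow> v \<in> N \<Longrightarrow> u \<noteq> v \<Longrightarrow> single u (ex u) + single v (ex v) \<in> link"
proof -
  assume uv: "u \<in> N" "v \<in> N" "u \<noteq> v"
  have "0 < ex u" using wpos by (simp add: ex_def)
  then have "single u (ex u) \<noteq> single v (ex v)"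
    using uv by (metis lookup_single_eq lookup_single_not_eq less_numeral_extra(3))
  then show ?thesis using uv unfolding link_def sums_def by blast
qed

lemma pairs_link: "pairs \<subseteq> link"
proof
  fix t assume "t \<in> pairs"
  then obtain p q where pq: "p \<in> N'" "q \<in> N'" "p \<noteq> q" "t = ev p + ev q" by (auto simp: pairs_def)
  then show "t \<in> link" using pair_in_link[of p q] N'_N by (simp add: ex_def ev_def)
qed

text \<open>Elements of \<open>link\<close> have degree at least two, so those of degree two are
  minimal.\<close>

lemma pairs_Mins: "pairs \<subseteq> Mins link"
proof
  fix t assume t: "t \<in> pairs"
  then have "deg t = 2" by (auto simp: pairs_def deg_add deg_single ev_def)
  then have "s = t" if "s \<in> link" "s \<preceq> t" for s
    using dv_deg_eq[OF that(2)] link_deg[OF that(1)] by simp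
  then show "t \<in> Mins link" using pairs_link t by (auto simp: Mins_def)
qed

lemma y0_in_link: "u \<in> N' \<Longrightarrow> y0 \<in> N \<Longrightarrow> ev u + single y0 (w y0) \<in> link"
  using pair_in_link[of u y0] N'_N by (simp add: ex_def ev_def)

lemma Mins_eq: "t \<in> Mins link \<Longrightarrow> s \<in> link \<Longrightarrow> s \<preceq> t \<Longrightarrow> t = s"
  by (auto simp: Mins_def)

text \<open>A light edge y0 -> u has the generator y0 u, a proper divisor of u y0^(w y0).\<close>

lemma Mins_y0:
  assumes "ev u + single y0 (w y0) \<in> Mins link" "u \<in> N'" "y0 \<in> N"
  shows "\<not> ((y0, u) \<in> E \<and> w u = 1)"
proof
  assume h: "(y0, u) \<in> E \<and> w u = 1"
  then have "edge_expo w (y0, u) \<in> link"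
    using assms(2,3) N'_N x_notin_N by (auto simp: link_def E2_iff)
  moreover have "edge_expo w (y0, u) = ev u + ev y0"
    using h by (simp add: edge_expo_def ev_def add.commute)
  moreover have "ev u + ev y0 \<preceq> ev u + single y0 (w y0)"
    using wpos[of y0] by (auto simp: dv_def lookup_add lookup_ev lookup_single when_def)
  ultimately have "ev u + single y0 (w y0) = ev u + ev y0" using Mins_eq[OF assms(1)] by metis
  then have "single y0 (w y0) = ev y0" by simp
  then have "w y0 = 1" by (metis ev_def lookup_single_eq)
  then show False using y0_heavy assms by simp
qed

text \<open>Sorts the minimal generators by their vertices in N'. Only \<open>far\<close> avoids N';
  \<open>pair\<close> and \<open>light\<close> have degree two, and the remaining cases contain
  exactly one vertex of N' and have degree at least three. In \<open>light\<close> the vertex v may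
  be y0.\<close>

lemma link_cases:
  assumes t: "t \<in> Mins link"
  obtains (pair) "t \<in> pairs"
  | (light) u v where "u \<in> N'" "v \<notin> N'" "v \<noteq> x" "t = ev u + ev v"
  | (out) u v where "u \<in> N'" "v \<notin> N" "(u, v) \<in> E2" "1 < w v" "t = ev u + single v (w v)"
  | (inn) u v where "u \<in> N'" "v \<notin> N" "(v, u) \<in> E2" "1 < w u" "t = ev v + single u (w u)"
  | (from_y0) u where "u \<in> N'" "y0 \<in> N" "\<not> ((y0, u) \<in> E \<and> w u = 1)" "t = ev u + single y0 (w y0)"
  | (to_N) u where "u \<in> N'" "y0 \<in> N" "(y0, u) \<in> E" "1 < w u" "t = ev y0 + single u (w u)"
  | (far) v where "v \<notin> N" "v \<noteq> x" "y0 \<in> N" "t = ev v + single y0 (w y0)"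
proof -
  have y0_case: thesis if "u \<in> N'" "y0 \<in> N" "t = ev u + single y0 (w y0)" for u
    using that t Mins_y0[of u] from_y0[of u] by blast
  have w1: "single v (w v) = ev v" if "\<not> 1 < w v" for v
  proof -
    have "w v = 1" using that wpos[of v] by simp
    then show ?thesis by (simp add: ev_def)
  qed
  have "t \<in> link" using t Mins_subset by blast
  then consider y z where "y \<in> N" "z \<in> N" "y \<noteq> z" "t = single y (ex y) + single z (ex z)"
    | u v where "(u, v) \<in> E2" "t = ev u + single v (w v)"
    by (force simp: link_def sums_def edge_expo_def)
  then show thesis
  proof cases
    case (1 y z)
    consider "y = y0" | "z = y0" | "y \<noteq> y0" "z \<noteq> y0" by blast
    then show thesis
    proof cases
      case a: 1
      then have "t = ev z + single y0 (w y0)" using 1 by (simp add: ex_def ev_def add.commute)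
      then show thesis using y0_case[of z] 1 a by (auto simp: N'_def)
    next
      case a: 2
      then have "t = ev y + single y0 (w y0)" using 1 by (simp add: ex_def ev_def)
      then show thesis using y0_case[of y] 1 a by (auto simp: N'_def)
    next
      case a: 3
      then have "t \<in> pairs" using 1 by (auto simp: pairs_def N'_def ex_def ev_def)
      then show thesis by (rule pair)
    qed
  next
    case (2 u v)
    have ne: "u \<noteq> v" "u \<noteq> x" "v \<noteq> x" using 2(1) G2.irrefl by (auto simp: E2_iff)
    consider "u \<in> N'" "v \<in> N'" | "u \<in> N'" "v = y0" | "u \<in> N'" "v \<notin> N'" "v \<noteq> y0"
      | "u \<notin> N'" "v = y0" "v \<in> N" | "u \<notin> N'" "v \<in> N'" "u = y0" | "u \<notin> N'" "v \<in> N'" "u \<noteq> y0"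
      using cover2[OF 2(1)] by (auto simp: N'_def)
    then show thesis
    proof cases
      \<comment> \<open>An edge within N' is a multiple of a pair, so by minimality it is that
        pair.\<close>
      case a: 1
      then have "ev u + ev v \<in> pairs" using ne by (auto simp: pairs_def)
      moreover have "ev u + ev v \<preceq> t"
        using wpos[of v] by (auto simp: 2(2) dv_def lookup_add lookup_ev lookup_single when_def)
      ultimately have "t \<in> pairs" using pairs_link Mins_eq[OF t] by (metis subsetD)
      then show thesis by (rule pair)
    next
      case a: 2
      then show thesis using y0_case[of u] 2 ne y0_N by simp
    next
      case a: 3
      then have "v \<notin> N" by (simp add: N'_def)
      then show thesis using a 2 ne w1[of v] light[of u v] out[of u v] by (cases "1 < w v") auto
    next
      case a: 4
      then have "u \<notin> N" using ne by (auto simp: N'_def)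
      then show thesis using far[of u] a 2 ne by auto
    next
      case a: 5
      have "y0 \<in> N" using y0_N ne a by simp
      then show thesis
        using a 2 ne w1[of v] light[of v u] to_N[of v] by (cases "1 < w v") (auto simp: add.commute E2_iff)
    next
      case a: 6
      then have "u \<notin> N" by (auto simp: N'_def)
      then show thesis
        using a 2 ne w1[of v] light[of v u] inn[of v u] by (cases "1 < w v") (auto simp: add.commute)
    qed
  qed
qed

text \<open>The place of the multiples of \<open>y0\<close> depends on \<open>w y0\<close>: if \<open>y0 \<rightarrow> u \<rightarrow> x \<rightarrow> y0\<close>, the absence of
  \<open>D\<^sub>7\<close> only says that \<open>w y0 = 2\<close> or \<open>w u = 2\<close>, and the generator with the square has to come first.\<close>

definition rank :: "'v expo \<Rightarrow> nat" where
  "rank t = (if t \<in> pairs then 0 else if \<forall>u\<in>N'. lookup t u = 0 then 5 else if deg t = 2 then 1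
     else if w y0 = 2 then (if lookup t y0 = 2 then 2 else if lookup t y0 = 1 then 3 else 4)
     else (if lookup t y0 = 1 then 2 else if lookup t y0 = 0 then 3 else 4))"

lemma deg_two: "deg (ev u + single v n) = 1 + n"
  by (simp add: deg_add deg_single ev_def)

lemma pairs_deg: "t \<in> pairs \<Longrightarrow> deg t = 2"
  by (auto simp: pairs_def deg_two ev_def deg_add deg_single)

lemma lookup_two: "lookup (ev u + single v n) z = (if z = u then 1 else 0) + (if z = v then n else 0)"
  by (auto simp: lookup_add lookup_ev lookup_single)

lemma lookup_two': "lookup (ev u + ev v) z = (if z = u then 1 else 0) + (if z = v then 1 else 0)"
  by (auto simp: lookup_add lookup_ev)

lemma rank_heavy: "u \<in> N' \<Longrightarrow> 0 < lookup t u \<Longrightarrow> deg t \<noteq> 2 \<Longrightarrow>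
  rank t = (if w y0 = 2 then (if lookup t y0 = 2 then 2 else if lookup t y0 = 1 then 3 else 4)
     else (if lookup t y0 = 1 then 2 else if lookup t y0 = 0 then 3 else 4))"
  using pairs_deg by (auto simp: rank_def)

lemma rank_less5: "u \<in> N' \<Longrightarrow> 0 < lookup t u \<Longrightarrow> rank t < 5"
  by (auto simp: rank_def)

text \<open>No generator of A is a pure power. Hence a minimal generator dividing a monomial in two
  variables involves both of them, which is how the ranks of such divisors are bounded
  below.\<close>

lemma Mins_two_vertices:
  assumes "t \<in> Mins link" shows "\<exists>u v. u \<noteq> v \<and> 0 < lookup t u \<and> 0 < lookup t v"
proof -
  have pos: "0 < ex y" for y using wpos by (simp add: ex_def)
  have "t \<in> link" using assms Mins_subset by blast
  then consider y z where "y \<in> N" "z \<in> N" "y \<noteq> z" "t = single y (ex y) + single z (ex z)"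
    | u v where "(u, v) \<in> E2" "t = ev u + single v (w v)"
    by (force simp: link_def sums_def edge_expo_def)
  then show ?thesis
  proof cases
    case (1 y z)
    then show ?thesis using pos by (intro exI[of _ y] exI[of _ z]) (simp add: lookup_add)
  next
    case (2 u v)
    then show ?thesis using G2.irrefl[of u] wpos[of v]
      by (intro exI[of _ u] exI[of _ v]) (auto simp: lookup_two)
  qed
qed

lemma far_ne_y0: "v \<notin> N \<Longrightarrow> v \<noteq> x \<Longrightarrow> v \<noteq> y0"
  using y0_N by auto

lemma rank_light: "u \<in> N' \<Longrightarrow> v \<notin> N' \<Longrightarrow> rank (ev u + ev v) = 1"
proof -
  assume uv: "u \<in> N'" "v \<notin> N'"
  have "ev u + ev v \<notin> pairs"
  proof
    assume "ev u + ev v \<in> pairs"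
    then obtain p q where pq: "p \<in> N'" "q \<in> N'" and eq: "ev u + ev v = ev p + ev q"
      by (auto simp: pairs_def)
    have "lookup (ev p + ev q) v = 0" using uv pq by (auto simp: lookup_two')
    moreover have "lookup (ev u + ev v) v \<noteq> 0" by (simp add: lookup_two')
    ultimately show False by (simp add: eq)
  qed
  moreover have "deg (ev u + ev v) = 2" by (simp add: deg_add deg_single ev_def)
  moreover have "0 < lookup (ev u + ev v) u" by (simp add: lookup_two')
  ultimately show ?thesis using uv unfolding rank_def by auto
qed

lemma rank_no_y0:
  assumes "u \<in> N'" "0 < lookup t u" "deg t \<noteq> 2" "lookup t y0 = 0"
  shows "rank t = (if w y0 = 2 then 4 else 3)"
  using rank_heavy[OF assms(1-3)] assms(4) by simp

lemma rank_from_y0: "u \<in> N' \<Longrightarrow> y0 \<in> N \<Longrightarrow> rank (ev u + single y0 (w y0)) = (if w y0 = 2 then 2 else 4)"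
  using rank_heavy[of u "ev u + single y0 (w y0)"] y0_heavy(1) N'_N by (auto simp: lookup_two deg_two)

lemma rank_to_N: "u \<in> N' \<Longrightarrow> y0 \<in> N \<Longrightarrow> 1 < w u \<Longrightarrow> rank (ev y0 + single u (w u)) = (if w y0 = 2 then 3 else 2)"
  using rank_heavy[of u "ev y0 + single u (w u)"] N'_N by (auto simp: lookup_two deg_two)

lemma rank_far: "v \<notin> N \<Longrightarrow> rank (ev v + single y0 n) = 5"
proof -
  assume v: "v \<notin> N"
  have no: "lookup (ev v + single y0 n) u = 0" if "u \<in> N'" for u
    using v that N'_N by (auto simp: lookup_two)
  have "ev v + single y0 n \<notin> pairs"
  proof
    assume "ev v + single y0 n \<in> pairs"
    then obtain p q where p: "p \<in> N'" and eq: "ev v + single y0 n = ev p + ev q"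
      by (auto simp: pairs_def)
    have "lookup (ev p + ev q) p \<noteq> 0" by (simp add: lookup_two')
    then show False using no[OF p] by (simp add: eq)
  qed
  then show ?thesis using no unfolding rank_def by simp
qed

text \<open>The generator of y0 -> u serves as a witness but need not be minimal. A minimal divisor
  of it still contains u, and y0 exactly once, and this bounds its rank.\<close>

lemma to_N_below:
  assumes "u \<in> N'" "y0 \<in> N" "(y0, u) \<in> E"
  obtains k where "k \<in> Mins link" "k \<preceq> ev y0 + single u (w u)" "rank k \<le> (if w y0 = 2 then 3 else 2)"
proof -
  have "edge_expo w (y0, u) \<in> link" using assms N'_N x_notin_N by (auto simp: link_def E2_iff)
  then obtain k where k: "k \<in> Mins link" "k \<preceq> ev y0 + single u (w u)"
    using Mins_below[of "edge_expo w (y0, u)" link] by (auto simp: edge_expo_def)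
  have l: "lookup k z \<le> (if z = y0 then 1 else 0) + (if z = u then w u else 0)" for z
    using dvD[OF k(2), of z] by (simp add: lookup_two)
  obtain p q where pq: "p \<noteq> q" "0 < lookup k p" "0 < lookup k q" using Mins_two_vertices[OF k(1)] by blast
  then have "p \<in> {y0, u}" "q \<in> {y0, u}" using l[of p] l[of q] by (auto split: if_splits)
  then have "0 < lookup k y0" "0 < lookup k u" using pq by auto
  moreover from this have "lookup k y0 = 1" using l[of y0] N'_N(2)[OF assms(1)] by auto
  ultimately have "rank k \<le> (if w y0 = 2 then 3 else 2)"
    using assms(1) by (auto simp: rank_def)
  with k that show thesis by blast
qed

text \<open>As in \<open>to_N_below\<close>, a minimal divisor contains u, and a vertex of N' keeps
  its rank below 5.\<close>

lemma from_y0_below: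
  assumes "u \<in> N'" "y0 \<in> N"
  obtains k where "k \<in> Mins link" "k \<preceq> ev u + single y0 (w y0)" "rank k < 5"
proof -
  obtain k where k: "k \<in> Mins link" "k \<preceq> ev u + single y0 (w y0)"
    using Mins_below[OF y0_in_link[OF assms]] by blast
  have l: "lookup k z \<le> (if z = u then 1 else 0) + (if z = y0 then w y0 else 0)" for z
    using dvD[OF k(2), of z] by (simp add: lookup_two)
  obtain p q where pq: "p \<noteq> q" "0 < lookup k p" "0 < lookup k q" using Mins_two_vertices[OF k(1)] by blast
  then have "p \<in> {y0, u}" "q \<in> {y0, u}" using l[of p] l[of q] by (auto split: if_splits)
  then have "0 < lookup k u" using pq by auto
  then show thesis using k that rank_less5[OF assms(1)] by blast
qed

end

section \<open>Linear quotients of A along the rank\<close>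

context splitting_vertex
begin

text \<open>If j contains a vertex u' of N' missing from a, the variable u' works, with a pair u u'
  as witness or, when a avoids N', a divisor of u' y0^(w y0). Otherwise N' offers no new variable.
  If a is \<open>far\<close>, then so is j, and the other end of j is the variable. If a contains u
  in N', a generator j of degree two is itself a witness, and only heavy generators through the same
  u remain; these are the cases that the lemmas on edges at u settle.\<close>

lemma rank_step:
  assumes a: "a \<in> Mins link" and j: "j \<in> Mins link" and ne: "j \<noteq> a"
    and ra: "0 < rank a" and rj: "rank j \<le> rank a"
  shows "\<exists>z. lookup a z < lookup j z \<and> (j \<preceq> a + ev z \<or> (\<exists>k\<in>Mins link. rank k < rank a \<and> k \<preceq> a + ev z))"
    (is "\<exists>z. ?P z")
proof -
  have anp: "a \<notin> pairs" using ra by (auto simp: rank_def)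
  have nd: "\<not> j \<preceq> a" using antichainD[OF antichain_Mins j a] ne by blast
  have itself: ?thesis if "lookup a z < lookup j z" "j \<preceq> a + ev z" for z
    using that by blast
  have via: ?thesis if "lookup a z < lookup j z" "k \<in> Mins link" "rank k < rank a" "k \<preceq> b" "b \<preceq> a + ev z"
    for z k b
    using that(1-3) dv_trans[OF that(4,5)] by blast
  show ?thesis
  proof (cases "\<exists>u'\<in>N'. 0 < lookup j u' \<and> lookup a u' = 0")
    case True
    then obtain u' where u': "u' \<in> N'" "0 < lookup j u'" "lookup a u' = 0" by blast
    have "\<exists>k\<in>Mins link. rank k < rank a \<and> k \<preceq> a + ev u'"
    proof (cases "\<exists>u\<in>N'. 0 < lookup a u")
      case True
      then obtain u where u: "u \<in> N'" "0 < lookup a u" by blast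
      then have "u \<noteq> u'" using u' by auto
      then have "ev u + ev u' \<in> pairs" using u(1) u'(1) unfolding pairs_def by blast
      moreover from this have "rank (ev u + ev u') = 0" by (simp add: rank_def)
      moreover have "ev u + ev u' \<preceq> a + ev u'"
        using u by (intro dv_add_mono) (simp add: ev_dv_iff)
      ultimately show ?thesis using pairs_Mins ra by (intro bexI[of _ "ev u + ev u'"]) auto
    next
      case False
      then have no: "\<And>u. u \<in> N' \<Longrightarrow> lookup a u = 0" by auto
      have "a \<notin> pairs \<and> rank a = 5" using anp no by (auto simp: rank_def)
      moreover obtain v where v: "y0 \<in> N" "a = ev v + single y0 (w y0)"
        using a
      proof (cases rule: link_cases)
        case pair then show ?thesis using anp by simp
      next
        case (far v) then show ?thesis using that by blast
      qed (use no in \<open>(force simp: lookup_two lookup_two')+\<close>)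
      \<comment> \<open>Here a is a multiple of y0^(w y0), so a u' is a multiple of u' y0^(w y0),
        which has a minimal divisor of rank below 5.\<close>
      obtain k where k: "k \<in> Mins link" "k \<preceq> ev u' + single y0 (w y0)" "rank k < 5"
        using from_y0_below[OF u'(1) v(1)] .
      have "ev u' + single y0 (w y0) \<preceq> a + ev u'"
        by (auto simp: v dv_def lookup_add lookup_ev lookup_single when_def)
      then show ?thesis using k \<open>a \<notin> pairs \<and> rank a = 5\<close> dv_trans by (intro bexI[of _ k]) auto
    qed
    then show ?thesis using u' by (intro exI[of _ u']) auto
  next
    case False
    then have sub: "0 < lookup a u" if "u \<in> N'" "0 < lookup j u" for u using that by auto
    have jnp: "j \<notin> pairs" if u: "u \<in> N'" "\<And>u'. u' \<in> N' \<Longrightarrow> 0 < lookup a u' \<Longrightarrow> u' = u" for u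
    proof
      assume "j \<in> pairs"
      then obtain p q where pq: "p \<in> N'" "q \<in> N'" "p \<noteq> q" "j = ev p + ev q" by (auto simp: pairs_def)
      have "0 < lookup j p" "0 < lookup j q" by (simp_all add: pq(4) lookup_two')
      then have "p = u" "q = u" using u(2) sub pq(1,2) by blast+
      then show False using pq by simp
    qed
    text \<open>Generators with different vertices in \<open>N'\<close> are linear through a pair, which leaves those
      meeting \<open>N'\<close> only in \<open>u\<close>.\<close>
    have star: ?thesis if u: "u \<in> N'" "0 < lookup a u" "\<And>u'. u' \<in> N' \<Longrightarrow> 0 < lookup a u' \<Longrightarrow> u' = u"
      and heavy: "\<And>t. t \<in> N' \<Longrightarrow> 0 < lookup j t \<Longrightarrow> t = u \<Longrightarrow> deg j \<noteq> 2 \<Longrightarrow> ?thesis" for u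
      using j
    proof (cases rule: link_cases)
      case pair then show ?thesis using jnp[of u] u by blast
    next
      case (light u' v)
      have *: "0 < lookup j u'" using light by (simp add: lookup_two')
      then have "u' = u" using sub u light by blast
      have "lookup a v = 0"
      proof (rule ccontr)
        assume "lookup a v \<noteq> 0"
        moreover have "u \<noteq> v" using light(2) u(1) by auto
        ultimately have "j \<preceq> a" using u(2) unfolding light(4) \<open>u' = u\<close>
          by (auto simp: dv_def lookup_two' Suc_le_eq)
        then show False using nd by simp
      qed
      moreover have "j \<preceq> a + ev v"
        using u(2) unfolding light(4) \<open>u' = u\<close> by (auto simp: dv_def lookup_add lookup_ev Suc_le_eq)
      moreover have "0 < lookup j v" by (simp add: light(4) lookup_two')
      ultimately show ?thesis by (intro itself[of v]) simp_all
    next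
      case (out u' v)
      have *: "0 < lookup j u'" using out by (simp add: lookup_two)
      then have "u' = u" using sub u out by blast
      then show ?thesis using heavy[OF out(1) *] out by (simp add: deg_two)
    next
      case (inn u' v)
      have *: "0 < lookup j u'" using inn by (simp add: lookup_two)
      then have "u' = u" using sub u inn by blast
      then show ?thesis using heavy[OF inn(1) *] inn by (simp add: deg_two)
    next
      case (from_y0 u')
      have *: "0 < lookup j u'" using from_y0 by (simp add: lookup_two)
      then have "u' = u" using sub u from_y0 by blast
      then show ?thesis using heavy[OF from_y0(1) *] from_y0 y0_heavy by (simp add: deg_two)
    next
      case (to_N u')
      have *: "0 < lookup j u'" using to_N by (simp add: lookup_two)
      then have "u' = u" using sub u to_N by blast
      then show ?thesis using heavy[OF to_N(1) *] to_N by (simp add: deg_two)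
    next
      case (far v)
      then have "rank j = 5" using rank_far by simp
      then show ?thesis using rj rank_less5[OF u(1,2)] by simp
    qed
    show ?thesis
      using a
    proof (cases rule: link_cases)
      case pair then show ?thesis using anp by simp
    next
      case (light u v)
      have ua: "u' = u" if "u' \<in> N'" "0 < lookup a u'" for u'
        using that light by (auto simp: lookup_two' split: if_splits)
      show ?thesis
      proof (rule star[of u])
        fix t assume t: "t \<in> N'" "0 < lookup j t" "t = u" "deg j \<noteq> 2"
        \<comment> \<open>Heavy generators through u have rank at least 2, so none of them has to be
          compared with a.\<close>
        have "rank a = 1" using light rank_light by simp
        then show ?thesis using rj rank_heavy[OF t(1,2,4)] by (auto split: if_splits)
      next
        show "u \<in> N'" by (rule light(1))
        show "0 < lookup a u" by (simp add: light(4) lookup_two')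
      qed (rule ua)
    next
      case (far v)
      have no: "lookup a u = 0" if "u \<in> N'" for u
        using that far N'_N by (auto simp: lookup_two)
      then have no': "lookup j u = 0" if "u \<in> N'" for u using sub[OF that] that by fastforce
      obtain v' where v': "v' \<notin> N" "v' \<noteq> x" "j = ev v' + single y0 (w y0)"
        using j
      proof (cases rule: link_cases)
        case pair then show ?thesis using no' by (force simp: pairs_def lookup_two')
      next
        case (far v) then show ?thesis using that by blast
      qed (use no' in \<open>(force simp: lookup_two lookup_two')+\<close>)
      have "v' \<noteq> v" "v' \<noteq> y0" using ne far v' far_ne_y0 by auto
      then have "lookup a v' < lookup j v'" by (simp add: v' far lookup_two)
      moreover have "j \<preceq> a + ev v'"
        by (auto simp: v' far dv_def lookup_add lookup_ev lookup_single when_def)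
      ultimately show ?thesis by (rule itself)
    next
      case (out u v)
      have vx: "v \<noteq> x" "v \<noteq> y0" using out far_ne_y0 by (auto simp: E2_iff)
      have ua: "u' = u" if "u' \<in> N'" "0 < lookup a u'" for u'
        using that out N'_N by (auto simp: lookup_two split: if_splits)
      show ?thesis
      proof (rule star[of u])
        fix t assume t: "t \<in> N'" "0 < lookup j t" "t = u" "deg j \<noteq> 2"
        from j show ?thesis
        proof (cases rule: link_cases)
          case pair then show ?thesis using t pairs_deg by simp
        next
          case (light u' v') then show ?thesis using t by (simp add: deg_add deg_single ev_def)
        next
          case o: (out u' v')
          then have "u' = u" using t N'_N by (auto simp: lookup_two split: if_splits)
          then have "v' = v" using out_out out o by blast
          then show ?thesis using ne out o \<open>u' = u\<close> by simp
        next
          case i: (inn u' v')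
          then have "u' = u" using t N'_N by (auto simp: lookup_two split: if_splits)
          then show ?thesis using out_in out i by blast
        next
          case f: (from_y0 u')
          then have "u' = u" using t N'_N by (auto simp: lookup_two split: if_splits)
          then show ?thesis using out_y0 out f by blast
        next
          case g: (to_N u')
          then have "u' = u" using t N'_N by (auto simp: lookup_two split: if_splits)
          then show ?thesis using out_y0[of u v] out g by auto
        next
          case (far v')
          then show ?thesis using t N'_N by (auto simp: lookup_two split: if_splits)
        qed
      next
        show "u \<in> N'" by (rule out(1))
        show "0 < lookup a u" by (simp add: out(5) lookup_two)
      qed (rule ua)
    next
      case (inn u v)
      have vx: "v \<noteq> x" "v \<noteq> y0" using inn far_ne_y0 by (auto simp: E2_iff)
      have ua: "u' = u" if "u' \<in> N'" "0 < lookup a u'" for u'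
        using that inn N'_N by (auto simp: lookup_two split: if_splits)
      have uv: "u \<noteq> v" "u \<noteq> y0" using inn N'_N by auto
      have rka: "rank a = (if w y0 = 2 then 4 else 3)"
        using inn uv vx by (intro rank_no_y0[of u]) (auto simp: lookup_two deg_two)
      show ?thesis
      proof (rule star[of u])
        fix t assume t: "t \<in> N'" "0 < lookup j t" "t = u" "deg j \<noteq> 2"
        from j show ?thesis
        proof (cases rule: link_cases)
          case pair then show ?thesis using t pairs_deg by simp
        next
          case (light u' v') then show ?thesis using t by (simp add: deg_add deg_single ev_def)
        next
          case o: (out u' v')
          then have "u' = u" using t N'_N by (auto simp: lookup_two split: if_splits)
          then show ?thesis using out_in inn o by blast
        next
          case i: (inn u' v')
          then have "u' = u" using t N'_N by (auto simp: lookup_two split: if_splits)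
          moreover from this have "v' \<noteq> v" "v' \<noteq> u" using ne i inn N'_N by auto
          ultimately show ?thesis
            by (intro itself[of v']) (auto simp: i inn dv_def lookup_add lookup_ev lookup_single when_def)
        next
          case f: (from_y0 u')
          then have u': "u' = u" using t N'_N by (auto simp: lookup_two split: if_splits)
          \<comment> \<open>The generator j exceeds a by a square of y0, so it is not a witness
            itself. The edge y0 -> u supplies one, and the rank of j forces w y0 = 2, where this
            witness comes before a.\<close>
          have yu: "(y0, u) \<in> E" using in_y0 inn f by blast
          have "w y0 = 2"
          proof (rule ccontr)
            assume "w y0 \<noteq> 2"
            then show False using rj rka rank_from_y0[of u] f u' by simp
          qed
          moreover obtain k where k: "k \<in> Mins link" "k \<preceq> ev y0 + single u (w u)"
            "rank k \<le> (if w y0 = 2 then 3 else 2)"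
            using to_N_below[OF inn(1) f(2) yu] .
          moreover have "ev y0 + single u (w u) \<preceq> a + ev y0"
            by (auto simp: inn dv_def lookup_add lookup_ev lookup_single when_def)
          moreover have "lookup a y0 < lookup j y0"
            using uv vx wpos[of y0] by (simp add: inn f lookup_two)
          ultimately show ?thesis using rka by (intro via[of y0 k]) simp_all
        next
          case g: (to_N u')
          then have "u' = u" using t N'_N by (auto simp: lookup_two split: if_splits)
          then show ?thesis using uv vx
            by (intro itself[of y0]) (auto simp: g inn dv_def lookup_add lookup_ev lookup_single when_def)
        next
          case (far v')
          then show ?thesis using t N'_N by (auto simp: lookup_two split: if_splits)
        qed
      next
        show "u \<in> N'" by (rule inn(1))
        show "0 < lookup a u" using wpos[of u] by (simp add: inn(5) lookup_two)
      qed (rule ua)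
    next
      case (from_y0 u)
      have ua: "u' = u" if "u' \<in> N'" "0 < lookup a u'" for u'
        using that from_y0 N'_N by (auto simp: lookup_two split: if_splits)
      have uy: "u \<noteq> y0" using from_y0 N'_N by auto
      have rka: "rank a = (if w y0 = 2 then 2 else 4)"
        using from_y0 rank_from_y0 by simp
      show ?thesis
      proof (rule star[of u])
        fix t assume t: "t \<in> N'" "0 < lookup j t" "t = u" "deg j \<noteq> 2"
        from j show ?thesis
        proof (cases rule: link_cases)
          case pair then show ?thesis using t pairs_deg by simp
        next
          case (light u' v') then show ?thesis using t by (simp add: deg_add deg_single ev_def)
        next
          case o: (out u' v')
          then have "u' = u" using t N'_N by (auto simp: lookup_two split: if_splits)
          then show ?thesis using out_y0 from_y0 o by blast
        next
          case i: (inn u' v)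
          then have u': "u' = u" using t N'_N by (auto simp: lookup_two split: if_splits)
          have vx: "v \<noteq> x" "v \<noteq> y0" "v \<noteq> u" using i far_ne_y0 N'_N from_y0 by (auto simp: E2_iff)
          have yu: "(y0, u) \<in> E" using in_y0 i from_y0 u' by blast
          have "rank j = (if w y0 = 2 then 4 else 3)"
            using i u' vx uy by (intro rank_no_y0[of u]) (auto simp: lookup_two deg_two)
          \<comment> \<open>For w y0 other than 2 the generator a = u y0^(w y0) comes after those of
            the edges into u. The triangle then has w u = 2, so multiplying a by u already reaches
            y0 u^2.\<close>
          then have "w y0 \<noteq> 2" using rj rka by auto
          then have wu: "w u = 2" using y0_cycle[of u] yu from_y0 i u' by blast
          obtain k where k: "k \<in> Mins link" "k \<preceq> ev y0 + single u (w u)"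
            "rank k \<le> (if w y0 = 2 then 3 else 2)"
            using to_N_below[OF from_y0(1,2) yu] .
          moreover have "ev y0 + single u (w u) \<preceq> a + ev u"
            using wpos[of y0] by (auto simp: from_y0 wu dv_def lookup_add lookup_ev lookup_single when_def)
          moreover have "lookup a u < lookup j u"
            using uy vx by (simp add: i u' from_y0 lookup_two wu)
          ultimately show ?thesis using rka \<open>w y0 \<noteq> 2\<close> by (intro via[of u k]) simp_all
        next
          case f: (from_y0 u')
          then have "u' = u" using t N'_N by (auto simp: lookup_two split: if_splits)
          then show ?thesis using ne f from_y0 by simp
        next
          case g: (to_N u')
          then have u': "u' = u" using t N'_N by (auto simp: lookup_two split: if_splits)
          have "w y0 \<noteq> 2" using rj rka rank_to_N[of u] g u' by auto
          then have "w u = 2" using y0_cycle[of u] g u' by blast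
          then show ?thesis using uy u' wpos[of y0]
            by (intro itself[of u]) (auto simp: g from_y0 dv_def lookup_add lookup_ev lookup_single when_def)
        next
          case (far v')
          then show ?thesis using t N'_N by (auto simp: lookup_two split: if_splits)
        qed
      next
        show "u \<in> N'" by (rule from_y0(1))
        show "0 < lookup a u" by (simp add: from_y0(4) lookup_two)
      qed (rule ua)
    next
      case (to_N u)
      have ua: "u' = u" if "u' \<in> N'" "0 < lookup a u'" for u'
        using that to_N N'_N by (auto simp: lookup_two split: if_splits)
      have uy: "u \<noteq> y0" using to_N N'_N by auto
      have rka: "rank a = (if w y0 = 2 then 3 else 2)"
        using to_N rank_to_N by simp
      show ?thesis
      proof (rule star[of u])
        fix t assume t: "t \<in> N'" "0 < lookup j t" "t = u" "deg j \<noteq> 2"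
        from j show ?thesis
        proof (cases rule: link_cases)
          case pair then show ?thesis using t pairs_deg by simp
        next
          case (light u' v') then show ?thesis using t by (simp add: deg_add deg_single ev_def)
        next
          case o: (out u' v')
          then have "u' = u" using t N'_N by (auto simp: lookup_two split: if_splits)
          then show ?thesis using out_y0[of u v'] to_N o by auto
        next
          case i: (inn u' v)
          then have u': "u' = u" using t N'_N by (auto simp: lookup_two split: if_splits)
          have vx: "v \<noteq> x" "v \<noteq> y0" "v \<noteq> u" using i far_ne_y0 N'_N to_N by (auto simp: E2_iff)
          then show ?thesis using u'
            by (intro itself[of v]) (auto simp: i to_N dv_def lookup_add lookup_ev lookup_single when_def)
        next
          case f: (from_y0 u')
          then have u': "u' = u" using t N'_N by (auto simp: lookup_two split: if_splits)
          have "w y0 = 2" using rj rka rank_from_y0[of u] f u' by (auto split: if_splits)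
          then show ?thesis using uy u' wpos[of u]
            by (intro itself[of y0]) (auto simp: f to_N dv_def lookup_add lookup_ev lookup_single when_def)
        next
          case g: (to_N u')
          then have "u' = u" using t N'_N by (auto simp: lookup_two split: if_splits)
          then show ?thesis using ne g to_N by simp
        next
          case (far v')
          then show ?thesis using t N'_N by (auto simp: lookup_two split: if_splits)
        qed
      next
        show "u \<in> N'" by (rule to_N(1))
        show "0 < lookup a u" using wpos[of u] by (simp add: to_N(5) lookup_two)
      qed (rule ua)
    qed
  qed
qed

lemma lqs_link: "lqs (Mins link)"
proof (rule lqs_rank[where \<rho> = rank])
  show "finite (Mins link)" by (rule finite_antichain[OF antichain_Mins])
  have "rank t = 0 \<longleftrightarrow> t \<in> pairs" for t by (auto simp: rank_def)
  then have "{t \<in> Mins link. rank t = 0} = pairs" using pairs_Mins by auto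
  then show "lqs {t \<in> Mins link. rank t = 0}" using lqs_pairs[of N'] by (simp add: pairs_def)
qed (rule rank_step)

end

section \<open>Deleting a vertex and splitting an edge ideal\<close>

definition deletion :: "('v \<times> 'v) set \<Rightarrow> 'v \<Rightarrow> ('v \<times> 'v) set" where
  "deletion E x = {e\<in>E. fst e \<noteq> x \<and> snd e \<noteq> x}"

lemma adj_deletion: "u \<noteq> x \<Longrightarrow> v \<noteq> x \<Longrightarrow> adj (deletion E x) u v \<longleftrightarrow> adj E u v"
  by (auto simp: adj_def deletion_def)

lemma path6_free_deletion:
  assumes "path6_free E w" shows "path6_free (deletion E x) w"
  unfolding path6_free_def
proof (intro allI impI, elim conjE)
  fix a b c d
  assume h: "distinct [a, b, c, d]" "(a, b) \<in> deletion E x" "(b, c) \<in> deletion E x" "(c, d) \<in> deletion E x"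
    "1 < w b" "w c = 1" "1 < w d"
  then have "a \<noteq> x" "b \<noteq> x" "c \<noteq> x" "d \<noteq> x" "(a, b) \<in> E" "(b, c) \<in> E" "(c, d) \<in> E"
    by (auto simp: deletion_def)
  then show "adj (deletion E x) a c \<or> adj (deletion E x) a d \<or> adj (deletion E x) b d"
    using assms h(1,5-7) by (simp add: adj_deletion path6_free_def)
qed

lemma cycle7_free_deletion:
  assumes "cycle7_free E w" shows "cycle7_free (deletion E x) w"
  using assms by (simp add: cycle7_free_def deletion_def) blast

lemma path8_free_deletion:
  assumes "path8_free E w" shows "path8_free (deletion E x) w"
  unfolding path8_free_def
proof (intro allI impI, elim conjE)
  fix a b c d
  assume h: "distinct [a, b, c, d]" "(b, a) \<in> deletion E x" "(c, d) \<in> deletion E x"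
    "(b, c) \<in> deletion E x \<and> w c = 1 \<or> (c, b) \<in> deletion E x \<and> w b = 1" "1 < w a" "1 < w d"
  then have "a \<noteq> x" "b \<noteq> x" "c \<noteq> x" "d \<noteq> x" "(b, a) \<in> E" "(c, d) \<in> E"
    "(b, c) \<in> E \<and> w c = 1 \<or> (c, b) \<in> E \<and> w b = 1"
    by (auto simp: deletion_def)
  then show "adj (deletion E x) a c \<or> adj (deletion E x) a d \<or> adj (deletion E x) b d"
    using assms h(1,5,6) by (simp add: adj_deletion path8_free_def)
qed

lemma single_dv_iff: "single y n \<preceq> a \<longleftrightarrow> n \<le> lookup a y"
  by (auto simp: dv_def lookup_single when_def)

text \<open>The generators free of x are \<open>S2\<close>, the others are x \<open>S1\<close>. As x
  is absent from \<open>S1\<close>, it occurs at most once in every generator, so an edge into x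
  forces w x = 1; dividing the edges at x by x then gives \<open>S1\<close>.\<close>

lemma (in weighted_graph) splitting_structure:
  assumes S: "shift x S1 \<union> S2 = edge_expo w ` E"
    and zero': "\<forall>s\<in>S1 \<union> S2. lookup s x = 0"
  shows "S2 = edge_expo w ` deletion E x"
    and "(y, x) \<in> E \<Longrightarrow> w x = 1"
    and "S1 = {single y (w y) | y. (x, y) \<in> E} \<union> {ev y | y. (y, x) \<in> E}"
proof -
  have zero: "lookup s x = 0" if "s \<in> S1 \<union> S2" for s using zero' that by blast
  have lx: "lookup (edge_expo w e) x = 0 \<longleftrightarrow> e \<in> deletion E x" if "e \<in> E" for e
    using that wpos[of x] by (cases e) (auto simp: lookup_edge_expo deletion_def)
  have sx: "0 < lookup s x" if "s \<in> shift x S1" for s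
    using that by (auto simp: shift_def lookup_add lookup_ev)
  show "S2 = edge_expo w ` deletion E x"
  proof (intro set_eqI iffI)
    fix s assume s: "s \<in> S2"
    then obtain e where "e \<in> E" "s = edge_expo w e" using S by blast
    then show "s \<in> edge_expo w ` deletion E x" using zero[of s] s lx[of e] by auto
  next
    fix s assume "s \<in> edge_expo w ` deletion E x"
    then obtain e where e: "e \<in> deletion E x" "e \<in> E" "s = edge_expo w e" by (auto simp: deletion_def)
    then have "s \<in> shift x S1 \<union> S2" using S by auto
    moreover have "lookup s x = 0" using e lx by auto
    ultimately show "s \<in> S2" using sx[of s] by auto
  qed
  have mem: "\<exists>s1\<in>S1. edge_expo w e = ev x + s1" if "e \<in> E" "e \<notin> deletion E x" for e
  proof -
    have "lookup (edge_expo w e) x \<noteq> 0" using lx that by blast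
    then have "edge_expo w e \<notin> S2" using zero by auto
    then have "edge_expo w e \<in> shift x S1" using S that(1) by blast
    then show ?thesis by (auto simp: shift_def)
  qed
  show inx: "w x = 1" if yx: "(y, x) \<in> E" for y
  proof -
    obtain s1 where s1: "s1 \<in> S1" "edge_expo w (y, x) = ev x + s1"
      using mem[OF yx] by (auto simp: deletion_def)
    have "y \<noteq> x" using yx irrefl by auto
    then have "lookup (edge_expo w (y, x)) x = w x" using lookup_edge_expo[OF yx] by simp
    moreover have "lookup (ev x + s1) x = 1" using zero[of s1] s1 by (simp add: lookup_add lookup_ev)
    ultimately show ?thesis using s1 by simp
  qed
  have in_eq: "edge_expo w (y, x) = ev x + ev y" if "(y, x) \<in> E" for y
    using inx[OF that] by (simp add: edge_expo_def ev_def add.commute)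
  show "S1 = {single y (w y) | y. (x, y) \<in> E} \<union> {ev y | y. (y, x) \<in> E}"
  proof (intro set_eqI iffI)
    fix s assume s: "s \<in> S1"
    then have "ev x + s \<in> edge_expo w ` E" using S by (auto simp: shift_def)
    then obtain e where e: "e \<in> E" "ev x + s = edge_expo w e" by blast
    have "lookup (edge_expo w e) x \<noteq> 0" unfolding e(2)[symmetric] by (simp add: lookup_add lookup_ev)
    then have "e \<notin> deletion E x" using lx[OF e(1)] by simp
    then obtain y where "e = (x, y) \<or> e = (y, x)" using e(1) by (cases e) (auto simp: deletion_def)
    then show "s \<in> {single y (w y) | y. (x, y) \<in> E} \<union> {ev y | y. (y, x) \<in> E}"
    proof
      assume xy: "e = (x, y)"
      then have "s = single y (w y)" using e(2) by (simp add: edge_expo_def)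
      then show ?thesis using e(1) xy by blast
    next
      assume yx: "e = (y, x)"
      then have "ev x + s = ev x + ev y" using e in_eq by simp
      then have "s = ev y" by simp
      then show ?thesis using e(1) yx by blast
    qed
  next
    fix s assume "s \<in> {single y (w y) | y. (x, y) \<in> E} \<union> {ev y | y. (y, x) \<in> E}"
    then consider y where "(x, y) \<in> E" "s = single y (w y)" | y where "(y, x) \<in> E" "s = ev y" by blast
    then show "s \<in> S1"
    proof cases
      case (1 y)
      obtain s1 where "s1 \<in> S1" "edge_expo w (x, y) = ev x + s1"
        using mem[OF 1(1)] by (auto simp: deletion_def)
      then show ?thesis using 1 by (simp add: edge_expo_def)
    next
      case (2 y)
      obtain s1 where "s1 \<in> S1" "edge_expo w (y, x) = ev x + s1"
        using mem[OF 2(1)] by (auto simp: deletion_def)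
      then show ?thesis using 2 in_eq by simp
    qed
  qed
qed

text \<open>The only generators dividing y^m z^n are y^m and z^n, and neither is linear over the
  other when both exponents exceed 1. Applied to \<open>S1\<close>, this leaves x at most one heavy
  out-neighbour.\<close>

lemma vsplit_pure_powers:
  assumes vs: "vsplit S" and yz: "single y m \<in> S" "single z n \<in> S" "y \<noteq> z" "1 < m" "1 < n"
    and pure: "\<And>s. s \<in> S \<Longrightarrow> \<exists>u k. s = single u k \<and> 0 < k"
    and uniq: "\<And>u k l. single u k \<in> S \<Longrightarrow> single u l \<in> S \<Longrightarrow> k = l"
  shows False
proof -
  let ?a = "single y m + single z n"
  have "single y m \<noteq> single z n"
    using yz by (metis lookup_single_eq lookup_single_not_eq not_one_less_zero)
  then obtain r where r: "r \<in> S" "r \<noteq> single y m" "r \<preceq> ?a" "lin r (single y m) \<or> lin (single y m) r"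
    using vsplit_not_isolated[OF vs yz(1,2), of ?a] by auto
  obtain u k where u: "r = single u k" "0 < k" using pure[OF r(1)] by blast
  have "0 < lookup ?a u" using dvD[OF r(3), of u] u by simp
  then have "u = y \<or> u = z" by (auto simp: lookup_add lookup_single when_def split: if_splits)
  then have "r = single z n" using uniq r u yz by metis
  then obtain v where "single z n \<preceq> single y m + ev v \<or> single y m \<preceq> single z n + ev v"
    using r(4) by (auto simp: lin_def)
  then show False using yz by (auto simp: single_dv_iff lookup_add lookup_single lookup_ev split: if_splits)
qed

text \<open>The graph is generalised because \<open>S2\<close> belongs to the deletion of x. The
  part \<open>S1\<close> consists of pure powers and is no set of edge generators, so
  \<open>lqs_link\<close> takes over there in place of an induction hypothesis.\<close>

theorem vsplit_edges_lqs:
  fixes E :: "('v::finite \<times> 'v) set"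
  assumes "vsplit S" "weighted_graph E w" "S = edge_expo w ` E"
    "path6_free E w" "cycle7_free E w" "path8_free E w"
  shows "lqs (Mins (U2 S))"
  using assms
proof (induction arbitrary: E)
  case vsplit_empty
  then show ?case by (simp add: U2_def Mins_def lqs_empty)
next
  case (vsplit_single s)
  have "U2 {s} = {}" by (auto simp: U2_def)
  then show ?case by (simp add: Mins_def lqs_empty)
next
  case (vsplit_step S1 S2 x)
  interpret weighted_graph E w by fact
  have "\<forall>s\<in>S1 \<union> S2. lookup s x = 0" using vsplit_step.hyps(3) by blast
  note str = splitting_structure[OF vsplit_step.prems(2) this]
  have wd: "weighted_graph (deletion E x) w"
    by unfold_locales (auto simp: deletion_def asym wpos)
  have IH: "lqs (Mins (U2 S2))"
    by (rule vsplit_step.IH(2)[OF wd str(1)])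
      (intro path6_free_deletion cycle7_free_deletion path8_free_deletion vsplit_step.prems(3-5))+
  have irr: "(x, x) \<notin> E" using irrefl by blast
  have uniq: "k = l" if kl: "single u k \<in> S1" "single u l \<in> S1" for u k l
  proof -
    have *: "(x, u) \<in> E \<and> k = w u \<or> (u, x) \<in> E \<and> k = 1" if k: "single u k \<in> S1" for k
    proof -
      consider y where "(x, y) \<in> E" "single u k = single y (w y)" | y where "(y, x) \<in> E" "single u k = single y 1"
        using k unfolding str(3) ev_def by blast
      then show ?thesis
      proof cases
        case (1 y)
        then have "u = y" "k = w y" using wpos[of y]
          by (metis lookup_single_eq lookup_single_not_eq less_numeral_extra(3))+
        then show ?thesis using 1 by simp
      next
        case (2 y)
        then have "u = y" "k = 1" by (metis lookup_single_eq lookup_single_not_eq zero_neq_one)+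
        then show ?thesis using 2 by simp
      qed
    qed
    show ?thesis using *[OF kl(1)] *[OF kl(2)] asym by blast
  qed
  have pure: "\<exists>u k. s = single u k \<and> 0 < k" if "s \<in> S1" for s
    using that wpos unfolding str(3) ev_def by fastforce
  obtain y0 where y0: "y0 = x \<or> (x, y0) \<in> E \<and> 1 < w y0"
    and y0_x: "\<And>y. (x, y) \<in> E \<Longrightarrow> 1 < w y \<Longrightarrow> y0 \<noteq> x"
  proof (cases "\<exists>y. (x, y) \<in> E \<and> 1 < w y")
    case True
    then show ?thesis using that irr by blast
  next
    case False
    then show ?thesis using that[of x] by blast
  qed
  have light: "w y = 1" if y: "(x, y) \<in> E" "y \<noteq> y0" for y
  proof (rule ccontr)
    assume "w y \<noteq> 1"
    then have wy: "1 < w y" using wpos[of y] by simp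
    then have "y0 \<noteq> x" using y y0_x by blast
    then have "(x, y0) \<in> E" "1 < w y0" using y0 by auto
    moreover from this have "single y (w y) \<in> S1" "single y0 (w y0) \<in> S1" using y unfolding str(3) by blast+
    ultimately show False
      using vsplit_pure_powers[OF vsplit_step.hyps(1), of y "w y" y0 "w y0"] pure uniq wy y(2) by blast
  qed
  have S1_ex: "S1 = (\<lambda>y. single y (if y = y0 then w y0 else 1)) ` {y. adj E x y}"
  proof -
    have e1: "single y (w y) = single y (if y = y0 then w y0 else 1)" if "(x, y) \<in> E" for y
      using light[OF that] by auto
    have e2: "ev y = single y (if y = y0 then w y0 else 1)" if "(y, x) \<in> E" for y
      using y0 asym[OF that] that irr by (auto simp: ev_def)
    let ?f = "\<lambda>y. single y (if y = y0 then w y0 else 1)"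
    have "{single y (w y) | y. (x, y) \<in> E} = ?f ` {y. (x, y) \<in> E}"
      unfolding setcompr_eq_image using e1 by (intro image_cong) simp_all
    moreover have "{ev y | y. (y, x) \<in> E} = ?f ` {y. (y, x) \<in> E}"
      unfolding setcompr_eq_image using e2 by (intro image_cong) simp_all
    ultimately show ?thesis unfolding str(3) adj_def Collect_disj_eq image_Un by simp
  qed
  have cover: "adj E x v \<or> adj E x u \<and> u \<noteq> y0" if uv: "(u, v) \<in> E" "u \<noteq> x" "v \<noteq> x" for u v
  proof -
    have "edge_expo w (u, v) \<in> S2" using uv unfolding str(1) by (auto simp: deletion_def)
    \<comment> \<open>A generator y^(ex y) of I_1 divides that of u -> v. It contains u only once,
      so y0 with its exponent above 1 can divide only at the head v.\<close>
    then obtain s where s: "s \<in> S1" "s \<preceq> edge_expo w (u, v)"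
      using vsplit_step.hyps(4) by (auto simp: up_def)
    then obtain y where y: "adj E x y" "s = single y (if y = y0 then w y0 else 1)" unfolding S1_ex by auto
    have le: "(if y = y0 then w y0 else 1) \<le> lookup (edge_expo w (u, v)) y"
      using s(2) y(2) by (simp add: single_dv_iff)
    have "y \<noteq> x" using y irr by (auto simp: adj_def)
    consider "y = v" | "y = u" "y \<noteq> v" using le wpos[of y0] by (auto simp: lookup_edge_expo[OF uv(1)] split: if_splits)
    then show ?thesis
    proof cases
      case 1 then show ?thesis using y by simp
    next
      case 2
      moreover have "y \<noteq> y0"
      proof
        assume "y = y0"
        then have "w y0 \<le> lookup (edge_expo w (u, v)) u" using le 2(1) by metis
        also have "\<dots> = 1" by (simp add: lookup_edge_expo[OF uv(1)])
        finally have "w y0 \<le> 1" .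
        then show False using y0 \<open>y = y0\<close> \<open>y \<noteq> x\<close> by simp
      qed
      ultimately show ?thesis using y by simp
    qed
  qed
  interpret splitting_vertex E w x y0
  proof unfold_locales
    show "vsplit (edge_expo w ` {e \<in> E. fst e \<noteq> x \<and> snd e \<noteq> x})"
      using vsplit_step.hyps(2) unfolding str(1) deletion_def .
  qed (use str(2) light y0 cover vsplit_step.prems in blast)+
  have "link = sums S1 \<union> S2"
    unfolding link_def str(1) S1_ex N_def E2_def deletion_def ex_def ..
  moreover have "Mins (U2 (shift x S1 \<union> S2)) = shift x (Mins (sums S1 \<union> S2)) \<union> Mins (U2 S2)"
  proof (rule Mins_U2_split)
    show "antichain S2" using vsplit_step.hyps(5) by (rule antichain_subset) simp
    fix s t a assume st: "s \<in> S1" "t \<in> S1" "s \<noteq> t" "s \<preceq> a" "t \<preceq> a"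
    obtain u k where u: "s = single u k" using pure[OF st(1)] by blast
    obtain v l where v: "t = single v l" using pure[OF st(2)] by blast
    have "u \<noteq> v" using st uniq u v by blast
    moreover have "k \<le> lookup a u" "l \<le> lookup a v" using st(4,5) by (simp_all add: u v single_dv_iff)
    ultimately show "s + t \<preceq> a" by (auto simp: u v dv_def lookup_add lookup_single when_def)
  qed (use vsplit_step.hyps in auto)
  moreover have "lqs (shift x (Mins (sums S1 \<union> S2)) \<union> Mins (U2 S2))"
  proof (rule lqs_shift_Un)
    show "lqs (Mins (sums S1 \<union> S2))" using lqs_link \<open>link = sums S1 \<union> S2\<close> by simp
    show "lqs (Mins (U2 S2))" by (rule IH)
    show "lookup b x = 0" if "b \<in> Mins (U2 S2)" for b
      by (rule Mins_U2_free[OF _ that]) (use vsplit_step.hyps in auto)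
    show "Mins (U2 S2) \<subseteq> up (Mins (sums S1 \<union> S2))"
    proof
      fix b assume "b \<in> Mins (U2 S2)"
      then obtain s where "s \<in> S2" "s \<preceq> b" using Mins_subset unfolding U2_def by blast
      then show "b \<in> up (Mins (sums S1 \<union> S2))" unfolding up_Mins by (auto simp: up_def)
    qed
  qed
  ultimately show ?case by simp
qed

text \<open>Conversely, each pattern produces two minimal generators of the homological shift ideal that
  are the only ones dividing their least common multiple, and that are not linear over each other.\<close>

lemma linear_quotients_three:
  fixes S :: "'v::finite expo set"
  assumes lq: "linear_quotients (mon_ideal UNIV (U2 S) :: ('v, 'k::field) mpoly set)"
    and g: "g1 \<in> S" "g2 \<in> S" "g3 \<in> S" "g1 \<noteq> g2" "g2 \<noteq> g3"
    and p: "\<And>y. lookup p y = max (lookup g1 y) (lookup g2 y)"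
    and q: "\<And>y. lookup q y = max (lookup g2 y) (lookup g3 y)"
    and mid: "\<And>y. lookup g2 y \<le> max (lookup g1 y) (lookup g3 y)"
    and only: "\<And>s. s \<in> S \<Longrightarrow> (\<And>y. lookup s y \<le> max (lookup p y) (lookup q y)) \<Longrightarrow> s \<in> {g1, g2, g3}"
  shows "lin p q \<or> lin q p"
\<comment> \<open>If p or q divides the other, linearity is immediate; incomparability is what makes
  both of them minimal.\<close>
proof (cases "p \<preceq> q \<or> q \<preceq> p")
  case True
  then show ?thesis unfolding lin_def using dv_trans dv_add(1) by blast
next
  case False
  have pd: "p \<preceq> a" if "g1 \<preceq> a" "g2 \<preceq> a" for a
    using that by (simp add: dv_def p)
  have qd: "q \<preceq> a" if "g2 \<preceq> a" "g3 \<preceq> a" for a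
    using that by (simp add: dv_def q)
  \<comment> \<open>The pair g1, g3 yields no further generator: its common multiples are also
    multiples of g2, hence of p and q.\<close>
  have md: "g2 \<preceq> a" if "g1 \<preceq> a" "g3 \<preceq> a" for a
    unfolding dv_def
  proof
    fix y show "lookup g2 y \<le> lookup a y"
      using mid[of y] dvD[OF that(1), of y] dvD[OF that(2), of y] by linarith
  qed
  have gp: "g1 \<preceq> p" "g2 \<preceq> p" "g2 \<preceq> q" "g3 \<preceq> q" by (simp_all add: dv_def p q)
  have pU: "p \<in> U2 S" "q \<in> U2 S" unfolding U2_def using g gp by blast+
  have below: "p \<preceq> r \<or> q \<preceq> r"
    if r: "r \<in> U2 S" "\<And>y. lookup r y \<le> max (lookup p y) (lookup q y)" for r
  proof -
    obtain s t where st: "s \<in> S" "t \<in> S" "s \<noteq> t" "s \<preceq> r" "t \<preceq> r" using r(1) by (auto simp: U2_def)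
    have "s \<in> {g1, g2, g3}" "t \<in> {g1, g2, g3}"
      using only st r(2) dvD[OF st(4)] dvD[OF st(5)] order_trans by blast+
    then have "g1 \<preceq> r \<and> g2 \<preceq> r \<or> g2 \<preceq> r \<and> g3 \<preceq> r" using st md by auto
    then show ?thesis using pd qd by blast
  qed
  have pM: "p \<in> Mins (U2 S)"
    unfolding Mins_def
  proof (intro CollectI conjI ballI impI)
    fix r assume r: "r \<in> U2 S" "r \<preceq> p"
    have "p \<preceq> r \<or> q \<preceq> r" using dvD[OF r(2)] by (intro below r) (simp add: le_max_iff_disj)
    then show "r = p" using r False dv_trans dv_antisym by blast
  qed (rule pU)
  have qM: "q \<in> Mins (U2 S)"
    unfolding Mins_def
  proof (intro CollectI conjI ballI impI)
    fix r assume r: "r \<in> U2 S" "r \<preceq> q"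
    have "p \<preceq> r \<or> q \<preceq> r" using dvD[OF r(2)] by (intro below r) (simp add: le_max_iff_disj)
    then show "r = q" using r False dv_trans dv_antisym by blast
  qed (rule pU)
  have "mon_ideal UNIV (U2 S) = (mon_ideal UNIV (Mins (U2 S)) :: ('v, 'k) mpoly set)"
    by (rule mon_ideal_cong_up) (simp add: up_Mins)
  then have "linear_quotients (mon_ideal UNIV (Mins (U2 S)) :: ('v, 'k) mpoly set)" using lq by simp
  then show ?thesis
  proof (rule linear_quotients_pair[OF _ antichain_Mins pM qM])
    show "p \<noteq> q" using False by auto
    fix r assume r: "r \<in> Mins (U2 S)" "\<And>y. lookup r y \<le> max (lookup p y) (lookup q y)"
    then have "p \<preceq> r \<or> q \<preceq> r" using below Mins_subset by blast
    then show "r = p \<or> r = q" using antichainD[OF antichain_Mins] pM qM r(1) by blast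
  qed
qed

section \<open>Each pattern prevents linear quotients\<close>

context weighted_graph
begin

text \<open>The middle generator is b c since w c = 1, so p = a b^(w b) c and q = b c d^(w d). The
  colon ideals are generated by a b^(w b - 1) and d^(w d), both of degree at least two.\<close>

lemma lq_path6_free:
  assumes lq: "linear_quotients (mon_ideal UNIV (U2 (edge_expo w ` E)) :: ('v, 'k::field) mpoly set)"
  shows "path6_free E w"
  unfolding path6_free_def
proof (intro allI impI, elim conjE, rule ccontr)
  fix a b c d
  assume h: "distinct [a, b, c, d]" "(a, b) \<in> E" "(b, c) \<in> E" "(c, d) \<in> E" "1 < w b" "w c = 1" "1 < w d"
    and n: "\<not> (adj E a c \<or> adj E a d \<or> adj E b d)"
  let ?p = "edge_expo w (a, b) + ev c" and ?q = "edge_expo w (c, d) + ev b"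
  note lk = lookup_edge_expo[OF h(2)] lookup_edge_expo[OF h(3)] lookup_edge_expo[OF h(4)] lookup_add lookup_ev
  have "lin ?p ?q \<or> lin ?q ?p"
  proof (rule linear_quotients_three[OF lq, of "edge_expo w (a, b)" "edge_expo w (b, c)" "edge_expo w (c, d)"])
    show "edge_expo w (a, b) \<noteq> edge_expo w (b, c)" using edge_expo_inj[OF h(2,3)] h(1) by auto
    show "edge_expo w (b, c) \<noteq> edge_expo w (c, d)" using edge_expo_inj[OF h(3,4)] h(1) by auto
    fix s assume "s \<in> edge_expo w ` E" and le: "\<And>y. lookup s y \<le> max (lookup ?p y) (lookup ?q y)"
    then obtain u v where uv: "(u, v) \<in> E" "s = edge_expo w (u, v)" by auto
    have "0 < lookup s u" "0 < lookup s v" using uv wpos by (auto simp: lookup_edge_expo)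
    then have "u \<in> {a, b, c, d}" "v \<in> {a, b, c, d}" using le[of u] le[of v] by (auto simp: lk split: if_splits)
    then have "(u, v) \<in> {(a, b), (b, c), (c, d)}"
      using uv(1) n asym h(2-4) irrefl by (auto simp: adj_def)
    then show "s \<in> {edge_expo w (a, b), edge_expo w (b, c), edge_expo w (c, d)}" using uv(2) by auto
  qed (use h in \<open>auto simp: lk\<close>)
  then obtain z where "?p \<preceq> ?q + ev z \<or> ?q \<preceq> ?p + ev z" by (auto simp: lin_def)
  then show False
  proof
    assume "?p \<preceq> ?q + ev z"
    then show False using dvD[of ?p "?q + ev z" a] dvD[of ?p "?q + ev z" b] h
      by (auto simp: lk split: if_splits)
  next
    assume "?q \<preceq> ?p + ev z"
    then show False using dvD[of ?q "?p + ev z" d] h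
      by (auto simp: lk split: if_splits)
  qed
qed

text \<open>The light edge c -> a goes in the middle: a c divides the least common multiple of the
  other two generators. Here p = a b^(w b) c and q = a b c^(w c), so the colon ideals are generated
  by b^(w b - 1) and c^(w c - 1).\<close>

lemma lq_cycle7_free:
  assumes lq: "linear_quotients (mon_ideal UNIV (U2 (edge_expo w ` E)) :: ('v, 'k::field) mpoly set)"
  shows "cycle7_free E w"
  unfolding cycle7_free_def
proof (intro allI impI, elim conjE, rule ccontr)
  fix a b c
  assume h: "(a, b) \<in> E" "(b, c) \<in> E" "(c, a) \<in> E" "w a = 1" and n: "\<not> (w b \<le> 2 \<or> w c \<le> 2)"
  have ne: "a \<noteq> b" "b \<noteq> c" "a \<noteq> c" using h irrefl by auto
  let ?p = "edge_expo w (a, b) + ev c" and ?q = "edge_expo w (b, c) + ev a"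
  note lk = lookup_edge_expo[OF h(1)] lookup_edge_expo[OF h(2)] lookup_edge_expo[OF h(3)] lookup_add lookup_ev
  have "lin ?p ?q \<or> lin ?q ?p"
  proof (rule linear_quotients_three[OF lq, of "edge_expo w (a, b)" "edge_expo w (c, a)" "edge_expo w (b, c)"])
    show "edge_expo w (a, b) \<noteq> edge_expo w (c, a)" using edge_expo_inj[OF h(1,3)] ne by auto
    show "edge_expo w (c, a) \<noteq> edge_expo w (b, c)" using edge_expo_inj[OF h(3,2)] ne by auto
    fix s assume "s \<in> edge_expo w ` E" and le: "\<And>y. lookup s y \<le> max (lookup ?p y) (lookup ?q y)"
    then obtain u v where uv: "(u, v) \<in> E" "s = edge_expo w (u, v)" by auto
    have "0 < lookup s u" "0 < lookup s v" using uv wpos by (auto simp: lookup_edge_expo)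
    then have "u \<in> {a, b, c}" "v \<in> {a, b, c}" using le[of u] le[of v] by (auto simp: lk split: if_splits)
    then have "(u, v) \<in> {(a, b), (b, c), (c, a)}"
      using uv(1) asym h(1-3) irrefl by auto
    then show "s \<in> {edge_expo w (a, b), edge_expo w (c, a), edge_expo w (b, c)}" using uv(2) by auto
  qed (use h n ne in \<open>auto simp: lk\<close>)
  then obtain z where "?p \<preceq> ?q + ev z \<or> ?q \<preceq> ?p + ev z" by (auto simp: lin_def)
  then show False
  proof
    assume "?p \<preceq> ?q + ev z"
    then show False using dvD[of ?p "?q + ev z" b] n ne
      by (auto simp: lk split: if_splits)
  next
    assume "?q \<preceq> ?p + ev z"
    then show False using dvD[of ?q "?p + ev z" c] n ne
      by (auto simp: lk split: if_splits)
  qed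
qed

text \<open>With b c in the middle, p = a^(w a) b c and q = b c d^(w d), and the colon ideals are
  generated by a^(w a) and d^(w d).\<close>

lemma lq_path8_free:
  assumes lq: "linear_quotients (mon_ideal UNIV (U2 (edge_expo w ` E)) :: ('v, 'k::field) mpoly set)"
  shows "path8_free E w"
  unfolding path8_free_def
proof (intro allI impI, elim conjE, rule ccontr)
  fix a b c d
  assume h: "distinct [a, b, c, d]" "(b, a) \<in> E" "(c, d) \<in> E" "1 < w a" "1 < w d"
    and bc: "(b, c) \<in> E \<and> w c = 1 \<or> (c, b) \<in> E \<and> w b = 1"
    and n: "\<not> (adj E a c \<or> adj E a d \<or> adj E b d)"
  \<comment> \<open>In either orientation the head of the middle edge has weight 1, so its generator
    is b c.\<close>
  obtain e where e: "e \<in> E" "e = (b, c) \<or> e = (c, b)" "edge_expo w e = ev b + ev c"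
    using bc by (auto simp: edge_expo_def ev_def add.commute)
  let ?p = "edge_expo w (b, a) + ev c" and ?q = "edge_expo w (c, d) + ev b"
  note lk = lookup_edge_expo[OF h(2)] lookup_edge_expo[OF h(3)] lookup_add lookup_ev
  have "lin ?p ?q \<or> lin ?q ?p"
  proof (rule linear_quotients_three[OF lq, of "edge_expo w (b, a)" "edge_expo w e" "edge_expo w (c, d)"])
    show "edge_expo w e \<in> edge_expo w ` E" using e(1) by (rule imageI)
    show "edge_expo w (b, a) \<noteq> edge_expo w e" using edge_expo_inj[OF h(2) e(1)] e(2) h(1) by auto
    show "edge_expo w e \<noteq> edge_expo w (c, d)" using edge_expo_inj[OF e(1) h(3)] e(2) h(1) by auto
    fix s assume "s \<in> edge_expo w ` E" and le: "\<And>y. lookup s y \<le> max (lookup ?p y) (lookup ?q y)"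
    then obtain u v where uv: "(u, v) \<in> E" "s = edge_expo w (u, v)" by auto
    have "0 < lookup s u" "0 < lookup s v" using uv wpos by (auto simp: lookup_edge_expo)
    then have "u \<in> {a, b, c, d}" "v \<in> {a, b, c, d}" using le[of u] le[of v] by (auto simp: lk split: if_splits)
    then have "(u, v) \<in> {(b, a), e, (c, d)}"
      using uv(1) n asym h(2,3) e(1,2) irrefl by (auto simp: adj_def)
    then show "s \<in> {edge_expo w (b, a), edge_expo w e, edge_expo w (c, d)}" using uv(2) by auto
  qed (use h in \<open>auto simp: lk e(3)\<close>)
  then obtain z where "?p \<preceq> ?q + ev z \<or> ?q \<preceq> ?p + ev z" by (auto simp: lin_def)
  then show False
  proof
    assume "?p \<preceq> ?q + ev z"
    then show False using dvD[of ?p "?q + ev z" a] h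
      by (auto simp: lk split: if_splits)
  next
    assume "?q \<preceq> ?p + ev z"
    then show False using dvD[of ?q "?p + ev z" d] h
      by (auto simp: lk split: if_splits)
  qed
qed

end

section \<open>Minimal free resolutions\<close>

type_synonym ('v, 'k) mvec = "nat \<Rightarrow> ('v, 'k) mpoly"

definition homog :: "(nat \<Rightarrow> 'v expo) \<Rightarrow> 'v expo \<Rightarrow> ('v, 'k::field) mvec \<Rightarrow> bool" where
  "homog d a v \<longleftrightarrow> (\<forall>i. \<forall>m\<in>keys (v i). m + d i = a)"

text \<open>The homogeneous component of degree a; each coefficient keeps at most one term. The
  guard is there because subtraction of exponents is truncated.\<close>

definition hcomp :: "(nat \<Rightarrow> 'v expo) \<Rightarrow> 'v expo \<Rightarrow> ('v, 'k::field) mvec \<Rightarrow> ('v, 'k) mvec" where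
  "hcomp d a v = (\<lambda>i. if d i \<preceq> a then single (a - d i) (lookup (v i) (a - d i)) else 0)"

definition lmap :: "nat \<Rightarrow> (nat \<Rightarrow> ('v, 'k::field) mvec) \<Rightarrow> ('v, 'k) mvec \<Rightarrow> ('v, 'k) mvec" where
  "lmap r c v = (\<lambda>i. \<Sum>j<r. v j * c j i)"

definition free :: "nat \<Rightarrow> ('v, 'k::field) mvec set" where
  "free r = {v. \<forall>i\<ge>r. v i = 0}"

definition graded_submodule :: "nat \<Rightarrow> (nat \<Rightarrow> 'v expo) \<Rightarrow> ('v, 'k::field) mvec set \<Rightarrow> bool" where
  "graded_submodule r d K \<longleftrightarrow> K \<subseteq> free r \<and> (\<lambda>_. 0) \<in> K \<and>
     (\<forall>u\<in>K. \<forall>v\<in>K. (\<lambda>i. u i + v i) \<in> K) \<and> (\<forall>p. \<forall>v\<in>K. (\<lambda>i. p * v i) \<in> K) \<and>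
     (\<forall>a. \<forall>v\<in>K. hcomp d a v \<in> K)"

lemma graded_submodule_add:
  "graded_submodule r d K \<Longrightarrow> u \<in> K \<Longrightarrow> v \<in> K \<Longrightarrow> (\<lambda>i. u i + v i) \<in> K"
  by (simp add: graded_submodule_def)

lemma graded_submodule_scale:
  "graded_submodule r d K \<Longrightarrow> v \<in> K \<Longrightarrow> (\<lambda>i. p * v i) \<in> K"
  by (simp add: graded_submodule_def)

lemma graded_submodule_hcomp: "graded_submodule r d K \<Longrightarrow> v \<in> K \<Longrightarrow> hcomp d a v \<in> K"
  by (simp add: graded_submodule_def)

definition span_of :: "('v, 'k::field) mvec set \<Rightarrow> ('v, 'k) mvec set" where
  "span_of G = {v. \<exists>q. v = (\<lambda>i. \<Sum>g\<in>G. q g * g i)}"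

lemma span_of_0: "(\<lambda>_. 0) \<in> span_of G"
  unfolding span_of_def by (intro CollectI exI[of _ "\<lambda>_. 0"]) simp

lemma span_of_add:
  assumes "u \<in> span_of G" "v \<in> span_of G" shows "(\<lambda>i. u i + v i) \<in> span_of G"
proof -
  obtain q q' where "u = (\<lambda>i. \<Sum>g\<in>G. q g * g i)" "v = (\<lambda>i. \<Sum>g\<in>G. q' g * g i)"
    using assms by (auto simp: span_of_def)
  then show ?thesis unfolding span_of_def
    by (intro CollectI exI[of _ "\<lambda>g. q g + q' g"]) (simp add: distrib_right sum.distrib)
qed

lemma span_of_scale:
  assumes "v \<in> span_of G" shows "(\<lambda>i. p * v i) \<in> span_of G"
proof -
  obtain q where "v = (\<lambda>i. \<Sum>g\<in>G. q g * g i)"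
    using assms by (auto simp: span_of_def)
  then show ?thesis unfolding span_of_def
    by (intro CollectI exI[of _ "\<lambda>g. p * q g"]) (simp add: sum_distrib_left mult.assoc)
qed

lemma span_of_base:
  assumes "finite G" "g \<in> G" shows "g \<in> span_of G"
  unfolding span_of_def
proof (intro CollectI exI)
  show "g = (\<lambda>i. \<Sum>h\<in>G. (if h = g then 1 else 0) * h i)"
    using assms by (auto simp: if_distrib[of "\<lambda>x. x * _"] cong: if_cong)
qed

lemma span_of_sum:
  "(\<And>a. a \<in> A \<Longrightarrow> f a \<in> span_of G) \<Longrightarrow> (\<lambda>i. \<Sum>a\<in>A. f a i) \<in> span_of G"
  by (induction A rule: infinite_finite_induct) (auto intro: span_of_0 span_of_add)

lemma span_of_mono:
  assumes "finite H" "G \<subseteq> H" "v \<in> span_of G" shows "v \<in> span_of H"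
proof -
  obtain q where "v = (\<lambda>i. \<Sum>g\<in>G. q g * g i)" using assms by (auto simp: span_of_def)
  then have "v = (\<lambda>i. \<Sum>g\<in>G. (q g * g i))" by simp
  moreover have "(\<lambda>i. \<Sum>g\<in>G. (\<lambda>i. q g * g i) i) \<in> span_of H"
    by (rule span_of_sum) (use assms in \<open>auto intro: span_of_scale span_of_base\<close>)
  ultimately show ?thesis by simp
qed

lemma graded_submodule_span:
  assumes "graded_submodule r d K" "finite G" "G \<subseteq> K" shows "span_of G \<subseteq> K"
proof
  fix v assume "v \<in> span_of G"
  then obtain q where v: "v = (\<lambda>i. \<Sum>g\<in>G. q g * g i)" by (auto simp: span_of_def)
  have "(\<lambda>i. \<Sum>g\<in>G. q g * g i) \<in> K"
    using assms(2,3)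
  proof (induction G)
    case empty then show ?case using assms(1) by (simp add: graded_submodule_def)
  next
    case (insert g G)
    have "(\<lambda>i. q g * g i) \<in> K" using insert by (intro graded_submodule_scale[OF assms(1)]) simp
    moreover have "(\<lambda>i. \<Sum>g\<in>G. q g * g i) \<in> K" using insert by simp
    ultimately have "(\<lambda>i. q g * g i + (\<Sum>g\<in>G. q g * g i)) \<in> K"
      by (rule graded_submodule_add[OF assms(1)])
    then show ?case using insert by simp
  qed
  then show "v \<in> K" using v by simp
qed

lemma homog_single:
  assumes "homog d a v"
  shows "v i = (if d i \<preceq> a then single (a - d i) (lookup (v i) (a - d i)) else 0)"
proof (rule poly_mapping_eqI)
  fix m
  have k: "m + d i = a" if "lookup (v i) m \<noteq> 0" for m
    using assms that by (auto simp: homog_def in_keys_iff)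
  show "lookup (v i) m = lookup (if d i \<preceq> a then single (a - d i) (lookup (v i) (a - d i)) else 0) m"
  proof (cases "lookup (v i) m = 0")
    case True
    then show ?thesis by (auto simp: lookup_single when_def)
  next
    case False
    then have "a = m + d i" using k by simp
    then show ?thesis by (simp add: lookup_single)
  qed
qed

lemma homog_hcomp: "homog d a (hcomp d a v)"
  unfolding homog_def hcomp_def by (auto simp: dv_minus_add split: if_splits)

lemma homog_add: "homog d a u \<Longrightarrow> homog d a v \<Longrightarrow> homog d a (\<lambda>i. u i + v i)"
  unfolding homog_def by (auto dest: subsetD[OF keys_add])

lemma homog_scale:
  assumes "homog d b v" shows "homog d (e + b) (\<lambda>i. single e s * v i)"
  unfolding homog_def
proof (intro allI ballI)
  fix i m assume "m \<in> keys (single e s * v i)"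
  then obtain m1 m2 where "m = m1 + m2" "m1 \<in> keys (single e s)" "m2 \<in> keys (v i)"
    using keys_mult[of "single e s" "v i"] by blast
  then show "m + d i = e + b" using assms by (auto simp: homog_def add.assoc split: if_splits)
qed

text \<open>In a multigrading each coefficient of a homogeneous vector is at most a single term, so
  divisibility of degrees does the work of leading terms, and a vector is the finite sum of its
  homogeneous components.\<close>

lemma graded_submodule_generated:
  fixes d :: "nat \<Rightarrow> 'v::finite expo" and K :: "('v, 'k::field) mvec set"
  assumes K: "graded_submodule r d K"
  shows "\<exists>G. finite G \<and> G \<subseteq> K \<and> (\<forall>g\<in>G. \<exists>a. homog d a g) \<and> span_of G = K"
proof -
  note add = graded_submodule_add[OF K] and scale = graded_submodule_scale[OF K]
  text \<open>Reduction of the last nonzero component; by Dickson's lemma finitely many elements suffice.\<close>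
  have step: "\<exists>G. finite G \<and> G \<subseteq> K \<and> (\<forall>g\<in>G. \<exists>a. homog d a g) \<and>
      (\<forall>v\<in>K. \<forall>a. homog d a v \<longrightarrow> (\<forall>i\<ge>n. v i = 0) \<longrightarrow> v \<in> span_of G)" for n
  proof (induction n)
    case 0
    have "v \<in> span_of {}" if "\<forall>i\<ge>0. v i = 0" for v :: "('v, 'k) mvec"
    proof -
      have "v = (\<lambda>_. 0)" using that by auto
      then show ?thesis by (simp only: span_of_0)
    qed
    then show ?case by (intro exI[of _ "{}"]) simp
  next
    case (Suc n)
    then obtain G where G: "finite G" "G \<subseteq> K" "\<forall>g\<in>G. \<exists>a. homog d a g"
      and Gn: "\<forall>v\<in>K. \<forall>a. homog d a v \<longrightarrow> (\<forall>i\<ge>n. v i = 0) \<longrightarrow> v \<in> span_of G"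
      by - (erule exE, elim conjE, rule that)
    define A where "A = {a. \<exists>v\<in>K. homog d a v \<and> (\<forall>i\<ge>Suc n. v i = 0) \<and> v n \<noteq> 0}"
    obtain B where B: "B \<subseteq> A" "finite B" "\<And>a. a \<in> A \<Longrightarrow> \<exists>b\<in>B. b \<preceq> a" by (rule dickson[of A]) blast
    have "\<forall>b\<in>B. \<exists>v. v \<in> K \<and> homog d b v \<and> (\<forall>i\<ge>Suc n. v i = 0) \<and> v n \<noteq> 0"
      using B(1) by (auto simp: A_def)
    from bchoice[OF this] obtain g
      where g: "\<forall>b\<in>B. g b \<in> K \<and> homog d b (g b) \<and> (\<forall>i\<ge>Suc n. g b i = 0) \<and> g b n \<noteq> 0" ..
    let ?G = "G \<union> g ` B"
    have fin: "finite ?G" using G B by simp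
    have "v \<in> span_of ?G" if v: "v \<in> K" "homog d a v" "\<forall>i\<ge>Suc n. v i = 0" for v a
    proof (cases "v n = 0")
      case True
      then have "\<forall>i\<ge>n. v i = 0" using v(3) by (metis le_antisym not_less_eq_eq)
      then have "v \<in> span_of G" using Gn[rule_format, OF v(1,2)] by simp
      then show ?thesis using span_of_mono[OF fin] by blast
    next
      case False
      then have "a \<in> A" using v by (auto simp: A_def)
      then obtain b where b: "b \<in> B" "b \<preceq> a" using B by blast
      have gb: "g b \<in> K" "homog d b (g b)" "\<forall>i\<ge>Suc n. g b i = 0" "g b n \<noteq> 0" using g b(1) by auto
      define s where "s = lookup (v n) (a - d n)"
      define t where "t = lookup (g b n) (b - d n)"
      have da: "d n \<preceq> a" "v n = single (a - d n) s"
        using homog_single[OF v(2), of n] False by (auto simp: s_def split: if_splits)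
      have db: "d n \<preceq> b" "g b n = single (b - d n) t"
        using homog_single[OF gb(2), of n] gb(4) by (auto simp: t_def split: if_splits)
      have t: "t \<noteq> 0" using db gb(4) by auto
      \<comment> \<open>Both nth coefficients are single terms over a field, so this multiple of g b
        cancels that of v without leaving degree a.\<close>
      let ?u = "\<lambda>i. v i + single (a - b) (- (s / t)) * g b i"
      have "(a - b) + (b - d n) = a - d n"
        by (rule poly_mapping_eqI) (use b(2) db(1) in \<open>simp add: lookup_add lookup_minus dv_def\<close>)
      then have "?u n = 0" using t by (simp add: da(2) db(2) mult_single single_add[symmetric])
      moreover have "?u i = 0" if "i \<ge> Suc n" for i using v(3) gb(3) that by simp
      ultimately have z: "\<forall>i\<ge>n. ?u i = 0" by (metis le_antisym not_less_eq_eq)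
      have uK: "?u \<in> K" by (rule add[OF v(1) scale[OF gb(1)]])
      have "homog d a ?u"
        using homog_scale[OF gb(2), of "a - b"] unfolding dv_minus_add[OF b(2)] by (rule homog_add[OF v(2)])
      then have "?u \<in> span_of G" using Gn[rule_format, OF uK] z by simp
      then have 1: "?u \<in> span_of ?G" using span_of_mono[OF fin] by blast
      have 2: "(\<lambda>i. single (a - b) (s / t) * g b i) \<in> span_of ?G"
        by (rule span_of_scale[OF span_of_base[OF fin]]) (use b(1) in simp)
      have "v = (\<lambda>i. ?u i + single (a - b) (s / t) * g b i)"
        by (rule ext) (simp add: distrib_right[symmetric] single_add[symmetric] add.assoc)
      then show ?thesis using span_of_add[OF 1 2] by simp
    qed
    moreover have "?G \<subseteq> K" "\<forall>h\<in>?G. \<exists>a. homog d a h" using G(2,3) g by blast+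
    ultimately show ?case using fin by (intro exI[of _ ?G]) simp
  qed
  obtain G where G: "finite G" "G \<subseteq> K" "\<forall>g\<in>G. \<exists>a. homog d a g"
    and Gr: "\<forall>v\<in>K. \<forall>a. homog d a v \<longrightarrow> (\<forall>i\<ge>r. v i = 0) \<longrightarrow> v \<in> span_of G"
    using step[of r] by - (erule exE, elim conjE, rule that)
  have "v \<in> span_of G" if v: "v \<in> K" for v
  proof -
    have vr: "v i = 0" if "i \<ge> r" for i using K v that by (auto simp: graded_submodule_def free_def)
    \<comment> \<open>The finitely many degrees in which v has a nonzero component.\<close>
    define D where "D = (\<Union>i<r. (\<lambda>m. m + d i) ` keys (v i))"
    have finD: "finite D" by (simp add: D_def)
    have "v i = (\<Sum>a\<in>D. hcomp d a v i)" for i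
    proof (rule poly_mapping_eqI)
      fix m
      have "lookup (\<Sum>a\<in>D. hcomp d a v i) m = (\<Sum>a\<in>D. if a = m + d i then lookup (v i) m else 0)"
        unfolding lookup_sum
      proof (rule sum.cong)
        fix a assume "a \<in> D"
        show "lookup (hcomp d a v i) m = (if a = m + d i then lookup (v i) m else 0)"
          unfolding hcomp_def using dv_minus_add[of "d i" a]
          by (auto simp: lookup_single when_def)
      qed simp
      also have "\<dots> = (if m + d i \<in> D then lookup (v i) m else 0)" using finD by simp
      also have "\<dots> = lookup (v i) m"
      proof (cases "m \<in> keys (v i)")
        case True
        then have "i < r" using vr[of i] by (metis keys_zero empty_iff not_le)
        then show ?thesis using True by (auto simp: D_def)
      qed (simp add: in_keys_iff)
      finally show "lookup (v i) m = lookup (\<Sum>a\<in>D. hcomp d a v i) m" ..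
    qed
    then have "v = (\<lambda>i. \<Sum>a\<in>D. hcomp d a v i)" by blast
    moreover have "hcomp d a v \<in> span_of G" for a
    proof (rule Gr[rule_format, OF _ homog_hcomp])
      show "hcomp d a v \<in> K" using K v by (simp add: graded_submodule_def)
      then show "hcomp d a v i = 0" if "r \<le> i" for i
        using K that by (auto simp: graded_submodule_def free_def)
    qed
    ultimately show ?thesis using span_of_sum[of D "\<lambda>a. hcomp d a v" G] by metis
  qed
  then have "span_of G = K" using graded_submodule_span[OF K G(1,2)] by blast
  then show ?thesis using G by blast
qed

lemma lookup_times_single:
  fixes p :: "('v, 'k::field) mpoly"
  shows "lookup (p * single e s) m = (if e \<preceq> m then lookup p (m - e) * s else 0)"
proof -
  have "p * single e s = (\<Sum>l\<in>keys p. single (l + e) (lookup p l * s))"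
    by (subst poly_mapping_sum_single[of p]) (simp add: sum_distrib_right mult_single)
  then have *: "lookup (p * single e s) m = (\<Sum>l\<in>keys p. if l + e = m then lookup p l * s else 0)"
    by (simp add: lookup_sum lookup_single when_def)
  show ?thesis
  proof (cases "e \<preceq> m")
    case True
    have "l + e = m \<longleftrightarrow> l = m - e" for l using dv_minus_add[OF True] by (metis add_right_cancel)
    then show ?thesis unfolding * using True by (simp add: in_keys_iff)
  next
    case False
    then have "l + e \<noteq> m" for l by (metis dv_add(2))
    then show ?thesis unfolding * using False by simp
  qed
qed

text \<open>A matrix with homogeneous columns preserves degrees. This makes its kernel graded, so
  that the construction of a resolution can go on.\<close>

lemma hcomp_lmap:
  fixes c :: "nat \<Rightarrow> ('v, 'k::field) mvec"
  assumes c: "\<And>j. j < r \<Longrightarrow> homog d (d' j) (c j)"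
  shows "hcomp d a (lmap r c v) = lmap r c (hcomp d' a v)"
proof
  fix i
  define s where "s j = lookup (c j i) (d' j - d i)" for j
  have ci: "c j i = (if d i \<preceq> d' j then single (d' j - d i) (s j) else 0)" if "j < r" for j
    unfolding s_def by (rule homog_single[OF c[OF that]])
  \<comment> \<open>Truncated differences cancel like integers only when the subtrahends
    divide.\<close>
  have e: "(a - d i) - (d' j - d i) = a - d' j" "d' j - d i \<preceq> a - d i \<longleftrightarrow> d' j \<preceq> a"
    "a - d' j + (d' j - d i) = a - d i \<or> \<not> d' j \<preceq> a"
    if "d i \<preceq> d' j" "d i \<preceq> a" for j
  proof -
    have l: "lookup (d i) y \<le> lookup (d' j) y" "lookup (d i) y \<le> lookup a y" for y
      using that by (auto simp: dv_def)
    show "(a - d i) - (d' j - d i) = a - d' j"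
      by (rule poly_mapping_eqI) (use l in \<open>simp add: lookup_minus\<close>)
    have "lookup (d' j) y - lookup (d i) y \<le> lookup a y - lookup (d i) y \<longleftrightarrow> lookup (d' j) y \<le> lookup a y" for y
      using l[of y] by linarith
    then show "d' j - d i \<preceq> a - d i \<longleftrightarrow> d' j \<preceq> a" by (simp add: dv_def lookup_minus)
    show "a - d' j + (d' j - d i) = a - d i \<or> \<not> d' j \<preceq> a"
    proof (cases "d' j \<preceq> a")
      case True
      have "a - d' j + (d' j - d i) = a - d i"
        by (rule poly_mapping_eqI) (use l True in \<open>simp add: lookup_minus lookup_add dv_def\<close>)
      then show ?thesis ..
    qed simp
  qed
  have summand: "(if d i \<preceq> a then single (a - d i) (lookup (v j * c j i) (a - d i)) else 0) =
      hcomp d' a v j * c j i" if "j < r" for j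
  proof (cases "d i \<preceq> d' j")
    case False
    then show ?thesis using ci[OF that] by simp
  next
    case True
    show ?thesis
    proof (cases "d i \<preceq> a")
      case da: True
      then show ?thesis using e[OF True da]
        by (auto simp: ci[OF that] True hcomp_def lookup_times_single mult_single)
    next
      case False
      then have "\<not> d' j \<preceq> a" using True dv_trans by blast
      then show ?thesis using False by (simp add: hcomp_def)
    qed
  qed
  have "hcomp d a (lmap r c v) i =
      (\<Sum>j<r. (if d i \<preceq> a then single (a - d i) (lookup (v j * c j i) (a - d i)) else 0))"
  proof (cases "d i \<preceq> a")
    case True
    then show ?thesis
      by (intro poly_mapping_eqI) (auto simp: hcomp_def lmap_def lookup_sum lookup_single when_def)
  qed (simp add: hcomp_def)
  also have "\<dots> = lmap r c (hcomp d' a v) i" unfolding lmap_def using summand by (intro sum.cong) auto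
  finally show "hcomp d a (lmap r c v) i = lmap r c (hcomp d' a v) i" .
qed

section \<open>Kernels, minimal covers and the existence of minimal resolutions\<close>

definition kern :: "nat \<Rightarrow> (nat \<Rightarrow> ('v, 'k::field) mvec) \<Rightarrow> ('v, 'k) mvec set" where
  "kern r c = {v \<in> free r. lmap r c v = (\<lambda>_. 0)}"

lemma graded_submodule_kern:
  fixes c :: "nat \<Rightarrow> ('v, 'k::field) mvec"
  assumes "\<And>j. j < r \<Longrightarrow> homog d (d' j) (c j)"
  shows "graded_submodule r d' (kern r c)"
proof -
  have "lmap r c (\<lambda>i. u i + v i) = (\<lambda>i. lmap r c u i + lmap r c v i)" for u v
    by (simp add: lmap_def distrib_right sum.distrib)
  moreover have "lmap r c (\<lambda>i. p * v i) = (\<lambda>i. p * lmap r c v i)" for p v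
    by (simp add: lmap_def sum_distrib_left mult.assoc)
  moreover have "hcomp d' a v \<in> kern r c" if "v \<in> kern r c" for a v
  proof -
    have "lmap r c (hcomp d' a v) = hcomp d a (lmap r c v)" using hcomp_lmap[OF assms] by simp
    then show ?thesis using that by (auto simp: kern_def free_def hcomp_def)
  qed
  ultimately show ?thesis
    by (auto simp: graded_submodule_def kern_def free_def lmap_def[of r c "\<lambda>_. 0"])
qed

text \<open>The last clause is the minimality: columns chosen later from the kernel have no constant
  terms, so the next differential lands in the maximal ideal.\<close>

definition minimal_cover ::
  "(nat \<Rightarrow> 'v expo) \<Rightarrow> ('v, 'k::field) mvec set \<Rightarrow> nat \<Rightarrow> (nat \<Rightarrow> 'v expo) \<Rightarrow> (nat \<Rightarrow> ('v, 'k) mvec) \<Rightarrow> bool" where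
  "minimal_cover d K r' d' c \<longleftrightarrow> (\<forall>j<r'. c j \<in> K \<and> homog d (d' j) (c j)) \<and> lmap r' c ` free r' = K \<and>
     (\<forall>v\<in>kern r' c. \<forall>j. lookup (v j) 0 = 0)"

text \<open>A homogeneous generating set of least cardinality works, as in the graded Nakayama
  lemma: a relation with a nonzero constant coefficient would express one generator by the
  others.\<close>

lemma minimal_cover_exists:
  fixes K :: "('v::finite, 'k::field) mvec set"
  assumes K: "graded_submodule r d K"
  shows "\<exists>r' d' c. minimal_cover d K r' d' c"
proof -
  let ?P = "\<lambda>G. finite G \<and> G \<subseteq> K \<and> (\<forall>g\<in>G. \<exists>a. homog d a g) \<and> span_of G = K"
  obtain G0 where "?P G0" using graded_submodule_generated[OF K] ..
  from ex_has_least_nat[of ?P G0 card, OF this]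
  obtain G where G: "?P G" and min: "\<forall>H. ?P H \<longrightarrow> card G \<le> card H" by - (erule exE, erule conjE, rule that)
  obtain c where c: "bij_betw c {..<card G} G"
    using G ex_bij_betw_nat_finite[of G] by (auto simp: atLeast0LessThan)
  let ?r = "card G"
  have cG: "c j \<in> G" if "j < ?r" for j using c that by (auto simp: bij_betw_def)
  have "\<forall>g\<in>G. \<exists>a. homog d a g" using G by blast
  from bchoice[OF this] obtain dg where dg: "\<And>g. g \<in> G \<Longrightarrow> homog d (dg g) g" by blast
  define d' where "d' j = dg (c j)" for j
  have hom: "homog d (d' j) (c j)" if "j < ?r" for j using dg cG that by (simp add: d'_def)
  have img: "lmap ?r c ` free ?r = K"
  proof -
    have "lmap ?r c v \<in> span_of G" for v
      unfolding lmap_def by (rule span_of_sum) (use cG G in \<open>auto intro: span_of_scale span_of_base\<close>)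
    moreover have "u \<in> lmap ?r c ` free ?r" if u: "u \<in> span_of G" for u
    proof -
      obtain q where q: "u = (\<lambda>i. \<Sum>g\<in>G. q g * g i)" using u by (auto simp: span_of_def)
      have "u = lmap ?r c (\<lambda>j. if j < ?r then q (c j) else 0)"
        unfolding q lmap_def
        by (rule ext) (simp add: sum.reindex_bij_betw[OF c, symmetric])
      then show ?thesis by (auto simp: free_def)
    qed
    ultimately show ?thesis using G by blast
  qed
  have "lookup (v k) 0 = 0" if v: "v \<in> kern ?r c" for v k
  proof (rule ccontr)
    assume nz: "lookup (v k) 0 \<noteq> 0"
    then have kr: "k < ?r" using v by (auto simp: kern_def free_def not_le[symmetric])
    \<comment> \<open>The coefficient v k may have further terms. The component in the degree of the
      kth generator keeps just its constant term, a unit.\<close>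
    define u where "u = hcomp d' (d' k) v"
    have uk: "u \<in> kern ?r c"
      unfolding u_def by (rule graded_submodule_hcomp[OF graded_submodule_kern[OF hom] v])
    define t where "t = lookup (v k) 0"
    have "u k = single 0 t" by (simp add: u_def hcomp_def t_def)
    have "(\<Sum>j<?r. u j * c j i) = 0" for i
      using uk by (simp add: kern_def lmap_def) metis
    then have "single 0 t * c k i + (\<Sum>j\<in>{..<?r} - {k}. u j * c j i) = 0" for i
      using kr \<open>u k = single 0 t\<close> by (simp add: sum.remove[of "{..<?r}" k])
    then have e: "single 0 t * c k i = (\<Sum>j\<in>{..<?r} - {k}. - u j * c j i)" for i
      by (simp add: sum_negf eq_neg_iff_add_eq_0)
    have "c k i = single 0 (inverse t) * (single 0 t * c k i)" for i
      using nz by (simp add: mult.assoc[symmetric] mult_single t_def)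
    then have ck: "c k = (\<lambda>i. single 0 (inverse t) * (\<Sum>j\<in>{..<?r} - {k}. - u j * c j i))"
      using e by auto
    let ?H = "G - {c k}"
    have finH: "finite ?H" using G by simp
    have cH: "c j \<in> ?H" if "j \<in> {..<?r} - {k}" for j
      using that c kr by (auto simp: bij_betw_def inj_on_def)
    have "c k \<in> span_of ?H"
      by (subst ck, rule span_of_scale, rule span_of_sum, rule span_of_scale, rule span_of_base[OF finH], rule cH)
    then have gH: "g \<in> span_of ?H" if "g \<in> G" for g
      using that span_of_base[OF finH] by blast
    have "span_of G \<subseteq> span_of ?H"
    proof
      fix w assume "w \<in> span_of G"
      then obtain q where "w = (\<lambda>i. \<Sum>g\<in>G. (\<lambda>i. q g * g i) i)" by (auto simp: span_of_def)
      then show "w \<in> span_of ?H" using span_of_sum[of G "\<lambda>g i. q g * g i" ?H] span_of_scale gH by blast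
    qed
    moreover have "?H \<subseteq> K" "\<forall>g\<in>?H. \<exists>a. homog d a g" using G by blast+
    ultimately have "?P ?H" using G finH graded_submodule_span[OF K finH] by simp
    then have "card G \<le> card ?H" using min by blast
    moreover have "card ?H < card G" using G cG[OF kr] by (intro card_Diff1_less) auto
    ultimately show False by simp
  qed
  then have "minimal_cover d K ?r d' c"
    unfolding minimal_cover_def using img hom cG G by (intro conjI allI impI ballI) auto
  then show ?thesis by (intro exI)
qed

lemma ideal_gen_range_var:
  "(ideal_gen UNIV (range var) :: ('v, 'k::field) mpoly set) = {p. lookup p 0 = 0}"
proof -
  have "m \<in> up (range ev) \<longleftrightarrow> m \<noteq> 0" for m :: "'v expo"
  proof
    assume "m \<noteq> 0"
    then obtain z where "0 < lookup m z" by (metis gr0I lookup_zero poly_mapping_eqI)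
    then show "m \<in> up (range ev)" by (auto simp: up_def ev_dv_iff)
  qed (auto simp: up_def ev_dv_iff)
  then have "mon_ideal UNIV (range ev) = {p :: ('v, 'k) mpoly. 0 \<notin> keys p}"
    by (auto simp: mon_ideal_def)
  moreover have "(ideal_gen UNIV (range var) :: ('v, 'k) mpoly set) = mon_ideal UNIV (range ev)"
    by (rule ideal_gen_var)
  ultimately show ?thesis by (simp add: in_keys_iff)
qed

lemma lookup_times_0:
  fixes p q :: "('v, 'k::field) mpoly"
  assumes "lookup p 0 = 0 \<or> lookup q 0 = 0" shows "lookup (p * q) 0 = 0"
proof (rule ccontr)
  assume "lookup (p * q) 0 \<noteq> 0"
  then have "0 \<in> keys (p * q)" by (simp add: in_keys_iff)
  then obtain a b where ab: "0 = a + b" "a \<in> keys p" "b \<in> keys q" using keys_mult[of p q] by blast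
  have "a = 0" "b = 0"
    using ab(1) by (metis add_is_0 lookup_add lookup_zero poly_mapping_eqI)+
  then show False using ab assms by (auto simp: in_keys_iff)
qed

text \<open>A step of the resolution is a triple of a rank, degrees and columns.\<close>

lemma minimal_resolution_exists:
  fixes S :: "'v::finite expo set"
  shows "\<exists>F. minimal_resolution F (mon_ideal UNIV S :: ('v, 'k::field) mpoly set)"
proof -
  let ?J = "mon_ideal UNIV S :: ('v, 'k) mpoly set"
  \<comment> \<open>The ideal as a submodule of a free module of rank one, so that the augmentation
    is a minimal cover like all later steps.\<close>
  define K0 :: "('v, 'k) mvec set" where "K0 = {v \<in> free 1. v 0 \<in> ?J}"
  have K0: "graded_submodule 1 (\<lambda>_. 0) K0"
    unfolding graded_submodule_def
  proof (intro conjI ballI allI)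
    show "hcomp (\<lambda>_. 0) a v \<in> K0" if v: "v \<in> K0" for a v
    proof -
      have "hcomp (\<lambda>_. 0) a v 0 \<in> ?J"
        using v by (auto simp: K0_def hcomp_def mon_ideal_def in_keys_iff split: if_splits)
      moreover have "hcomp (\<lambda>_. 0) a v \<in> free 1" using v by (auto simp: K0_def hcomp_def free_def)
      ultimately show ?thesis by (simp add: K0_def)
    qed
  qed (auto simp: K0_def free_def mon_ideal_0 intro: mon_ideal_add mon_ideal_mult)
  \<comment> \<open>The clause for n = 0 ties the start of the chain to the ideal; \<open>Q\<close>
    only relates consecutive steps.\<close>
  define P :: "nat \<Rightarrow> nat \<times> (nat \<Rightarrow> 'v expo) \<times> (nat \<Rightarrow> ('v, 'k) mvec) \<Rightarrow> bool" where
    "P n x = (case x of (r, d, c) \<Rightarrow> graded_submodule r d (kern r c) \<and> (\<forall>v\<in>kern r c. \<forall>j. lookup (v j) 0 = 0) \<and>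
       (n = 0 \<longrightarrow> minimal_cover (\<lambda>_. 0) K0 r d c))" for n x
  define Q :: "nat \<Rightarrow> nat \<times> (nat \<Rightarrow> 'v expo) \<times> (nat \<Rightarrow> ('v, 'k) mvec) \<Rightarrow>
      nat \<times> (nat \<Rightarrow> 'v expo) \<times> (nat \<Rightarrow> ('v, 'k) mvec) \<Rightarrow> bool" where
    "Q n x y = (case x of (r, d, c) \<Rightarrow> case y of (r', d', c') \<Rightarrow> minimal_cover d (kern r c) r' d' c')" for n x y
  have cover: "graded_submodule r d (kern r c) \<and> (\<forall>v\<in>kern r c. \<forall>j. lookup (v j) 0 = 0)"
    if "minimal_cover e K r d c" for e K r d and c :: "nat \<Rightarrow> ('v, 'k) mvec"
    using that graded_submodule_kern[of r e d c] by (simp add: minimal_cover_def)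
  have ex0: "\<exists>x. P 0 x"
  proof -
    obtain r d c where "minimal_cover (\<lambda>_. 0) K0 r d c" using minimal_cover_exists[OF K0] by (elim exE) (rule that)
    then show ?thesis using cover by (intro exI[of _ "(r, d, c)"]) (simp add: P_def)
  qed
  have exS: "\<exists>y. P (Suc n) y \<and> Q n x y" if "P n x" for n x
  proof -
    obtain r d c where x: "x = (r, d, c)" by (cases x)
    then have "graded_submodule r d (kern r c)" using that by (simp add: P_def)
    from minimal_cover_exists[OF this] obtain r' d' c' where m: "minimal_cover d (kern r c) r' d' c'"
      by (elim exE) (rule that)
    then show ?thesis using cover[OF m] by (intro exI[of _ "(r', d', c')"]) (simp add: P_def Q_def x)
  qed
  obtain f where f: "\<And>n. P n (f n)" "\<And>n. Q n (f n) (f (Suc n))"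
    using dependent_nat_choice[of P Q, OF ex0 exS] by blast
  define r where "r n = fst (f n)" for n
  define d where "d n = fst (snd (f n))" for n
  define c where "c n = snd (snd (f n))" for n
  have fe: "f n = (r n, d n, c n)" for n by (simp add: r_def d_def c_def)
  have const: "lookup (v j) 0 = 0" if "v \<in> kern (r n) (c n)" for n v j
    using f(1)[of n] that by (simp add: P_def fe)
  have c0: "minimal_cover (\<lambda>_. 0) K0 (r 0) (d 0) (c 0)" using f(1)[of 0] by (simp add: P_def fe)
  have cS: "minimal_cover (d n) (kern (r n) (c n)) (r (Suc n)) (d (Suc n)) (c (Suc n))" for n
    using f(2)[of n] by (simp add: Q_def fe)
  define F where "F = \<lparr>frank = r, fdeg = d, faug = (\<lambda>j. c 0 j 0), fdiff = (\<lambda>k i j. c (Suc k) j i)\<rparr>"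
  have fm: "free_mod F k = free (r k)" for k by (simp add: free_mod_def free_def F_def)
  have colS: "c (Suc k) j \<in> kern (r k) (c k)" if "j < r (Suc k)" for k j
    using cS[of k] that by (simp add: minimal_cover_def)
  have col0: "c 0 j \<in> K0" if "j < r 0" for j
    using c0 that by (simp add: minimal_cover_def)
  have dm: "diff_map F k v = lmap (r (Suc k)) (c (Suc k)) v" for k v
  proof
    fix i
    show "diff_map F k v i = lmap (r (Suc k)) (c (Suc k)) v i"
    proof (cases "i < r k")
      case False
      then have "c (Suc k) j i = 0" if "j < r (Suc k)" for j
        using colS[OF that] by (auto simp: kern_def free_def)
      then show ?thesis using False by (simp add: diff_map_def lmap_def F_def)
    qed (simp add: diff_map_def lmap_def F_def)
  qed
  have am: "aug_map F v = lmap (r 0) (c 0) v 0" for v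
    by (simp add: aug_map_def lmap_def F_def)
  have am0: "aug_map F v = 0 \<longleftrightarrow> lmap (r 0) (c 0) v = (\<lambda>_. 0)" for v
  proof
    assume a: "aug_map F v = 0"
    have "lmap (r 0) (c 0) v i = 0" for i
    proof (cases "i = 0")
      case False
      then have "c 0 j i = 0" if "j < r 0" for j using col0[OF that] by (auto simp: K0_def free_def)
      then show ?thesis by (simp add: lmap_def)
    qed (use a am in simp)
    then show "lmap (r 0) (c 0) v = (\<lambda>_. 0)" by auto
  qed (simp add: am)
  have "minimal_resolution F ?J"
    unfolding minimal_resolution_def
  proof (intro conjI allI impI)
    show "multigraded F"
      using c0 cS by (auto simp: multigraded_def minimal_cover_def homog_def F_def)
    show "resolves F ?J"
      unfolding resolves_def
    proof (intro conjI allI)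
      have img0: "lmap (r 0) (c 0) ` free (r 0) = K0" using c0 by (simp add: minimal_cover_def)
      show "aug_map F ` free_mod F 0 = ?J"
      proof (intro set_eqI iffI)
        fix p assume "p \<in> aug_map F ` free_mod F 0"
        then obtain v where v: "v \<in> free (r 0)" "p = lmap (r 0) (c 0) v 0" by (auto simp: am fm)
        then have "lmap (r 0) (c 0) v \<in> K0" unfolding img0[symmetric] by (intro imageI)
        then show "p \<in> ?J" using v by (simp add: K0_def)
      next
        fix p assume p: "p \<in> ?J"
        then have "(\<lambda>i. if i = 0 then p else 0) \<in> K0" by (auto simp: K0_def free_def)
        then obtain v where v: "v \<in> free (r 0)" "(\<lambda>i. if i = 0 then p else 0) = lmap (r 0) (c 0) v"
          unfolding img0[symmetric] by (rule imageE)
        have "p = aug_map F v" using fun_cong[OF v(2), of 0] by (simp add: am)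
        moreover have "v \<in> free_mod F 0" using v(1) by (simp add: fm)
        ultimately show "p \<in> aug_map F ` free_mod F 0" by blast
      qed
      have im: "diff_map F k ` free_mod F (Suc k) = kern (r k) (c k)" for k
        using cS[of k] unfolding fm dm[abs_def] by (simp add: minimal_cover_def)
      show "diff_map F 0 ` free_mod F 1 = {v \<in> free_mod F 0. aug_map F v = 0}"
        using im[of 0] by (simp add: am0 fm kern_def)
      show "diff_map F (Suc k) ` free_mod F (Suc (Suc k)) = {v \<in> free_mod F (Suc k). diff_map F k v = (\<lambda>_. 0)}" for k
        using im[of "Suc k"] by (simp add: dm fm kern_def)
    qed
    fix k i j assume "i < frank F k" "j < frank F (Suc k)"
    then show "fdiff F k i j \<in> ideal_gen UNIV (range var)"
      unfolding ideal_gen_range_var using const[OF colS[of j k], of i] by (simp add: F_def)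
  qed
  then show ?thesis ..
qed

section \<open>First syzygies of monomial ideals\<close>

lemma unit_vector_sum:
  fixes g :: "nat \<Rightarrow> ('v, 'k::field) mpoly"
  shows "k < n \<Longrightarrow> (\<Sum>j<n. (if j = k then p else 0) * g j) = p * g k"
  by (simp add: if_distrib[of "\<lambda>x. x * _"] cong: if_cong)

lemma pair_vector_sum:
  fixes g :: "nat \<Rightarrow> ('v, 'k::field) mpoly"
  assumes "k < n" "l < n" "k \<noteq> l"
  shows "(\<Sum>j<n. (if j = k then p else if j = l then q else 0) * g j) = p * g k + q * g l"
proof -
  have "(\<Sum>j<n. (if j = k then p else if j = l then q else 0) * g j) =
      (\<Sum>j<n. (if j = k then p else 0) * g j + (if j = l then q else 0) * g j)"
    using assms by (intro sum.cong) auto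
  then show ?thesis using assms by (simp add: sum.distrib unit_vector_sum)
qed

text \<open>Minimality makes the degrees of F_0 an antichain, hence equal to \<open>S\<close>. Two
  generators dividing a give a syzygy of degree a, and exactness yields a basis element of F_1 whose
  degree divides a. Conversely, the column of a basis element of F_1 has at least two nonzero
  entries, so two generators divide its degree.\<close>

lemma minimal_resolution_HS1:
  fixes S :: "'v::finite expo set"
  assumes F: "minimal_resolution F (mon_ideal UNIV S :: ('v, 'k::field) mpoly set)" and S: "antichain S"
  shows "up (fdeg F 1 ` {..<frank F 1}) = U2 S"
proof -
  let ?J = "mon_ideal UNIV S :: ('v, 'k) mpoly set"
  let ?r0 = "frank F 0" and ?r1 = "frank F 1"
  have mg: "multigraded F" and rs: "resolves F ?J" and
    mn: "\<And>k i j. i < frank F k \<Longrightarrow> j < frank F (Suc k) \<Longrightarrow> lookup (fdiff F k i j) 0 = 0"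
    using F unfolding minimal_resolution_def ideal_gen_range_var by blast+
  have aug: "aug_map F ` free_mod F 0 = ?J"
    and ex0: "diff_map F 0 ` free_mod F 1 = {v \<in> free_mod F 0. aug_map F v = 0}"
    and ex1: "diff_map F 1 ` free_mod F 2 = {v \<in> free_mod F 1. diff_map F 0 v = (\<lambda>_. 0)}"
    using rs unfolding resolves_def by (auto simp: numeral_2_eq_2)
  have dconst: "lookup (diff_map F k v i) 0 = 0" for k v i
    by (auto simp: diff_map_def lookup_sum intro!: sum.neutral lookup_times_0 mn)
  have ker0: "lookup (v i) 0 = 0" if "v \<in> free_mod F 0" "aug_map F v = 0" for v i
  proof -
    have "v \<in> diff_map F 0 ` free_mod F 1" unfolding ex0 using that by blast
    then show ?thesis using dconst by auto
  qed
  have ker1: "lookup (v i) 0 = 0" if "v \<in> free_mod F 1" "diff_map F 0 v = (\<lambda>_. 0)" for v i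
  proof -
    have "v \<in> diff_map F 1 ` free_mod F 2" unfolding ex1 using that by blast
    then show ?thesis using dconst by auto
  qed
  define d where "d = fdeg F 0"
  define f where "f = fdeg F 1"
  define \<gamma> where "\<gamma> j = lookup (faug F j) (d j)" for j
  have fa: "faug F j = single (d j) (\<gamma> j)" if "j < ?r0" for j
  proof (rule poly_mapping_eqI)
    fix m
    show "lookup (faug F j) m = lookup (single (d j) (\<gamma> j)) m"
    proof (cases "m = d j")
      case False
      then have "m \<notin> keys (faug F j)" using mg that unfolding multigraded_def d_def by blast
      then show ?thesis using False by (simp add: in_keys_iff lookup_single when_def)
    qed (simp add: \<gamma>_def)
  qed
  have \<gamma>0: "\<gamma> k \<noteq> 0" if k: "k < ?r0" for k
  proof
    assume "\<gamma> k = 0"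
    let ?e = "\<lambda>j. if j = k then 1 else (0 :: ('v, 'k) mpoly)"
    have "?e \<in> free_mod F 0" using k by (auto simp: free_mod_def)
    moreover have "aug_map F ?e = 0"
      unfolding aug_map_def unit_vector_sum[OF k] using fa[OF k] \<open>\<gamma> k = 0\<close> by simp
    ultimately have "lookup (?e k) 0 = 0" by (rule ker0)
    then show False by simp
  qed
  \<comment> \<open>The syzygy of two terms in degree a; the coefficients are exchanged so that the
    two images cancel.\<close>
  have syz: "\<exists>v\<in>free_mod F 0. aug_map F v = 0 \<and> v k = single (a - d k) (\<gamma> l)"
    if kl: "k < ?r0" "l < ?r0" "k \<noteq> l" "d k \<preceq> a" "d l \<preceq> a" for k l a
  proof
    let ?v = "\<lambda>j. if j = k then single (a - d k) (\<gamma> l) else if j = l then single (a - d l) (- \<gamma> k) else 0"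
    show "?v \<in> free_mod F 0" using kl by (auto simp: free_mod_def)
    have "aug_map F ?v = 0"
      unfolding aug_map_def pair_vector_sum[OF kl(1-3)] fa[OF kl(1)] fa[OF kl(2)] mult_single
        dv_minus_add[OF kl(4)] dv_minus_add[OF kl(5)] single_add[symmetric] by simp
    then show "aug_map F ?v = 0 \<and> ?v k = single (a - d k) (\<gamma> l)" by simp
  qed
  \<comment> \<open>If one degree divided another, the syzygy of the two would have a nonzero
    constant entry.\<close>
  have d_anti: "k = l" if kl: "k < ?r0" "l < ?r0" "d l \<preceq> d k" for k l
  proof (rule ccontr)
    assume "k \<noteq> l"
    then obtain v where v: "v \<in> free_mod F 0" "aug_map F v = 0" "v k = single (d k - d k) (\<gamma> l)"
      using syz[OF kl(1,2) _ dv_refl kl(3)] by blast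
    then have "lookup (v k) 0 = \<gamma> l" by simp
    then show False using ker0[OF v(1,2), of k] \<gamma>0[OF kl(2)] by simp
  qed
  have dS: "d ` {..<?r0} = S"
  proof (rule antichain_up_unique[OF _ S])
    show "antichain (d ` {..<?r0})" using d_anti unfolding antichain_def by auto
    show "up (d ` {..<?r0}) = up S"
    proof (intro set_eqI iffI)
      fix a assume "a \<in> up (d ` {..<?r0})"
      then obtain k where k: "k < ?r0" "d k \<preceq> a" by (auto simp: up_def)
      let ?e = "\<lambda>j. if j = k then single (a - d k) (inverse (\<gamma> k)) else 0"
      have "?e \<in> free_mod F 0" using k by (auto simp: free_mod_def)
      then have "aug_map F ?e \<in> ?J" unfolding aug[symmetric] by (rule imageI)
      moreover have "aug_map F ?e = monom a"
        unfolding aug_map_def unit_vector_sum[OF k(1)] fa[OF k(1)] mult_single dv_minus_add[OF k(2)]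
        using \<gamma>0[OF k(1)] by (simp add: monom_def)
      ultimately show "a \<in> up S" by (simp add: monom_in_mon_ideal)
    next
      fix a assume "a \<in> up S"
      then have "(monom a :: ('v, 'k) mpoly) \<in> ?J" by (simp add: monom_in_mon_ideal)
      then obtain v where v: "monom a = aug_map F v" unfolding aug[symmetric] by (rule imageE)
      have "aug_map F v \<in> mon_ideal UNIV (d ` {..<?r0})"
        unfolding aug_map_def
      proof (rule mon_ideal_sum, rule mon_ideal_mult)
        fix j assume j: "j \<in> {..<?r0}"
        then have "d j \<in> up (d ` {..<?r0})" by (intro in_up imageI)
        then show "faug F j \<in> mon_ideal UNIV (d ` {..<?r0})"
          using fa[of j] j by (auto simp: mon_ideal_def)
      qed simp
      then show "a \<in> up (d ` {..<?r0})" unfolding v[symmetric] by (simp add: monom_in_mon_ideal)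
    qed
  qed
  have hom: "m + d i = f l" if "i < ?r0" "l < ?r1" "m \<in> keys (fdiff F 0 i l)" for i l m
    using mg that unfolding multigraded_def d_def f_def by auto
  have "up (f ` {..<?r1}) = U2 S"
  proof (intro set_eqI iffI)
    fix a assume "a \<in> U2 S"
    then obtain s t where st: "s \<in> S" "t \<in> S" "s \<noteq> t" "s \<preceq> a" "t \<preceq> a" by (auto simp: U2_def)
    obtain k where k: "k < ?r0" "s = d k" using st(1) dS by blast
    obtain l where l: "l < ?r0" "t = d l" using st(2) dS by blast
    have "k \<noteq> l" using st k l by auto
    then obtain v where v: "v \<in> free_mod F 0" "aug_map F v = 0" "v k = single (a - d k) (\<gamma> l)"
      using syz[OF k(1) l(1)] st k l by blast
    then have "v \<in> diff_map F 0 ` free_mod F 1" unfolding ex0 by blast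
    then obtain w where w: "v = diff_map F 0 w" by blast
    have "v k = (\<Sum>j<?r1. w j * fdiff F 0 k j)" unfolding w diff_map_def using k(1) by simp
    moreover have "lookup (v k) (a - d k) \<noteq> 0" using v(3) \<gamma>0[OF l(1)] by simp
    ultimately obtain j where j: "j < ?r1" "lookup (w j * fdiff F 0 k j) (a - d k) \<noteq> 0"
      by (auto simp: lookup_sum elim: sum.not_neutral_contains_not_neutral)
    then have "a - d k \<in> keys (w j * fdiff F 0 k j)" by (simp add: in_keys_iff)
    then obtain m1 m2 where m: "a - d k = m1 + m2" "m2 \<in> keys (fdiff F 0 k j)"
      using keys_mult[of "w j" "fdiff F 0 k j"] by blast
    have "a = m1 + f j"
      using dv_minus_add[of "d k" a] st(4) k(2) m(1) hom[OF k(1) j(1) m(2)] by (metis add.assoc)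
    then have "f j \<preceq> a" by simp
    then show "a \<in> up (f ` {..<?r1})" using j(1) by (auto simp: up_def)
  next
    fix a assume "a \<in> up (f ` {..<?r1})"
    then obtain l where l: "l < ?r1" "f l \<preceq> a" by (auto simp: up_def)
    let ?e = "\<lambda>j. if j = l then 1 else (0 :: ('v, 'k) mpoly)"
    have eF: "?e \<in> free_mod F 1" using l by (auto simp: free_mod_def)
    have col: "diff_map F 0 ?e i = fdiff F 0 i l" if "i < ?r0" for i
      unfolding diff_map_def using that unit_vector_sum[of l ?r1 1 "\<lambda>j. fdiff F 0 i j"] l(1) by simp
    \<comment> \<open>A zero column would put a basis element, with its constant entry 1, into the
      kernel.\<close>
    have "diff_map F 0 ?e \<noteq> (\<lambda>_. 0)" using ker1[OF eF, of l] by auto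
    then obtain i where i: "diff_map F 0 ?e i \<noteq> 0" by auto
    then have ir: "i < ?r0" by (auto simp: diff_map_def split: if_splits)
    have dvi: "d i \<preceq> f l" if "i < ?r0" "fdiff F 0 i l \<noteq> 0" for i
    proof -
      have "keys (fdiff F 0 i l) \<noteq> {}" using that(2) by simp
      then obtain m where "m \<in> keys (fdiff F 0 i l)" by blast
      then show ?thesis using hom[OF that(1) l(1)] by (metis dv_add(2))
    qed
    have fi: "fdiff F 0 i l \<noteq> 0" using i col[OF ir] by simp
    have "diff_map F 0 ?e \<in> {v \<in> free_mod F 0. aug_map F v = 0}" unfolding ex0[symmetric] using eF by (rule imageI)
    then have sum0: "(\<Sum>j<?r0. fdiff F 0 j l * faug F j) = 0"
      using col by (simp add: aug_map_def)
    \<comment> \<open>A single nonzero entry would multiply a nonzero term to 0.\<close>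
    have "\<exists>j<?r0. j \<noteq> i \<and> fdiff F 0 j l \<noteq> 0"
    proof (rule ccontr)
      assume "\<not> ?thesis"
      then have "(\<Sum>j<?r0. fdiff F 0 j l * faug F j) = (\<Sum>j\<in>{i}. fdiff F 0 j l * faug F j)"
        using ir by (intro sum.mono_neutral_right) auto
      then have z: "fdiff F 0 i l * single (d i) (\<gamma> i) = 0" using sum0 fa[OF ir] by simp
      obtain m where m: "lookup (fdiff F 0 i l) m \<noteq> 0" using fi by (metis lookup_zero poly_mapping_eqI)
      have "lookup (fdiff F 0 i l * single (d i) (\<gamma> i)) (m + d i) = lookup (fdiff F 0 i l) m * \<gamma> i"
        by (simp add: lookup_times_single)
      then show False using z m \<gamma>0[OF ir] by simp
    qed
    then obtain j where j: "j < ?r0" "j \<noteq> i" "fdiff F 0 j l \<noteq> 0" by blast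
    have "d i \<preceq> a" "d j \<preceq> a" using dvi[OF ir fi] dvi[OF j(1,3)] l(2) dv_trans by blast+
    moreover have "d i \<in> S" "d j \<in> S" using dS ir j(1) by blast+
    moreover have "d i \<noteq> d j" using d_anti[OF j(1) ir] j(2) by auto
    ultimately show "a \<in> U2 S" unfolding U2_def by blast
  qed
  then show ?thesis by (simp add: f_def)
qed

text \<open>The computation holds for every minimal resolution; since one exists, it holds for the
  one that \<open>betti\<close> chooses.\<close>

theorem HS_1_mon_ideal:
  fixes S :: "'v::finite expo set"
  assumes S: "antichain S"
  shows "HS 1 (mon_ideal UNIV S) = (mon_ideal UNIV (U2 S) :: ('v, 'k::field) mpoly set)"
proof -
  let ?J = "mon_ideal UNIV S :: ('v, 'k) mpoly set"
  define F where "F = (SOME F. minimal_resolution F ?J)"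
  have F: "minimal_resolution F ?J"
    unfolding F_def by (rule someI_ex) (rule minimal_resolution_exists)
  have "betti 1 a ?J \<noteq> 0 \<longleftrightarrow> a \<in> fdeg F 1 ` {..<frank F 1}" for a
    by (auto simp: betti_def F_def[symmetric] Let_def card_eq_0_iff)
  then have "{monom a | a. betti 1 a ?J \<noteq> 0} = (monom ` fdeg F 1 ` {..<frank F 1} :: ('v, 'k) mpoly set)"
    by auto
  then have "HS 1 ?J = mon_ideal UNIV (fdeg F 1 ` {..<frank F 1})"
    by (simp only: HS_def ideal_gen_monom_UNIV)
  also have "\<dots> = mon_ideal UNIV (U2 S)"
    by (rule mon_ideal_cong_up) (simp only: minimal_resolution_HS1[OF F S] up_U2)
  finally show ?thesis .
qed

section \<open>Induced subgraphs\<close>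

lemma edge_ideal_mon_ideal:
  assumes "verts D = UNIV"
  shows "edge_ideal D = (mon_ideal UNIV (edge_expo (weight D) ` edges D) :: ('v, 'k::field) mpoly set)"
proof -
  have pow: "(var v :: ('v, 'k) mpoly) ^ n = monom (single v n)" for v n
  proof (induction n)
    case (Suc n)
    have "ev v + single v n = single v (Suc n)"
      by (rule poly_mapping_eqI) (simp add: lookup_add lookup_ev lookup_single when_def)
    then show ?case using Suc by (simp add: var_eq monom_mult)
  qed (simp add: monom_0)
  have eq: "(var u :: ('v, 'k) mpoly) * var v ^ weight D v = monom (edge_expo (weight D) (u, v))" for u v
    by (simp only: pow) (simp add: var_eq monom_mult edge_expo_def)
  have "{var u * var v ^ weight D v | u v. (u, v) \<in> edges D} =
      (monom ` edge_expo (weight D) ` edges D :: ('v, 'k) mpoly set)"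
    unfolding eq image_image by (auto intro: rev_image_eqI)
  then show ?thesis unfolding edge_ideal_def assms by (simp only: ideal_gen_monom_UNIV)
qed

locale full_graph =
  fixes D :: "'v::finite wograph"
  assumes wog: "weighted_oriented_graph D" and verts: "verts D = UNIV"
begin

sublocale weighted_graph "edges D" "weight D"
  using wog by unfold_locales (auto simp: weighted_oriented_graph_def verts Suc_le_eq)

lemma weight_induced: "(u, v) \<in> edges (induced D A) \<Longrightarrow> weight (induced D A) v = weight D v"
  by (auto simp: induced_def Let_def)

lemma edges_induced: "edges (induced D A) = edges D \<inter> (A \<times> A)"
  by (simp add: induced_def Let_def)

lemma verts_induced: "verts (induced D A) = A"
  by (simp add: induced_def Let_def)

lemma weight_induced_source: "(\<And>u. (u, v) \<notin> edges (induced D A)) \<Longrightarrow> weight (induced D A) v = 1"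
  by (auto simp: induced_def Let_def)

lemma not_adj_induced:
  assumes "edges D \<inter> (A \<times> A) = B" "u \<in> A" "v \<in> A" "(u, v) \<notin> B" "(v, u) \<notin> B"
  shows "\<not> adj (edges D) u v"
  using assms by (auto simp: adj_def)

text \<open>An induced subgraph inherits the weights of heads of its edges, and every weight
  constrained in D_6 belongs to a head.\<close>

lemma has_induced_D6: "has_induced D is_D6 \<longleftrightarrow> \<not> path6_free (edges D) (weight D)"
proof
  assume "has_induced D is_D6"
  then obtain A a b c d where dist: "distinct [a, b, c, d]" and A: "A = {a, b, c, d}"
    and E: "edges (induced D A) = {(a, b), (b, c), (c, d)}"
    and W: "1 < weight (induced D A) b" "weight (induced D A) c = 1" "1 < weight (induced D A) d"
    unfolding has_induced_def is_D6_def verts_induced by blast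
  have "weight (induced D A) b = weight D b" "weight (induced D A) c = weight D c"
    "weight (induced D A) d = weight D d"
    using weight_induced[of a b A] weight_induced[of b c A] weight_induced[of c d A] E by auto
  then have w: "1 < weight D b" "weight D c = 1" "1 < weight D d" using W by auto
  have "(a, b) \<in> edges D" "(b, c) \<in> edges D" "(c, d) \<in> edges D"
    using E unfolding edges_induced by blast+
  moreover have "\<not> adj (edges D) a c" "\<not> adj (edges D) a d" "\<not> adj (edges D) b d"
    using not_adj_induced[OF E[unfolded edges_induced]] dist A by auto
  ultimately show "\<not> path6_free (edges D) (weight D)" using dist w unfolding path6_free_def by blast
next
  assume "\<not> path6_free (edges D) (weight D)"
  then obtain a b c d where h: "distinct [a, b, c, d]" "(a, b) \<in> edges D" "(b, c) \<in> edges D" "(c, d) \<in> edges D"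
    "1 < weight D b" "weight D c = 1" "1 < weight D d"
    "\<not> adj (edges D) a c" "\<not> adj (edges D) a d" "\<not> adj (edges D) b d"
    unfolding path6_free_def by blast
  let ?A = "{a, b, c, d}"
  have E: "edges (induced D ?A) = {(a, b), (b, c), (c, d)}"
    using h asym[OF h(2)] asym[OF h(3)] asym[OF h(4)] irrefl by (auto simp: edges_induced adj_def)
  have "weight (induced D ?A) b = weight D b" "weight (induced D ?A) c = weight D c"
    "weight (induced D ?A) d = weight D d"
    using weight_induced[of a b ?A] weight_induced[of b c ?A] weight_induced[of c d ?A] E by auto
  then have "is_D6 (induced D ?A)"
    unfolding is_D6_def verts_induced E using h by (intro exI[of _ a] exI[of _ b] exI[of _ c] exI[of _ d]) simp
  then show "has_induced D is_D6" unfolding has_induced_def verts by blast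
qed

lemma has_induced_D7: "has_induced D is_D7 \<longleftrightarrow> \<not> cycle7_free (edges D) (weight D)"
proof
  assume "has_induced D is_D7"
  then obtain A a b c where dist: "distinct [a, b, c]" and A: "A = {a, b, c}"
    and E: "edges (induced D A) = {(a, b), (b, c), (c, a)}"
    and W: "weight (induced D A) a = 1" "2 < weight (induced D A) b" "2 < weight (induced D A) c"
    unfolding has_induced_def is_D7_def verts_induced by blast
  have "weight (induced D A) b = weight D b" "weight (induced D A) c = weight D c"
    "weight (induced D A) a = weight D a"
    using weight_induced[of a b A] weight_induced[of b c A] weight_induced[of c a A] E by auto
  then have w: "weight D a = 1" "2 < weight D b" "2 < weight D c" using W by auto
  have "(a, b) \<in> edges D" "(b, c) \<in> edges D" "(c, a) \<in> edges D"
    using E unfolding edges_induced by blast+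
  then show "\<not> cycle7_free (edges D) (weight D)" using w unfolding cycle7_free_def by (meson not_le)
next
  assume "\<not> cycle7_free (edges D) (weight D)"
  then obtain a b c where h: "(a, b) \<in> edges D" "(b, c) \<in> edges D" "(c, a) \<in> edges D"
    "weight D a = 1" "2 < weight D b" "2 < weight D c"
    unfolding cycle7_free_def by (meson not_le)
  let ?A = "{a, b, c}"
  have dist: "distinct [a, b, c]" using h irrefl by auto
  have E: "edges (induced D ?A) = {(a, b), (b, c), (c, a)}"
    using h asym[OF h(1)] asym[OF h(2)] asym[OF h(3)] irrefl by (auto simp: edges_induced)
  have "weight (induced D ?A) b = weight D b" "weight (induced D ?A) c = weight D c"
    "weight (induced D ?A) a = weight D a"
    using weight_induced[of a b ?A] weight_induced[of b c ?A] weight_induced[of c a ?A] E by auto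
  then have "is_D7 (induced D ?A)"
    unfolding is_D7_def verts_induced E using h dist by (intro exI[of _ a] exI[of _ b] exI[of _ c]) simp
  then show "has_induced D is_D7" unfolding has_induced_def verts by blast
qed

text \<open>The tail of the middle edge becomes a source of the induced path and gets weight 1
  there, whatever its weight in D; the other three weights belong to heads and are
  inherited.\<close>

lemma has_induced_D8: "has_induced D is_D8 \<longleftrightarrow> \<not> path8_free (edges D) (weight D)"
proof
  assume "has_induced D is_D8"
  then obtain A where "is_D8 (induced D A)" by (auto simp: has_induced_def)
  then obtain a b c d where dist: "distinct [a, b, c, d]" and A: "A = {a, b, c, d}"
    and E: "edges (induced D A) = {(b, a), (c, d), (b, c)} \<or> edges (induced D A) = {(b, a), (c, d), (c, b)}"
    and W: "1 < weight (induced D A) a" "weight (induced D A) b = 1" "weight (induced D A) c = 1"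
      "1 < weight (induced D A) d"
    unfolding is_D8_def verts_induced by - (elim exE, elim conjE, rule that)
  have "weight (induced D A) a = weight D a" "weight (induced D A) d = weight D d"
    using weight_induced[of b a A] weight_induced[of c d A] E by auto
  then have w: "1 < weight D a" "1 < weight D d" using W by auto
  have bc: "(b, c) \<in> edges D \<and> weight D c = 1 \<or> (c, b) \<in> edges D \<and> weight D b = 1"
  proof -
    have "(b, c) \<in> edges (induced D A) \<or> (c, b) \<in> edges (induced D A)" using E by auto
    then show ?thesis using W weight_induced[of b c A] weight_induced[of c b A] by (auto simp: edges_induced)
  qed
  have "(b, a) \<in> edges (induced D A)" "(c, d) \<in> edges (induced D A)" using E by auto
  then have "(b, a) \<in> edges D" "(c, d) \<in> edges D" by (auto simp: edges_induced)
  moreover have "\<not> adj (edges D) a c" "\<not> adj (edges D) a d" "\<not> adj (edges D) b d"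
    using E unfolding edges_induced by (elim disjE; use not_adj_induced dist A in \<open>auto simp: adj_def\<close>)+
  ultimately show "\<not> path8_free (edges D) (weight D)" using dist w bc unfolding path8_free_def by blast
next
  assume "\<not> path8_free (edges D) (weight D)"
  then obtain a b c d where h: "distinct [a, b, c, d]" "(b, a) \<in> edges D" "(c, d) \<in> edges D"
    "(b, c) \<in> edges D \<and> weight D c = 1 \<or> (c, b) \<in> edges D \<and> weight D b = 1"
    "1 < weight D a" "1 < weight D d"
    "\<not> adj (edges D) a c" "\<not> adj (edges D) a d" "\<not> adj (edges D) b d"
    unfolding path8_free_def by blast
  let ?A = "{a, b, c, d}"
  have "\<exists>e. (e = (b, c) \<or> e = (c, b)) \<and> edges (induced D ?A) = {(b, a), (c, d), e} \<and>
    weight (induced D ?A) b = 1 \<and> weight (induced D ?A) c = 1"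
    using h(4)
  proof
    assume bc: "(b, c) \<in> edges D \<and> weight D c = 1"
    then have E: "edges (induced D ?A) = {(b, a), (c, d), (b, c)}"
      using h asym[OF h(2)] asym[OF h(3)] asym[of b c] irrefl by (auto simp: edges_induced adj_def)
    moreover have "weight (induced D ?A) c = 1" using weight_induced[of b c ?A] E bc by auto
    moreover have "weight (induced D ?A) b = 1" by (rule weight_induced_source) (use E h(1) in auto)
    ultimately show ?thesis by blast
  next
    assume bc: "(c, b) \<in> edges D \<and> weight D b = 1"
    then have E: "edges (induced D ?A) = {(b, a), (c, d), (c, b)}"
      using h asym[OF h(2)] asym[OF h(3)] asym[of c b] irrefl by (auto simp: edges_induced adj_def)
    moreover have "weight (induced D ?A) b = 1" using weight_induced[of c b ?A] E bc by auto
    moreover have "weight (induced D ?A) c = 1" by (rule weight_induced_source) (use E h(1) in auto)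
    ultimately show ?thesis by blast
  qed
  then obtain e where e: "e = (b, c) \<or> e = (c, b)" and E: "edges (induced D ?A) = {(b, a), (c, d), e}"
    and wbc: "weight (induced D ?A) b = 1" "weight (induced D ?A) c = 1" by blast
  have "weight (induced D ?A) a = weight D a" "weight (induced D ?A) d = weight D d"
    using weight_induced[of b a ?A] weight_induced[of c d ?A] E by auto
  then have "is_D8 (induced D ?A)"
    unfolding is_D8_def verts_induced E using h e wbc
    by (intro exI[of _ a] exI[of _ b] exI[of _ c] exI[of _ d]) auto
  then show "has_induced D is_D8" unfolding has_induced_def verts by blast
qed

end

theorem theorem3p15:
  fixes D :: "'v::finite wograph" and x1 :: 'v
    and I I1 I2 :: "('v, 'k::field) mpoly set"
  assumes "weighted_oriented_graph D" and "verts D = UNIV"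
    and "I = edge_ideal D"
    and "vertex_splittable UNIV I"
    and "vertex_splitting UNIV x1 I1 I2 I"
  shows "linear_quotients (HS 1 I) \<longleftrightarrow>
           \<not> has_induced D is_D6 \<and> \<not> has_induced D is_D7 \<and> \<not> has_induced D is_D8"
proof -
  interpret full_graph D by unfold_locales fact+
  define S where "S = edge_expo (weight D) ` edges D"
  have S: "antichain S" unfolding S_def by (rule antichain_edge_expo) simp
  have I: "I = mon_ideal UNIV S" unfolding S_def assms(3) by (rule edge_ideal_mon_ideal[OF assms(2)])
  obtain T where T: "I = mon_ideal UNIV T" "antichain T" "vsplit T"
    using vertex_splittable_vsplit[OF assms(4)] by blast
  \<comment> \<open>The recursion yields some antichain of generators; uniqueness identifies it with
    the generators of the edges.\<close>
  have "up T = up S" by (rule mon_ideal_eqD[OF T(1)[unfolded I, symmetric]]) simp_all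
  then have vs: "vsplit S" using antichain_up_unique[OF T(2) S] T(3) by simp
  have HS: "HS 1 I = mon_ideal UNIV (U2 S)" unfolding I by (rule HS_1_mon_ideal[OF S])
  have "linear_quotients (HS 1 I)"
    if "path6_free (edges D) (weight D)" "cycle7_free (edges D) (weight D)" "path8_free (edges D) (weight D)"
  proof -
    have "lqs (Mins (U2 S))"
      by (rule vsplit_edges_lqs[OF vs weighted_graph_axioms S_def that])
    then have "linear_quotients (mon_ideal UNIV (Mins (U2 S)) :: ('v, 'k) mpoly set)"
      by (rule lqs_linear_quotients[OF _ antichain_Mins])
    then show ?thesis unfolding HS by (simp only: mon_ideal_cong_up[OF up_Mins])
  qed
  moreover have "path6_free (edges D) (weight D) \<and> cycle7_free (edges D) (weight D) \<and> path8_free (edges D) (weight D)"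
    if "linear_quotients (HS 1 I)"
    using that lq_path6_free lq_cycle7_free lq_path8_free unfolding HS S_def by blast
  ultimately show ?thesis unfolding has_induced_D6 has_induced_D7 has_induced_D8 by blast
qed

end
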